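(* Let $G$ be an infinite discrete countable group, $(X,\mu,G)$ a $G$-measure preserving system and $\alpha$ a finite partition of $X$ into sets of $\mathcal{B}_X^\mu$. Then $h^*_\mu(G,\alpha)=H_\mu(\alpha\mid\mathcal{K}_\mu(G))$.
   Context: $(X,\mu,G)$: compact metric space with $G$ acting by homeomorphisms and $G$-invariant Borel probability $\mu$; $\mathcal{B}_X^\mu$ is the $\mu$-completed Borel $\sigma$-algebra; $U_gf(x)=f(gx)$. Kronecker $\sigma$-algebra: $\mathcal{K}_\mu(G)=\{B\in\mathcal{B}_X^\mu:\{U_g1_B:g\in G\}\text{ precompact in }L^2(\mu)\}$. For a sub-$\sigma$-algebra $\mathcal{F}$, $H_\mu(\alpha\mid\mathcal{F})=\sum_{A\in\alpha}\int_X-\mathbb{E}_\mu(1_A|\mathcal{F})\log\mathbb{E}_\mu(1_A|\mathcal{F})\,d\mu$. For a sequence $\mathcal{A}=(g_n)$ in $G$, $h^{\mathcal{A}}_\mu(G,\alpha)=\limsup_n\frac1nH_\mu(\bigvee_{i=1}^ng_i^{-1}\alpha)$ with $H_\mu(\beta)=-\sum_{C\in\beta}\mu(C)\log\mu(C)$, and $h^*_\mu(G,\alpha)=\sup_{\mathcal{A}}h^{\mathcal{A}}_\mu(G,\alpha)$ over all sequences in $G$. *)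

theory Defs
  imports "HOL-Probability.Probability" "HOL-Algebra.Group"
begin

definition orbit_L2_precompact ::
  "'x measure \<Rightarrow> ('g, 'b) monoid_scheme \<Rightarrow> ('g \<Rightarrow> 'x \<Rightarrow> 'x) \<Rightarrow> 'x set \<Rightarrow> bool" where
  "orbit_L2_precompact N G act B \<longleftrightarrow>
     (\<forall>s::nat \<Rightarrow> 'g. (\<forall>n. s n \<in> carrier G) \<longrightarrow>
        (\<exists>r (f::'x \<Rightarrow> real). strict_mono r \<and> f \<in> borel_measurable N \<and> integrable N (\<lambda>x. (f x)\<^sup>2) \<and>
           (\<lambda>n. \<integral>x. (indicator B (act (s (r n)) x) - f x)\<^sup>2 \<partial>N) \<longlonglongrightarrow> 0))"

text \<open>Kronecker collection K_mu(G) (N is the completed measure).\<close>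
definition kronecker_sets ::
  "'x measure \<Rightarrow> ('g, 'b) monoid_scheme \<Rightarrow> ('g \<Rightarrow> 'x \<Rightarrow> 'x) \<Rightarrow> 'x set set" where
  "kronecker_sets N G act = {B \<in> sets N. orbit_L2_precompact N G act B}"

text \<open>The Kronecker sigma-algebra as a measurable space (sigma generated; it equals the
  collection itself, the collection being a sigma-algebra).\<close>
definition kronecker_algebra ::
  "'x measure \<Rightarrow> ('g, 'b) monoid_scheme \<Rightarrow> ('g \<Rightarrow> 'x \<Rightarrow> 'x) \<Rightarrow> 'x measure" where
  "kronecker_algebra N G act = sigma (space N) (kronecker_sets N G act)"

definition cond_entropy :: "'x measure \<Rightarrow> 'x set set \<Rightarrow> 'x measure \<Rightarrow> real" where
  "cond_entropy N \<alpha> F =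
     (\<Sum>A\<in>\<alpha>. \<integral>x. - real_cond_exp N F (indicator A) x * ln (real_cond_exp N F (indicator A) x) \<partial>N)"

definition part_entropy :: "'x measure \<Rightarrow> 'x set set \<Rightarrow> real" where
  "part_entropy N \<beta> = - (\<Sum>C\<in>\<beta>. measure N C * ln (measure N C))"

definition join_pullbacks ::
  "'x set \<Rightarrow> ('g \<Rightarrow> 'x \<Rightarrow> 'x) \<Rightarrow> (nat \<Rightarrow> 'g) \<Rightarrow> nat \<Rightarrow> 'x set set \<Rightarrow> 'x set set" where
  "join_pullbacks X act s n \<alpha> =
     {X \<inter> (\<Inter>i\<in>{1..n}. act (s i) -` c i) | c. \<forall>i\<in>{1..n}. c i \<in> \<alpha>}"

text \<open>Sequence entropy h^A_mu(G,alpha) along the sequence (g_n) = s (index 0 unused).\<close>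
definition seq_entropy ::
  "'x measure \<Rightarrow> ('g \<Rightarrow> 'x \<Rightarrow> 'x) \<Rightarrow> (nat \<Rightarrow> 'g) \<Rightarrow> 'x set set \<Rightarrow> ereal" where
  "seq_entropy N act s \<alpha> =
     limsup (\<lambda>n. ereal (part_entropy N (join_pullbacks (space N) act s n \<alpha>) / real n))"

definition max_seq_entropy ::
  "'x measure \<Rightarrow> ('g, 'b) monoid_scheme \<Rightarrow> ('g \<Rightarrow> 'x \<Rightarrow> 'x) \<Rightarrow> 'x set set \<Rightarrow> ereal" where
  "max_seq_entropy N G act \<alpha> =
     (SUP s \<in> {s :: nat \<Rightarrow> 'g. \<forall>n. s n \<in> carrier G}. seq_entropy N act s \<alpha>)"

end

theory Submission
  imports Defs "HOL-Library.Diagonal_Subsequence"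
begin

text \<open>\<open>G\<close> is an arbitrary group, so there are no ergodic averages to work with;
  minimising a norm over a convex hull takes their place. The tensor square is used because a
  squared correlation of a translate of \<open>f\<close> with \<open>h\<close> is quadratic in
  \<open>f\<close> but affine in the kernel: it is the quadratic form of the translated kernel at
  \<open>h\<close>. A lower bound valid for every group element therefore survives convex
  combinations and norm limits, which would fail for the correlations themselves, since these may
  cancel.

  The minimal kernel is never constructed. A minimising sequence is Cauchy in the Hilbert-Schmidt
  norm and asymptotically invariant, and only the functions obtained by applying its operators to a
  fixed function need a limit. Completeness of the square-integrable functions of one variable is
  then enough.

  The lower bound needs one group element that decorrelates all cells of \<alpha> from all cells of
  a partition at once. This is why the vanishing of correlations is stated for a finite family, as a
  sum of squares over the family and over the test functions.\<close>

text \<open>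
  The functions with totally bounded \<open>L\<^sup>2\<close>-orbit are measurable for the Kronecker algebra \<open>\<K>\<close>.
  If \<open>f\<close> is orthogonal to all of them, then its translates become almost orthogonal to any finite set
  of test functions along suitable group elements: otherwise the element of minimal norm in the closed
  convex hull of the orbit of \<open>f \<otimes> f\<close> would be a nonzero invariant kernel, and the compact operator it
  defines commutes with the action, so its range consists of functions with totally bounded orbit;
  but the kernel is a limit of combinations of translates of \<open>f \<otimes> f\<close>, so the range is also orthogonal to
  these functions and the operator is zero.

  Lower bound: applying this to \<open>1\<^sub>A - E(1\<^sub>A | \<K>)\<close>, one finds, for any finite partition \<open>\<beta>\<close>, some \<open>g\<close> such
  that \<open>\<mu>(g\<^sup>-\<^sup>1A \<inter> C)\<close> is close to the integral of \<open>U\<^sub>g E(1\<^sub>A | \<K>)\<close> over each \<open>C \<in> \<beta>\<close>; by Jensen's inequality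
  \<open>g\<^sup>-\<^sup>1\<alpha>\<close> then adds almost \<open>H(\<alpha> | \<K>)\<close> to the entropy of \<open>\<beta>\<close>.

  Upper bound: approximate \<open>\<K>\<close> by a finite partition \<open>\<beta>\<close> with \<open>H(\<alpha> | \<beta>) \<le> H(\<alpha> | \<K>) + \<epsilon>\<close>. Up to small errors
  the translates of \<open>\<beta>\<close> take finitely many positions, so along any sequence they contribute bounded
  entropy, and the translates of \<open>\<alpha>\<close> at most \<open>H(\<alpha> | \<beta>) + \<epsilon>\<close> each.
\<close>

section \<open>Square-integrable functions\<close>

text \<open>Functions rather than classes modulo null sets, so that they can be composed with the
  action pointwise; \<open>l2norm\<close> is accordingly a seminorm.\<close>

definition L2 :: "'x measure \<Rightarrow> ('x \<Rightarrow> real) set" where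
  "L2 M = {f \<in> borel_measurable M. integrable M (\<lambda>x. (f x)\<^sup>2)}"

definition l2norm :: "'x measure \<Rightarrow> ('x \<Rightarrow> real) \<Rightarrow> real" where
  "l2norm M f = sqrt (\<integral>x. (f x)\<^sup>2 \<partial>M)"

lemma L2_measurable: "f \<in> L2 M \<Longrightarrow> f \<in> borel_measurable M"
  and L2_integrable_sq: "f \<in> L2 M \<Longrightarrow> integrable M (\<lambda>x. (f x)\<^sup>2)"
  by (auto simp: L2_def)

section \<open>Seminorm inequalities and completeness\<close>

lemma L2_integrable_mult:
  assumes "f \<in> L2 M" "g \<in> L2 M"
  shows "integrable M (\<lambda>x. f x * g x)"
proof (rule Bochner_Integration.integrable_bound)
  show "integrable M (\<lambda>x. (f x)\<^sup>2 + (g x)\<^sup>2)"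
    using assms by (auto simp: L2_def)
  show "(\<lambda>x. f x * g x) \<in> borel_measurable M"
    using assms by (auto simp: L2_def)
  have "\<bar>f x * g x\<bar> \<le> (f x)\<^sup>2 + (g x)\<^sup>2" for x
    using sum_squares_bound[of "f x" "g x"] sum_squares_bound[of "f x" "- g x"]
      zero_le_power2[of "f x"] zero_le_power2[of "g x"] by (simp add: abs_if)
  then show "AE x in M. norm (f x * g x) \<le> norm ((f x)\<^sup>2 + (g x)\<^sup>2)"
    by auto
qed

lemma L2_add:
  assumes "f \<in> L2 M" "g \<in> L2 M"
  shows "(\<lambda>x. f x + g x) \<in> L2 M"
  using assms L2_integrable_mult[OF assms]
  by (auto simp: L2_def power2_sum mult.assoc)

lemma L2_cmult: "f \<in> L2 M \<Longrightarrow> (\<lambda>x. c * f x) \<in> L2 M"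
  by (auto simp: L2_def power_mult_distrib)

lemma L2_diff:
  assumes "f \<in> L2 M" "g \<in> L2 M"
  shows "(\<lambda>x. f x - g x) \<in> L2 M"
  using L2_add[OF assms(1) L2_cmult[OF assms(2), of "-1"]] by simp

lemma l2norm_nonneg [simp]: "0 \<le> l2norm M f"
  by (simp add: l2norm_def)

lemma l2norm_sq: "(l2norm M f)\<^sup>2 = (\<integral>x. (f x)\<^sup>2 \<partial>M)"
  by (simp add: l2norm_def)

lemma l2norm_minus_commute: "l2norm M (\<lambda>x. f x - g x) = l2norm M (\<lambda>x. g x - f x)"
  by (simp add: l2norm_def power2_commute)

text \<open>The integral of \<open>(t * f - g)\<^sup>2\<close> is a nonnegative quadratic polynomial
  in \<open>t\<close>; evaluate it at its minimum. If the leading coefficient vanishes, the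
  polynomial is affine and its slope must be zero.\<close>

lemma Cauchy_Schwarz_integral_sq:
  assumes "f \<in> L2 M" "g \<in> L2 M"
  shows "(\<integral>x. f x * g x \<partial>M)\<^sup>2 \<le> (\<integral>x. (f x)\<^sup>2 \<partial>M) * (\<integral>x. (g x)\<^sup>2 \<partial>M)"
proof -
  let ?a = "\<integral>x. (f x)\<^sup>2 \<partial>M" and ?b = "\<integral>x. f x * g x \<partial>M" and ?c = "\<integral>x. (g x)\<^sup>2 \<partial>M"
  note [simp] = L2_integrable_sq[OF assms(1)] L2_integrable_sq[OF assms(2)]
    L2_integrable_mult[OF assms]
  have q: "0 \<le> t\<^sup>2 * ?a - 2 * t * ?b + ?c" for t
  proof -
    have "0 \<le> (\<integral>x. (t * f x - g x)\<^sup>2 \<partial>M)" by simp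
    also have "\<dots> = (\<integral>x. t\<^sup>2 * (f x)\<^sup>2 - 2 * t * (f x * g x) + (g x)\<^sup>2 \<partial>M)"
      by (simp add: power2_diff power_mult_distrib algebra_simps)
    also have "\<dots> = t\<^sup>2 * ?a - 2 * t * ?b + ?c"
      by simp
    finally show ?thesis .
  qed
  have a0: "0 \<le> ?a" by simp
  show ?thesis
  proof (cases "?a = 0")
    case True
    have "?b = 0"
    proof (rule ccontr)
      assume "?b \<noteq> 0"
      \<comment> \<open>The chosen \<open>t\<close> would give the affine function the value
        -1.\<close>
      then show False
        using q[of "(?c + 1) / (2 * ?b)"] True by (simp add: field_simps)
    qed
    then show ?thesis using True by simp
  next
    case False
    with a0 have "0 < ?a" by linarith
    moreover have "b\<^sup>2 \<le> a * c" if "0 < a" "0 \<le> (b / a)\<^sup>2 * a - 2 * (b / a) * b + c" for a b c :: real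
      using that by (simp add: field_simps power2_eq_square)
    ultimately show ?thesis using q[of "?b / ?a"] by blast
  qed
qed

lemma Cauchy_Schwarz_integral:
  assumes "f \<in> L2 M" "g \<in> L2 M"
  shows "\<bar>\<integral>x. f x * g x \<partial>M\<bar> \<le> l2norm M f * l2norm M g"
  using real_sqrt_le_mono[OF Cauchy_Schwarz_integral_sq[OF assms]]
  by (simp add: l2norm_def real_sqrt_mult)

lemma l2norm_triangle:
  assumes "f \<in> L2 M" "g \<in> L2 M"
  shows "l2norm M (\<lambda>x. f x + g x) \<le> l2norm M f + l2norm M g"
proof (rule power2_le_imp_le)
  have "(l2norm M (\<lambda>x. f x + g x))\<^sup>2
      = (\<integral>x. (f x)\<^sup>2 + (g x)\<^sup>2 + 2 * (f x * g x) \<partial>M)"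
    unfolding l2norm_sq by (simp add: power2_sum mult.assoc)
  also have "\<dots> = (l2norm M f)\<^sup>2 + (l2norm M g)\<^sup>2 + 2 * (\<integral>x. f x * g x \<partial>M)"
    using assms by (simp add: l2norm_sq L2_integrable_sq L2_integrable_mult)
  also have "\<dots> \<le> (l2norm M f + l2norm M g)\<^sup>2"
    using Cauchy_Schwarz_integral[OF assms] by (simp add: power2_sum)
  finally show "(l2norm M (\<lambda>x. f x + g x))\<^sup>2 \<le> (l2norm M f + l2norm M g)\<^sup>2" .
qed simp

lemma l2norm_diff_triangle:
  assumes "f \<in> L2 M" "g \<in> L2 M" "h \<in> L2 M"
  shows "l2norm M (\<lambda>x. f x - h x) \<le> l2norm M (\<lambda>x. f x - g x) + l2norm M (\<lambda>x. g x - h x)"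
  using l2norm_triangle[OF L2_diff[OF assms(1,2)] L2_diff[OF assms(2,3)]] by simp

lemma l2norm_mono:
  assumes "f \<in> borel_measurable M" "g \<in> L2 M" "\<And>x. x \<in> space M \<Longrightarrow> \<bar>f x\<bar> \<le> \<bar>g x\<bar>"
  shows "f \<in> L2 M" "l2norm M f \<le> l2norm M g"
proof -
  have le: "(f x)\<^sup>2 \<le> (g x)\<^sup>2" if "x \<in> space M" for x
    using assms(3)[OF that] by (simp add: abs_le_square_iff)
  show f: "f \<in> L2 M"
    unfolding L2_def using assms le
    by (auto intro!: Bochner_Integration.integrable_bound[OF L2_integrable_sq[OF assms(2)]])
  show "l2norm M f \<le> l2norm M g"
    unfolding l2norm_def
    using f assms(2) le by (intro real_sqrt_le_mono integral_mono) (auto simp: L2_def)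
qed

lemma (in finite_measure) bounded_L2:
  assumes "f \<in> borel_measurable M" "\<And>x. x \<in> space M \<Longrightarrow> \<bar>f x\<bar> \<le> c"
  shows "f \<in> L2 M"
proof -
  have "integrable M (\<lambda>x. (f x)\<^sup>2)"
  proof (rule integrable_const_bound[where B = "c\<^sup>2"])
    show "AE x in M. norm ((f x)\<^sup>2) \<le> c\<^sup>2"
    proof (rule AE_I2)
      fix x assume "x \<in> space M"
      then show "norm ((f x)\<^sup>2) \<le> c\<^sup>2"
        using assms(2)[of x] power_mono[of "\<bar>f x\<bar>" c 2] by simp
    qed
  qed (use assms(1) in auto)
  then show ?thesis using assms(1) by (simp add: L2_def)
qed

lemma (in finite_measure) indicator_L2: "A \<in> sets M \<Longrightarrow> indicator A \<in> L2 M"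
  by (rule bounded_L2[where c = 1]) (auto simp: indicator_def)

lemma (in finite_measure) L2_integrable:
  assumes "f \<in> L2 M" shows "integrable M f"
  using L2_integrable_mult[OF assms bounded_L2[of "\<lambda>x. 1" 1]] by simp

lemma (in prob_space) L1_le_l2norm:
  assumes "f \<in> L2 M"
  shows "(\<integral>x. \<bar>f x\<bar> \<partial>M) \<le> l2norm M f"
proof -
  have "(\<lambda>x. \<bar>f x\<bar>) \<in> L2 M" using assms by (auto simp: L2_def)
  from Cauchy_Schwarz_integral[OF this bounded_L2[of "\<lambda>x. 1" 1]]
  show ?thesis by (simp add: l2norm_def prob_space)
qed

text \<open>On a probability space an L2-Cauchy sequence is L1-Cauchy, so a subsequence converges
  almost everywhere. Fatou's lemma along that subsequence turns the Cauchy bound for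
  \<open>f n - f (r i)\<close> into one for \<open>f n - u\<close>.\<close>

lemma (in prob_space) L2_complete:
  assumes f: "\<And>n. f n \<in> L2 M"
    and cau: "\<And>e. e > 0 \<Longrightarrow> \<exists>N::nat. \<forall>m\<ge>N. \<forall>n\<ge>N. l2norm M (\<lambda>x. f m x - f n x) < e"
  obtains u where "u \<in> L2 M" "(\<lambda>n. l2norm M (\<lambda>x. f n x - u x)) \<longlonglongrightarrow> 0"
proof -
  have [measurable]: "f n \<in> borel_measurable M" for n using f by (auto simp: L2_def)
  have "\<exists>N. \<forall>i\<ge>N. \<forall>j\<ge>N. (LINT x|M. norm (f i x - f j x)) < e" if "e > 0" for e
    using cau[OF that] L1_le_l2norm[OF L2_diff[OF f f]] by (auto intro: le_less_trans) (meson le_less_trans)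
  then obtain r where r: "strict_mono r" "AE x in M. Cauchy (\<lambda>i. f (r i) x)"
    using cauchy_L1_AE_cauchy_subseq[of M f] L2_integrable[OF f] by metis
  \<comment> \<open>Where the subsequence diverges \<open>lim\<close> is an unspecified value, yet
    \<open>u\<close> is measurable; only the almost everywhere limit matters below.\<close>
  define u where "u x = lim (\<lambda>i. f (r i) x)" for x
  have [measurable]: "u \<in> borel_measurable M"
    unfolding u_def by (rule borel_measurable_lim_metric) auto
  have ae: "AE x in M. (\<lambda>i. f (r i) x) \<longlonglongrightarrow> u x"
    using r(2) by eventually_elim (auto simp: u_def Cauchy_convergent_iff convergent_LIMSEQ_iff)
  have key: "\<exists>N. \<forall>n\<ge>N. (\<lambda>x. f n x - u x) \<in> L2 M \<and> l2norm M (\<lambda>x. f n x - u x) \<le> e" if e: "e > 0" for e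
  proof -
    obtain N where N: "\<And>m n. m \<ge> N \<Longrightarrow> n \<ge> N \<Longrightarrow> l2norm M (\<lambda>x. f m x - f n x) < e"
      using cau[OF e] by blast
    have "(\<lambda>x. f n x - u x) \<in> L2 M \<and> l2norm M (\<lambda>x. f n x - u x) \<le> e" if n: "n \<ge> N" for n
    proof -
      have "(\<integral>\<^sup>+x. ennreal ((f n x - u x)\<^sup>2) \<partial>M) = (\<integral>\<^sup>+x. liminf (\<lambda>i. ennreal ((f n x - f (r i) x)\<^sup>2)) \<partial>M)"
      proof (rule nn_integral_cong_AE)
        show "AE x in M. ennreal ((f n x - u x)\<^sup>2) = liminf (\<lambda>i. ennreal ((f n x - f (r i) x)\<^sup>2))"
          using ae
        proof eventually_elim
          case (elim x)
          then have "(\<lambda>i. ennreal ((f n x - f (r i) x)\<^sup>2)) \<longlonglongrightarrow> ennreal ((f n x - u x)\<^sup>2)"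
            by (intro tendsto_ennrealI tendsto_intros)
          from lim_imp_Liminf[OF _ this] show ?case by simp
        qed
      qed
      also have "\<dots> \<le> liminf (\<lambda>i. \<integral>\<^sup>+x. ennreal ((f n x - f (r i) x)\<^sup>2) \<partial>M)"
        by (rule nn_integral_liminf) simp
      also have "\<dots> \<le> liminf (\<lambda>i. ennreal (e\<^sup>2))"
      proof (rule Liminf_mono)
        show "\<forall>\<^sub>F i in sequentially. (\<integral>\<^sup>+x. ennreal ((f n x - f (r i) x)\<^sup>2) \<partial>M) \<le> ennreal (e\<^sup>2)"
          using eventually_ge_at_top[of N]
        proof eventually_elim
          case (elim i)
          then have "r i \<ge> N" using seq_suble[OF r(1), of i] by simp
          then have "l2norm M (\<lambda>x. f n x - f (r i) x) \<le> e" using N[OF n] by (simp add: less_imp_le)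
          then have "(l2norm M (\<lambda>x. f n x - f (r i) x))\<^sup>2 \<le> e\<^sup>2"
            by (rule power_mono) simp
          then show ?case
            unfolding l2norm_sq using L2_integrable_sq[OF L2_diff[OF f f]]
            by (subst nn_integral_eq_integral) (auto intro: ennreal_leI)
        qed
      qed
      finally have le: "(\<integral>\<^sup>+x. ennreal ((f n x - u x)\<^sup>2) \<partial>M) \<le> ennreal (e\<^sup>2)"
        by (simp only: Liminf_const[OF sequentially_bot])
      have int: "integrable M (\<lambda>x. (f n x - u x)\<^sup>2)"
      proof (rule integrableI_bounded)
        show "(\<integral>\<^sup>+x. ennreal (norm ((f n x - u x)\<^sup>2)) \<partial>M) < \<infinity>"
          using le_less_trans[OF le ennreal_less_top] by simp
      qed simp
      have "(\<integral>x. (f n x - u x)\<^sup>2 \<partial>M) \<le> e\<^sup>2"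
        using le int by (subst (asm) nn_integral_eq_integral) (auto simp: ennreal_le_iff)
      then have "l2norm M (\<lambda>x. f n x - u x) \<le> e"
        unfolding l2norm_def using e by (intro real_le_lsqrt) auto
      then show ?thesis using int by (simp add: L2_def)
    qed
    then show ?thesis by blast
  qed
  obtain N where "(\<lambda>x. f N x - u x) \<in> L2 M" using key[of 1] by auto
  from L2_diff[OF f[of N] this] have u: "u \<in> L2 M" by simp
  have "(\<lambda>n. l2norm M (\<lambda>x. f n x - u x)) \<longlonglongrightarrow> 0"
  proof (rule LIMSEQ_I)
    fix e :: real assume "e > 0"
    then obtain N where "\<forall>n\<ge>N. l2norm M (\<lambda>x. f n x - u x) \<le> e/2" using key[of "e/2"] by auto
    then have "\<forall>n\<ge>N. norm (l2norm M (\<lambda>x. f n x - u x) - 0) < e"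
      using \<open>e > 0\<close> by fastforce
    then show "\<exists>no. \<forall>n\<ge>no. norm (l2norm M (\<lambda>x. f n x - u x) - 0) < e" by blast
  qed
  with u show ?thesis by (rule that)
qed

lemma tendsto_integral_mult_L2:
  assumes f: "\<And>n. f n \<in> L2 M" and u: "u \<in> L2 M" and h: "h \<in> L2 M"
    and lim: "(\<lambda>n. l2norm M (\<lambda>x. f n x - u x)) \<longlonglongrightarrow> 0"
  shows "(\<lambda>n. \<integral>x. f n x * h x \<partial>M) \<longlonglongrightarrow> (\<integral>x. u x * h x \<partial>M)"
proof (rule LIM_zero_cancel, rule Lim_null_comparison)
  show "(\<lambda>n. l2norm M (\<lambda>x. f n x - u x) * l2norm M h) \<longlonglongrightarrow> 0"
    using tendsto_mult_left_zero[OF lim] by simp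
  show "\<forall>\<^sub>F n in sequentially. norm ((\<integral>x. f n x * h x \<partial>M) - (\<integral>x. u x * h x \<partial>M))
      \<le> l2norm M (\<lambda>x. f n x - u x) * l2norm M h"
  proof (rule always_eventually, rule allI)
    fix n
    have "(\<integral>x. f n x * h x \<partial>M) - (\<integral>x. u x * h x \<partial>M) = (\<integral>x. (f n x - u x) * h x \<partial>M)"
      using L2_integrable_mult[OF f h] L2_integrable_mult[OF u h]
      by (simp add: left_diff_distrib)
    then show "norm ((\<integral>x. f n x * h x \<partial>M) - (\<integral>x. u x * h x \<partial>M))
      \<le> l2norm M (\<lambda>x. f n x - u x) * l2norm M h"
      using Cauchy_Schwarz_integral[OF L2_diff[OF f u] h, of n] by simp
  qed
qed


section \<open>Almost periodic functions and the Kronecker algebra\<close>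

text \<open>\<open>M\<close> will be the completed measure. The action laws are asked on
  \<open>space M\<close> only, because \<open>act g\<close> is arbitrary outside it.\<close>

locale pmp_action = prob_space M + group G
  for M :: "'x measure" and G :: "('g, 'b) monoid_scheme" (structure) +
  fixes act :: "'g \<Rightarrow> 'x \<Rightarrow> 'x"
  assumes act_measurable [measurable]: "g \<in> carrier G \<Longrightarrow> act g \<in> measurable M M"
    and distr_act: "g \<in> carrier G \<Longrightarrow> distr M M (act g) = M"
    and act_one: "x \<in> space M \<Longrightarrow> act \<one> x = x"
    and act_mult: "g \<in> carrier G \<Longrightarrow> h \<in> carrier G \<Longrightarrow> x \<in> space M \<Longrightarrow>
        act (g \<otimes> h) x = act g (act h x)"
begin

section \<open>Invariance of integrals and norms under the action\<close>

lemma act_space: "g \<in> carrier G \<Longrightarrow> x \<in> space M \<Longrightarrow> act g x \<in> space M"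
  using measurable_space[OF act_measurable] .

lemma act_inv_act: "g \<in> carrier G \<Longrightarrow> x \<in> space M \<Longrightarrow> act (inv g) (act g x) = x"
  by (metis act_mult act_one inv_closed l_inv)

lemma integral_act:
  fixes f :: "'x \<Rightarrow> real"
  assumes "g \<in> carrier G" "f \<in> borel_measurable M"
  shows "(\<integral>x. f (act g x) \<partial>M) = (\<integral>x. f x \<partial>M)"
  using integral_distr[OF act_measurable[OF assms(1)] assms(2)] distr_act[OF assms(1)] by simp

lemma integrable_act:
  fixes f :: "'x \<Rightarrow> real"
  assumes "g \<in> carrier G" "integrable M f"
  shows "integrable M (\<lambda>x. f (act g x))"
  using integrable_distr[OF act_measurable[OF assms(1)], of f] distr_act[OF assms(1)] assms by simp

lemma AE_act:
  assumes "g \<in> carrier G" "AE x in M. P x"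
  shows "AE x in M. P (act g x)"
proof -
  have "AE x in distr M M (act g). P x" unfolding distr_act[OF assms(1)] by (rule assms(2))
  from AE_distrD[OF act_measurable[OF assms(1)] this] show ?thesis .
qed

lemma measure_act:
  assumes "g \<in> carrier G" "A \<in> sets M"
  shows "measure M (act g -` A \<inter> space M) = measure M A"
  using measure_distr[OF act_measurable[OF assms(1)] assms(2)] distr_act[OF assms(1)] by simp

lemma L2_act:
  assumes "g \<in> carrier G" "f \<in> L2 M"
  shows "(\<lambda>x. f (act g x)) \<in> L2 M"
  using assms integrable_act[OF assms(1), of "\<lambda>x. (f x)\<^sup>2"] act_measurable[OF assms(1)]
  by (auto simp: L2_def)

lemma l2norm_act:
  assumes "g \<in> carrier G" "f \<in> borel_measurable M"
  shows "l2norm M (\<lambda>x. f (act g x)) = l2norm M f"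
  unfolding l2norm_def using integral_act[OF assms(1), of "\<lambda>x. (f x)\<^sup>2"] assms by simp

lemma integral_act_adjoint:
  fixes f k :: "'x \<Rightarrow> real"
  assumes g: "g \<in> carrier G" and [measurable]: "f \<in> borel_measurable M" "k \<in> borel_measurable M"
  shows "(\<integral>x. f (act g x) * k x \<partial>M) = (\<integral>x. f x * k (act (inv g) x) \<partial>M)"
proof -
  have [measurable]: "act (inv g) \<in> measurable M M" using g by auto
  have "(\<integral>x. f x * k (act (inv g) x) \<partial>M) = (\<integral>x. f (act g x) * k (act (inv g) (act g x)) \<partial>M)"
    by (subst integral_act[OF g, symmetric]) auto
  also have "\<dots> = (\<integral>x. f (act g x) * k x \<partial>M)"
    by (intro Bochner_Integration.integral_cong) (auto simp: act_inv_act g)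
  finally show ?thesis ..
qed

text \<open>Total boundedness of the orbit of \<open>f\<close>, phrased by finite colourings of the group: colourings
  of two functions combine to a colouring by pairs.\<close>
definition orbit_coloured :: "('x \<Rightarrow> real) \<Rightarrow> real \<Rightarrow> bool" where
  "orbit_coloured f e \<longleftrightarrow> (\<exists>\<Phi> :: 'g \<Rightarrow> nat. finite (\<Phi> ` carrier G) \<and>
     (\<forall>g\<in>carrier G. \<forall>h\<in>carrier G. \<Phi> g = \<Phi> h \<longrightarrow> l2norm M (\<lambda>x. f (act g x) - f (act h x)) < e))"

definition almost_periodic :: "('x \<Rightarrow> real) \<Rightarrow> bool" where
  "almost_periodic f \<longleftrightarrow> f \<in> L2 M \<and> (\<forall>e>0. orbit_coloured f e)"

lemma almost_periodic_L2: "almost_periodic f \<Longrightarrow> f \<in> L2 M"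
  by (simp add: almost_periodic_def)

text \<open>\<open>orbit_coloured\<close> quantifies over colourings inside a formula and has to fix
  a colour type. Finite images embed in the naturals, so pairs, tuples and representatives can serve
  as colours too.\<close>

lemma colouring_to_nat:
  fixes \<Phi> :: "'g \<Rightarrow> 'c"
  assumes "finite (\<Phi> ` S)"
  obtains \<Psi> :: "'g \<Rightarrow> nat" where "finite (\<Psi> ` S)"
    "\<And>g h. g \<in> S \<Longrightarrow> h \<in> S \<Longrightarrow> \<Psi> g = \<Psi> h \<Longrightarrow> \<Phi> g = \<Phi> h"
proof -
  obtain f :: "'c \<Rightarrow> nat" where f: "inj_on f (\<Phi> ` S)"
    using finite_imp_inj_to_nat_seg[OF assms] by metis
  show ?thesis
  proof (rule that)
    show "finite ((f \<circ> \<Phi>) ` S)" using assms by (metis finite_imageI image_comp)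
    show "\<Phi> g = \<Phi> h" if "g \<in> S" "h \<in> S" "(f \<circ> \<Phi>) g = (f \<circ> \<Phi>) h" for g h
      using that f by (auto simp: inj_on_def)
  qed
qed

lemma orbit_colouredI:
  fixes \<Phi> :: "'g \<Rightarrow> 'c"
  assumes "finite (\<Phi> ` carrier G)"
    "\<And>g h. g \<in> carrier G \<Longrightarrow> h \<in> carrier G \<Longrightarrow> \<Phi> g = \<Phi> h \<Longrightarrow>
      l2norm M (\<lambda>x. f (act g x) - f (act h x)) < e"
  shows "orbit_coloured f e"
proof -
  obtain \<Psi> :: "'g \<Rightarrow> nat" where "finite (\<Psi> ` carrier G)"
    "\<And>g h. g \<in> carrier G \<Longrightarrow> h \<in> carrier G \<Longrightarrow> \<Psi> g = \<Psi> h \<Longrightarrow> \<Phi> g = \<Phi> h"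
    using colouring_to_nat[OF assms(1)] by metis
  then show ?thesis unfolding orbit_coloured_def using assms(2) by blast
qed

text \<open>The action is isometric, so an approximation of \<open>u\<close> by \<open>v\<close>
  holds with the same error along the whole orbit. The approximant \<open>v\<close> has to be
  coloured only at the scale \<open>e\<close>: the approximants in
  \<open>correlations_vanish\<close> are chosen for one scale and controlled only at that
  scale.\<close>

lemma almost_periodic_limit:
  assumes u: "u \<in> L2 M"
    and ex: "\<And>e. e > 0 \<Longrightarrow> \<exists>v\<in>L2 M. l2norm M (\<lambda>x. v x - u x) < e \<and> orbit_coloured v e"
  shows "almost_periodic u"
  unfolding almost_periodic_def
proof (intro conjI allI impI u)
  fix e :: real assume "e > 0"
  then have e: "e / 3 > 0" by simp
  obtain v where v: "v \<in> L2 M" and vu: "l2norm M (\<lambda>x. v x - u x) < e / 3"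
    and "orbit_coloured v (e / 3)" using ex[OF e] by blast
  then obtain \<Phi> :: "'g \<Rightarrow> nat" where fin: "finite (\<Phi> ` carrier G)" and
    \<Phi>: "\<And>g h. g \<in> carrier G \<Longrightarrow> h \<in> carrier G \<Longrightarrow> \<Phi> g = \<Phi> h \<Longrightarrow>
      l2norm M (\<lambda>x. v (act g x) - v (act h x)) < e / 3"
    unfolding orbit_coloured_def by blast
  have *: "l2norm M (\<lambda>x. v (act g x) - u (act g x)) < e / 3" if "g \<in> carrier G" for g
    using l2norm_act[OF that, of "\<lambda>x. v x - u x"] u v vu by (auto simp: L2_def)
  show "orbit_coloured u e"
  proof (rule orbit_colouredI[OF fin])
    fix g h assume gh: "g \<in> carrier G" "h \<in> carrier G" "\<Phi> g = \<Phi> h"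
    note L = L2_act[OF gh(1) u] L2_act[OF gh(1) v] L2_act[OF gh(2) v] L2_act[OF gh(2) u]
    show "l2norm M (\<lambda>x. u (act g x) - u (act h x)) < e"
      using l2norm_diff_triangle[OF L(1,2,4)] l2norm_diff_triangle[OF L(2,3,4)]
        *[OF gh(1)] *[OF gh(2)] \<Phi>[OF gh]
        l2norm_minus_commute[of M "\<lambda>x. u (act g x)" "\<lambda>x. v (act g x)"] by linarith
  qed
qed

text \<open>Dominated convergence makes a bounded pointwise limit an L2-limit. This gives closure
  under countable unions and, later, access to superlevel sets.\<close>

lemma almost_periodic_pointwise_limit:
  assumes v: "\<And>n. almost_periodic (v n)" and bd: "\<And>n x. x \<in> space M \<Longrightarrow> \<bar>v n x\<bar> \<le> c"
    and lim: "\<And>x. x \<in> space M \<Longrightarrow> (\<lambda>n. v n x) \<longlonglongrightarrow> u x"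
  shows "almost_periodic u"
proof (rule almost_periodic_limit)
  have [measurable]: "v n \<in> borel_measurable M" for n using almost_periodic_L2[OF v] by (simp add: L2_def)
  have [measurable]: "u \<in> borel_measurable M"
    by (rule borel_measurable_LIMSEQ_metric[of v]) (auto intro: lim)
  have bu: "\<bar>u x\<bar> \<le> c" if "x \<in> space M" for x
    using LIMSEQ_le_const2[OF tendsto_rabs[OF lim[OF that]]] bd[OF that] by blast
  then show uL: "u \<in> L2 M" by (intro bounded_L2[where c = c]) auto
  have "(\<lambda>n. \<integral>x. (v n x - u x)\<^sup>2 \<partial>M) \<longlonglongrightarrow> (\<integral>x. 0 \<partial>M)"
  proof (rule integral_dominated_convergence[where w = "\<lambda>x. (2 * c)\<^sup>2"])
    show "AE x in M. (\<lambda>n. (v n x - u x)\<^sup>2) \<longlonglongrightarrow> 0"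
    proof (rule AE_I2)
      fix x assume "x \<in> space M"
      from tendsto_power[OF tendsto_diff[OF lim[OF this] tendsto_const], of "u x" 2]
      show "(\<lambda>n. (v n x - u x)\<^sup>2) \<longlonglongrightarrow> 0" by simp
    qed
    show "AE x in M. norm ((v n x - u x)\<^sup>2) \<le> (2 * c)\<^sup>2" for n
    proof (rule AE_I2)
      fix x assume "x \<in> space M"
      then have "\<bar>v n x - u x\<bar> \<le> 2 * c" using bu[of x] bd[of x n] by linarith
      then show "norm ((v n x - u x)\<^sup>2) \<le> (2 * c)\<^sup>2"
        using power_mono[of "\<bar>v n x - u x\<bar>" "2 * c" 2] by simp
    qed
  qed auto
  then have lim0: "(\<lambda>n. l2norm M (\<lambda>x. v n x - u x)) \<longlonglongrightarrow> 0"
    unfolding l2norm_def using tendsto_real_sqrt[of _ 0] by fastforce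
  fix e :: real assume e: "e > 0"
  obtain n where "l2norm M (\<lambda>x. v n x - u x) < e"
    using order_tendstoD(2)[OF lim0 e] unfolding eventually_sequentially by blast
  then show "\<exists>v\<in>L2 M. l2norm M (\<lambda>x. v x - u x) < e \<and> orbit_coloured v e"
    using v[of n] e unfolding almost_periodic_def by (intro bexI[of _ "v n"]) auto
qed

text \<open>Pairs of colours control both arguments, and the Lipschitz bound transfers this to
  \<open>F\<close>. Unions (\<open>max\<close>), complements and truncations are all instances;
  unary operations ignore the second argument.\<close>

lemma almost_periodic_Lipschitz2:
  assumes f: "almost_periodic f" and k: "almost_periodic k" and m: "(\<lambda>x. F (f x) (k x)) \<in> L2 M"
    and lip: "\<And>a b a' b'. \<bar>F a b - F a' b'\<bar> \<le> c * (\<bar>a - a'\<bar> + \<bar>b - b'\<bar>)"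
  shows "almost_periodic (\<lambda>x. F (f x) (k x))"
  unfolding almost_periodic_def
proof (intro conjI allI impI m)
  fix e :: real assume e: "e > 0"
  \<comment> \<open>Two errors below \<open>d\<close>, each multiplied by
    \<open>\<bar>c\<bar> + 1\<close>, add up to less than \<open>e\<close>; the 1 keeps the
    denominator positive when \<open>c = 0\<close>.\<close>
  define d where "d = e / (2 * (\<bar>c\<bar> + 1))"
  have d: "d > 0" using e by (simp add: d_def)
  obtain \<Phi> :: "'g \<Rightarrow> nat" where fin: "finite (\<Phi> ` carrier G)" and
    \<Phi>: "\<And>g h. g \<in> carrier G \<Longrightarrow> h \<in> carrier G \<Longrightarrow> \<Phi> g = \<Phi> h \<Longrightarrow>
      l2norm M (\<lambda>x. f (act g x) - f (act h x)) < d"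
    using f d unfolding almost_periodic_def orbit_coloured_def by blast
  obtain \<Psi> :: "'g \<Rightarrow> nat" where fin': "finite (\<Psi> ` carrier G)" and
    \<Psi>: "\<And>g h. g \<in> carrier G \<Longrightarrow> h \<in> carrier G \<Longrightarrow> \<Psi> g = \<Psi> h \<Longrightarrow>
      l2norm M (\<lambda>x. k (act g x) - k (act h x)) < d"
    using k d unfolding almost_periodic_def orbit_coloured_def by blast
  show "orbit_coloured (\<lambda>x. F (f x) (k x)) e"
  proof (rule orbit_colouredI[where \<Phi> = "\<lambda>g. (\<Phi> g, \<Psi> g)"])
    have "(\<lambda>g. (\<Phi> g, \<Psi> g)) ` carrier G \<subseteq> \<Phi> ` carrier G \<times> \<Psi> ` carrier G" by auto
    then show "finite ((\<lambda>g. (\<Phi> g, \<Psi> g)) ` carrier G)"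
      using fin fin' finite_subset by blast
    fix g h assume gh: "g \<in> carrier G" "h \<in> carrier G" "(\<Phi> g, \<Psi> g) = (\<Phi> h, \<Psi> h)"
    let ?f = "\<lambda>x. \<bar>f (act g x) - f (act h x)\<bar>" and ?k = "\<lambda>x. \<bar>k (act g x) - k (act h x)\<bar>"
    have L: "?f \<in> L2 M" "?k \<in> L2 M"
      using L2_diff[OF L2_act[OF gh(1) almost_periodic_L2[OF f]] L2_act[OF gh(2) almost_periodic_L2[OF f]]]
        L2_diff[OF L2_act[OF gh(1) almost_periodic_L2[OF k]] L2_act[OF gh(2) almost_periodic_L2[OF k]]]
      by (auto simp: L2_def)
    have fk: "l2norm M (\<lambda>x. ?f x + ?k x) < 2 * d"
      using l2norm_triangle[OF L] \<Phi>[OF gh(1,2)] \<Psi>[OF gh(1,2)] gh(3)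
      by (auto simp: l2norm_def)
    have "l2norm M (\<lambda>x. F (f (act g x)) (k (act g x)) - F (f (act h x)) (k (act h x)))
        \<le> l2norm M (\<lambda>x. (\<bar>c\<bar> + 1) * (?f x + ?k x))"
    proof (rule l2norm_mono)
      show "(\<lambda>x. F (f (act g x)) (k (act g x)) - F (f (act h x)) (k (act h x))) \<in> borel_measurable M"
        using L2_diff[OF L2_act[OF gh(1) m] L2_act[OF gh(2) m]] by (simp add: L2_def)
      show "(\<lambda>x. (\<bar>c\<bar> + 1) * (?f x + ?k x)) \<in> L2 M"
        by (intro L2_cmult L2_add L)
      fix x
      have "c * (?f x + ?k x) \<le> (\<bar>c\<bar> + 1) * (?f x + ?k x)"
        by (intro mult_right_mono) auto
      then show "\<bar>F (f (act g x)) (k (act g x)) - F (f (act h x)) (k (act h x))\<bar>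
          \<le> \<bar>(\<bar>c\<bar> + 1) * (?f x + ?k x)\<bar>"
        using lip[of "f (act g x)" "k (act g x)" "f (act h x)" "k (act h x)"] by linarith
    qed
    also have "\<dots> = (\<bar>c\<bar> + 1) * l2norm M (\<lambda>x. ?f x + ?k x)"
      by (simp add: l2norm_def power_mult_distrib real_sqrt_mult)
    also have "\<dots> < (\<bar>c\<bar> + 1) * (2 * d)"
      by (rule mult_strict_left_mono[OF fk]) simp
    also have "\<dots> = e"
    proof -
      have "k * (2 * (e / (2 * k))) = e" if "k \<noteq> 0" for k
        using that by simp
      then show ?thesis unfolding d_def by (smt (verit) abs_ge_zero)
    qed
    finally show "l2norm M (\<lambda>x. F (f (act g x)) (k (act g x)) - F (f (act h x)) (k (act h x))) < e" .
  qed
qed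

lemma almost_periodic_act:
  assumes f: "almost_periodic f" and g: "g \<in> carrier G"
  shows "almost_periodic (\<lambda>x. f (act g x))"
  unfolding almost_periodic_def
proof (intro conjI allI impI)
  show "(\<lambda>x. f (act g x)) \<in> L2 M" using L2_act[OF g almost_periodic_L2[OF f]] .
  fix e :: real assume "e > 0"
  then obtain \<Phi> :: "'g \<Rightarrow> nat" where fin: "finite (\<Phi> ` carrier G)" and
    \<Phi>: "\<And>g h. g \<in> carrier G \<Longrightarrow> h \<in> carrier G \<Longrightarrow> \<Phi> g = \<Phi> h \<Longrightarrow>
      l2norm M (\<lambda>x. f (act g x) - f (act h x)) < e"
    using f unfolding almost_periodic_def orbit_coloured_def by blast
  show "orbit_coloured (\<lambda>x. f (act g x)) e"
  \<comment> \<open>The orbit of the translated function is part of the orbit of \<open>f\<close>,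
    reindexed by left multiplication with \<open>g\<close>.\<close>
  proof (rule orbit_colouredI[where \<Phi> = "\<lambda>\<gamma>. \<Phi> (g \<otimes> \<gamma>)"])
    show "finite ((\<lambda>\<gamma>. \<Phi> (g \<otimes> \<gamma>)) ` carrier G)"
      by (rule finite_subset[OF _ fin]) (use g in auto)
    fix h k assume hk: "h \<in> carrier G" "k \<in> carrier G" "\<Phi> (g \<otimes> h) = \<Phi> (g \<otimes> k)"
    have "l2norm M (\<lambda>x. f (act g (act h x)) - f (act g (act k x)))
        = l2norm M (\<lambda>x. f (act (g \<otimes> h) x) - f (act (g \<otimes> k) x))"
      unfolding l2norm_def
      by (intro arg_cong[where f = sqrt] Bochner_Integration.integral_cong) (auto simp: act_mult g hk)
    also have "\<dots> < e" using \<Phi>[OF _ _ hk(3)] g hk by auto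
    finally show "l2norm M (\<lambda>x. f (act g (act h x)) - f (act g (act k x))) < e" .
  qed
qed

text \<open>By pigeonhole a subsequence has constant colour at each scale
  \<open>1 / (n + 1)\<close>; the diagonal subsequence is then Cauchy and completeness
  applies.\<close>

lemma almost_periodic_imp_precompact:
  assumes f: "almost_periodic f" and s: "\<And>n::nat. s n \<in> carrier G"
  obtains r u where "strict_mono r" "u \<in> L2 M"
    "(\<lambda>n. l2norm M (\<lambda>x. f (act (s (r n)) x) - u x)) \<longlonglongrightarrow> 0"
proof -
  have "\<exists>\<Phi> :: 'g \<Rightarrow> nat. finite (\<Phi> ` carrier G) \<and>
     (\<forall>g\<in>carrier G. \<forall>h\<in>carrier G. \<Phi> g = \<Phi> h \<longrightarrow>
        l2norm M (\<lambda>x. f (act g x) - f (act h x)) < inverse (real (Suc n)))" for n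
    using f unfolding almost_periodic_def orbit_coloured_def by simp
  then obtain \<Phi> :: "nat \<Rightarrow> 'g \<Rightarrow> nat" where fin: "\<And>n. finite (\<Phi> n ` carrier G)" and
    \<Phi>: "\<And>n g h. g \<in> carrier G \<Longrightarrow> h \<in> carrier G \<Longrightarrow> \<Phi> n g = \<Phi> n h \<Longrightarrow>
      l2norm M (\<lambda>x. f (act g x) - f (act h x)) < inverse (real (Suc n))"
    by metis
  interpret ss: subseqs "\<lambda>n r. \<forall>i j. \<Phi> n (s (r i)) = \<Phi> n (s (r j))"
  proof
    fix n and t :: "nat \<Rightarrow> nat" assume "strict_mono t"
    have "finite (range (\<lambda>i. \<Phi> n (s (t i))))"
      by (rule finite_subset[OF _ fin[of n]]) (use s in auto)
    then obtain c where "infinite {i. \<Phi> n (s (t i)) = c}"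
      using pigeonhole_infinite[of "UNIV :: nat set" "\<lambda>i. \<Phi> n (s (t i))"] by auto
    from infinite_enumerate[OF this] obtain r' :: "nat \<Rightarrow> nat"
      where "strict_mono r'" "\<forall>k. r' k \<in> {i. \<Phi> n (s (t i)) = c}" by auto
    note r' = this
    show "\<exists>r' :: nat \<Rightarrow> nat. strict_mono r' \<and> (\<forall>i j. \<Phi> n (s ((t \<circ> r') i)) = \<Phi> n (s ((t \<circ> r') j)))"
      using r' by - (rule exI[of _ r'], simp)
  qed
  let ?r = "ss.diagseq"
  \<comment> \<open>Only from index \<open>Suc k\<close> on is the diagonal sequence a subsequence
    of one with constant colour at stage \<open>k\<close>.\<close>
  have same: "\<Phi> k (s (?r i)) = \<Phi> k (s (?r j))" if "i \<ge> Suc k" "j \<ge> Suc k" for i j k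
  proof -
    have "\<forall>i j. \<Phi> k (s ((?r \<circ> ((+) (Suc k))) i)) = \<Phi> k (s ((?r \<circ> ((+) (Suc k))) j))"
      by (rule ss.diagseq_holds) auto
    from this[rule_format, of "i - Suc k" "j - Suc k"] show ?thesis using that by simp
  qed
  have L: "(\<lambda>x. f (act (s (?r n)) x)) \<in> L2 M" for n
    using L2_act[OF s almost_periodic_L2[OF f]] .
  have "\<exists>N. \<forall>m\<ge>N. \<forall>n\<ge>N. l2norm M (\<lambda>x. f (act (s (?r m)) x) - f (act (s (?r n)) x)) < e"
    if e: "e > 0" for e
  proof -
    obtain k where k: "inverse (real (Suc k)) < e" using reals_Archimedean[OF e] by blast
    show ?thesis
    proof (intro exI[of _ "Suc k"] allI impI)
      fix m n assume mn: "Suc k \<le> m" "Suc k \<le> n"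
      show "l2norm M (\<lambda>x. f (act (s (?r m)) x) - f (act (s (?r n)) x)) < e"
        using \<Phi>[OF s s same[OF mn]] k by (rule less_trans)
    qed
  qed
  then obtain u where "u \<in> L2 M" "(\<lambda>n. l2norm M (\<lambda>x. f (act (s (?r n)) x) - u x)) \<longlonglongrightarrow> 0"
    by (rule L2_complete[of "\<lambda>n x. f (act (s (?r n)) x)", OF L])
  then show ?thesis by (rule that[OF ss.subseq_diagseq])
qed

text \<open>Without a colouring at scale \<open>e\<close>, no finite set of translates is an
  \<open>e / 2\<close>-net, and a greedy choice yields an \<open>e / 2\<close>-separated sequence of
  translates, which has no convergent subsequence.\<close>

lemma precompact_imp_almost_periodic:
  assumes f: "f \<in> L2 M"
    and pre: "\<And>s. (\<And>n::nat. s n \<in> carrier G) \<Longrightarrow> \<exists>r u. strict_mono r \<and> u \<in> L2 M \<and>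
      (\<lambda>n. l2norm M (\<lambda>x. f (act (s (r n)) x) - u x)) \<longlonglongrightarrow> 0"
  shows "almost_periodic f"
  unfolding almost_periodic_def
proof (intro conjI allI impI f)
  fix e :: real assume e: "e > 0"
  let ?d = "\<lambda>g h. l2norm M (\<lambda>x. f (act g x) - f (act h x))"
  show "orbit_coloured f e"
  proof (rule ccontr)
    assume neg: "\<not> orbit_coloured f e"
    have far: "\<exists>g\<in>carrier G. \<forall>h\<in>F. ?d g h \<ge> e / 2" if F: "finite F" "F \<subseteq> carrier G" for F
    proof (rule ccontr)
      assume "\<not> ?thesis"
      then have "\<forall>g\<in>carrier G. \<exists>h\<in>F. ?d g h < e / 2" by (auto simp: not_le)
      then obtain \<rho> where \<rho>: "\<And>g. g \<in> carrier G \<Longrightarrow> \<rho> g \<in> F \<and> ?d g (\<rho> g) < e / 2" by metis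
      \<comment> \<open>A finite net is itself a colouring: colour \<open>g\<close> by a net element
        \<open>\<rho> g\<close> close to it.\<close>
      have "orbit_coloured f e"
      proof (rule orbit_colouredI[where \<Phi> = \<rho>])
        show "finite (\<rho> ` carrier G)" by (rule finite_subset[OF _ F(1)]) (use \<rho> in auto)
        fix g h assume gh: "g \<in> carrier G" "h \<in> carrier G" "\<rho> g = \<rho> h"
        have r: "\<rho> h \<in> carrier G" using \<rho>[OF gh(2)] F by auto
        have "?d g (\<rho> h) < e / 2" "?d h (\<rho> h) < e / 2"
          using \<rho>[OF gh(1)] \<rho>[OF gh(2)] gh(3) by auto
        then show "?d g h < e"
          using l2norm_diff_triangle[OF L2_act[OF gh(1) f] L2_act[OF r f] L2_act[OF gh(2) f]]
            l2norm_minus_commute[of M "\<lambda>x. f (act (\<rho> h) x)" "\<lambda>x. f (act h x)"] by linarith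
      qed
      with neg show False by blast
    qed
    have "\<exists>s. \<forall>n::nat. s n \<in> carrier G \<and> (\<forall>i<n. ?d (s n) (s i) \<ge> e / 2)"
    proof (rule dependent_wellorder_choice)
      fix n and s :: "nat \<Rightarrow> 'g"
      assume "\<And>y. y < n \<Longrightarrow> s y \<in> carrier G \<and> (\<forall>i<y. ?d (s y) (s i) \<ge> e / 2)"
      then have "s ` {..<n} \<subseteq> carrier G" by auto
      from far[OF _ this] show "\<exists>g. g \<in> carrier G \<and> (\<forall>i<n. ?d g (s i) \<ge> e / 2)" by auto
    qed auto
    then obtain s where s: "\<And>n::nat. s n \<in> carrier G"
      and sep: "\<And>n i. i < n \<Longrightarrow> ?d (s n) (s i) \<ge> e / 2" by metis
    obtain r u where r: "strict_mono r" and u: "u \<in> L2 M"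
      and lim: "(\<lambda>n. l2norm M (\<lambda>x. f (act (s (r n)) x) - u x)) \<longlonglongrightarrow> 0"
      using pre[of s, OF s] by (elim exE conjE) (rule that)
    have "\<forall>\<^sub>F n in sequentially. l2norm M (\<lambda>x. f (act (s (r n)) x) - u x) < e / 4"
      by (rule order_tendstoD(2)[OF lim]) (use e in simp)
    then obtain N where N: "\<And>n. n \<ge> N \<Longrightarrow> l2norm M (\<lambda>x. f (act (s (r n)) x) - u x) < e / 4"
      by (auto simp: eventually_sequentially)
    have "?d (s (r (Suc N))) (s (r N)) < e / 2"
      using l2norm_diff_triangle[OF L2_act[OF s f] u L2_act[OF s f], of "r (Suc N)" "r N"]
        N[of N] N[of "Suc N"]
        l2norm_minus_commute[of M "\<lambda>x. f (act (s (r N)) x)" u] by simp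
    moreover have "r N < r (Suc N)" using r by (simp add: strict_mono_def)
    ultimately show False using sep[of "r N" "r (Suc N)"] by simp
  qed
qed

text \<open>This replaces the sequential compactness in the definition of the Kronecker sets by
  finite colourings, which are easier to combine.\<close>

lemma kronecker_sets_iff:
  "B \<in> kronecker_sets M G act \<longleftrightarrow> B \<in> sets M \<and> almost_periodic (indicator B)"
proof -
  have sq: "(\<lambda>n. \<integral>x. (F n x)\<^sup>2 \<partial>M) \<longlonglongrightarrow> 0 \<longleftrightarrow> (\<lambda>n. l2norm M (F n)) \<longlonglongrightarrow> 0"
    for F :: "nat \<Rightarrow> 'x \<Rightarrow> real"
  proof
    assume "(\<lambda>n. \<integral>x. (F n x)\<^sup>2 \<partial>M) \<longlonglongrightarrow> 0"
    from tendsto_real_sqrt[OF this] show "(\<lambda>n. l2norm M (F n)) \<longlonglongrightarrow> 0" by (simp add: l2norm_def)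
  next
    assume "(\<lambda>n. l2norm M (F n)) \<longlonglongrightarrow> 0"
    from tendsto_power[OF this, of 2] show "(\<lambda>n. \<integral>x. (F n x)\<^sup>2 \<partial>M) \<longlonglongrightarrow> 0" by (simp add: l2norm_sq)
  qed
  have "orbit_L2_precompact M G act B \<longleftrightarrow> almost_periodic (indicator B)" if B: "B \<in> sets M"
  proof
    assume pre: "orbit_L2_precompact M G act B"
    show "almost_periodic (indicator B)"
    proof (rule precompact_imp_almost_periodic[OF indicator_L2[OF B]])
      fix s :: "nat \<Rightarrow> 'g" assume "\<And>n. s n \<in> carrier G"
      then show "\<exists>r u. strict_mono r \<and> u \<in> L2 M \<and>
          (\<lambda>n. l2norm M (\<lambda>x. indicator B (act (s (r n)) x) - u x)) \<longlonglongrightarrow> 0"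
        using pre unfolding orbit_L2_precompact_def sq L2_def mem_Collect_eq by blast
    qed
  next
    assume a: "almost_periodic (indicator B)"
    show "orbit_L2_precompact M G act B"
      unfolding orbit_L2_precompact_def sq
    proof (intro allI impI)
      fix s :: "nat \<Rightarrow> 'g" assume s: "\<forall>n. s n \<in> carrier G"
      obtain r u where "strict_mono r" "u \<in> L2 M"
        "(\<lambda>n. l2norm M (\<lambda>x. indicator B (act (s (r n)) x) - u x)) \<longlonglongrightarrow> 0"
        by (rule almost_periodic_imp_precompact[OF a s[rule_format]])
      then show "\<exists>r f. strict_mono r \<and> f \<in> borel_measurable M \<and> integrable M (\<lambda>x. (f x)\<^sup>2) \<and>
        (\<lambda>n. l2norm M (\<lambda>x. indicator B (act (s (r n)) x) - f x)) \<longlonglongrightarrow> 0"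
        by (auto simp: L2_def)
    qed
  qed
  then show ?thesis by (auto simp: kronecker_sets_def)
qed

section \<open>The Kronecker sets as a sigma-algebra\<close>

lemma almost_periodic_const: "almost_periodic (\<lambda>x. c)"
  unfolding almost_periodic_def
proof (intro conjI allI impI)
  show "(\<lambda>x. c) \<in> L2 M" by (rule bounded_L2[where c = "\<bar>c\<bar>"]) auto
  show "orbit_coloured (\<lambda>x. c) e" if "e > 0" for e
    using that by (intro orbit_colouredI[where \<Phi> = "\<lambda>_. ()"]) (auto simp: l2norm_def finite_subset)
qed

lemma almost_periodic_cong:
  assumes "almost_periodic f" "\<And>x. x \<in> space M \<Longrightarrow> f x = k x"
  shows "almost_periodic k"
proof (rule almost_periodic_limit)
  show k: "k \<in> L2 M" using almost_periodic_L2[OF assms(1)] assms(2)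
    by (auto simp: L2_def cong: measurable_cong Bochner_Integration.integrable_cong)
  have "l2norm M (\<lambda>x. f x - k x) = l2norm M (\<lambda>x. 0)"
    unfolding l2norm_def
    by (intro arg_cong[where f = sqrt] Bochner_Integration.integral_cong) (auto simp: assms(2))
  then have "l2norm M (\<lambda>x. f x - k x) = 0" by (simp add: l2norm_def)
  then show "\<exists>v\<in>L2 M. l2norm M (\<lambda>x. v x - k x) < e \<and> orbit_coloured v e" if "e > 0" for e
    using that assms(1) by (intro bexI[of _ f]) (auto simp: almost_periodic_def)
qed

lemma kronecker_sets_empty: "{} \<in> kronecker_sets M G act"
proof -
  have "almost_periodic (indicator {})" by (rule almost_periodic_cong[OF almost_periodic_const[of 0]]) auto
  then show ?thesis by (simp add: kronecker_sets_iff)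
qed

lemma kronecker_sets_UN_finite:
  assumes "\<And>i::nat. A i \<in> kronecker_sets M G act"
  shows "(\<Union>i<n. A i) \<in> kronecker_sets M G act"
proof (induction n)
  case 0
  then show ?case by (simp add: kronecker_sets_empty)
next
  case (Suc n)
  let ?B = "\<Union>i<n. A i"
  have "almost_periodic (\<lambda>x. max (indicator ?B x) (indicator (A n) x))"
  proof (rule almost_periodic_Lipschitz2[where c = 1 and F = max and f = "indicator ?B" and k = "indicator (A n)"])
    show "almost_periodic (indicator ?B)" "almost_periodic (indicator (A n))"
      using Suc assms[of n] by (auto simp: kronecker_sets_iff)
    have [measurable]: "?B \<in> sets M" "A n \<in> sets M"
      using Suc assms[of n] unfolding kronecker_sets_iff by blast+
    show "(\<lambda>x. max (indicator ?B x) (indicator (A n) x :: real)) \<in> L2 M"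
      by (rule bounded_L2[where c = 1]) (measurable, auto simp: indicator_def)
  qed (auto simp: max_def abs_if)
  then have "almost_periodic (indicator (\<Union>i<Suc n. A i))"
    by (rule almost_periodic_cong) (auto simp: indicator_def less_Suc_eq)
  moreover have "(\<Union>i<Suc n. A i) \<in> sets M"
    using assms unfolding kronecker_sets_iff by blast
  ultimately show ?case unfolding kronecker_sets_iff by blast
qed

text \<open>Complements and finite unions are Lipschitz operations on indicators, and a countable
  union is a bounded pointwise limit of finite ones. Hence \<open>sigma\<close> in the definition of
  \<open>kronecker_algebra\<close> adds no sets.\<close>

lemma sigma_algebra_kronecker: "sigma_algebra (space M) (kronecker_sets M G act)"
  unfolding sigma_algebra_iff2
proof (intro conjI ballI allI impI)
  show "kronecker_sets M G act \<subseteq> Pow (space M)"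
    by (auto simp: kronecker_sets_iff dest: sets.sets_into_space[THEN subsetD])
  show "{} \<in> kronecker_sets M G act"
    by (rule kronecker_sets_empty)
next
  fix B assume B: "B \<in> kronecker_sets M G act"
  then have [measurable]: "B \<in> sets M" by (simp add: kronecker_sets_iff)
  have "almost_periodic (\<lambda>x. 1 - indicator B x)"
  proof (rule almost_periodic_Lipschitz2[where c = 1 and F = "\<lambda>a b. 1 - a"])
    show "almost_periodic (indicator B)" "almost_periodic (\<lambda>x. 0)" using B by (auto simp: kronecker_sets_iff almost_periodic_const)
    show "(\<lambda>x. 1 - indicator B x :: real) \<in> L2 M"
      by (rule bounded_L2[where c = 1]) (auto simp: indicator_def)
  qed (auto simp: abs_if)
  then have "almost_periodic (indicator (space M - B))"
    by (rule almost_periodic_cong) (auto simp: indicator_def)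
  then show "space M - B \<in> kronecker_sets M G act" by (simp add: kronecker_sets_iff)
next
  fix A :: "nat \<Rightarrow> 'x set" assume "range A \<subseteq> kronecker_sets M G act"
  then have A: "A i \<in> kronecker_sets M G act" for i by auto
  have "almost_periodic (indicator (\<Union>i. A i))"
  proof (rule almost_periodic_pointwise_limit)
    show "almost_periodic (indicator (\<Union>i<n. A i))" for n
      using kronecker_sets_UN_finite[of A n] A by (simp only: kronecker_sets_iff)
    show "(\<lambda>n. indicator (\<Union>i<n. A i) x :: real) \<longlonglongrightarrow> indicator (\<Union>i. A i) x" for x
      by (rule LIMSEQ_indicator_UN)
    show "\<bar>indicator (\<Union>i<n. A i) x :: real\<bar> \<le> 1" for n x by (simp add: indicator_def)
  qed
  then show "(\<Union>i. A i) \<in> kronecker_sets M G act"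
    using A by (auto simp: kronecker_sets_iff)
qed

abbreviation "\<K> \<equiv> kronecker_algebra M G act"

lemma sets_kronecker: "sets \<K> = kronecker_sets M G act"
  unfolding kronecker_algebra_def
  by (rule sigma_algebra.sets_measure_of_eq[OF sigma_algebra_kronecker])

lemma space_kronecker: "space \<K> = space M"
  unfolding kronecker_algebra_def by (rule space_measure_of_conv)

lemma subalgebra_kronecker: "subalgebra M \<K>"
  by (auto simp: subalgebra_def sets_kronecker space_kronecker kronecker_sets_iff)

text \<open>The indicator of \<open>{c < u}\<close> is the pointwise limit of the Lipschitz
  truncations \<open>?F n\<close> of \<open>u\<close>, so superlevel sets are Kronecker sets.
  Consequently \<open>1 - E(.|\<K>)\<close> applied to an indicator is orthogonal to every almost
  periodic function.\<close>

lemma almost_periodic_measurable: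
  assumes u: "almost_periodic u" shows "u \<in> borel_measurable \<K>"
proof (rule borel_measurableI_greater)
  fix c :: real
  have [measurable]: "u \<in> borel_measurable M" using almost_periodic_L2[OF u] by (simp add: L2_def)
  have "almost_periodic (indicator {x \<in> space M. c < u x})"
  proof (rule almost_periodic_pointwise_limit)
    let ?F = "\<lambda>n a. min 1 (max 0 (real n * (a - c)))"
    show "almost_periodic (\<lambda>x. ?F n (u x))" for n
    proof (rule almost_periodic_Lipschitz2[where F = "\<lambda>a b. ?F n a", OF u almost_periodic_const[of 0]])
      show "(\<lambda>x. ?F n (u x)) \<in> L2 M"
        by (rule bounded_L2[where c = 1]) auto
      show "\<bar>?F n a - ?F n a'\<bar> \<le> real n * (\<bar>a - a'\<bar> + \<bar>b - b'\<bar>)" for a b a' b'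
      proof -
        have "\<bar>?F n a - ?F n a'\<bar> \<le> \<bar>real n * (a - c) - real n * (a' - c)\<bar>" by linarith
        also have "\<dots> = real n * \<bar>a - a'\<bar>" by (simp add: abs_mult flip: right_diff_distrib)
        also have "\<dots> \<le> real n * (\<bar>a - a'\<bar> + \<bar>b - b'\<bar>)" by (intro mult_left_mono) auto
        finally show ?thesis .
      qed
    qed
    show "\<bar>?F n (u x)\<bar> \<le> 1" for n x by auto
    fix x assume x: "x \<in> space M"
    show "(\<lambda>n. ?F n (u x)) \<longlonglongrightarrow> indicator {x \<in> space M. c < u x} x"
    proof (cases "c < u x")
      case True
      obtain N where N: "1 < real N * (u x - c)"
        using ex_less_of_nat_mult[of "u x - c" 1] True by auto
      have "\<forall>n\<ge>N. ?F n (u x) = 1"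
      proof (intro allI impI)
        fix n assume "n \<ge> N"
        then have "real N * (u x - c) \<le> real n * (u x - c)" using True by (intro mult_right_mono) auto
        then show "?F n (u x) = 1" using N by auto
      qed
      then have "\<forall>\<^sub>F n in sequentially. ?F n (u x) = 1" by (auto simp: eventually_sequentially)
      then show ?thesis using True x by (simp add: tendsto_eventually)
    next
      case False
      then have "?F n (u x) = 0" for n by (simp add: mult_nonneg_nonpos)
      then show ?thesis using False by simp
    qed
  qed
  then show "{x \<in> space \<K>. c < u x} \<in> sets \<K>"
    unfolding sets_kronecker space_kronecker kronecker_sets_iff by simp
qed

end


section \<open>Vanishing correlations\<close>

context prob_space
begin

text \<open>The bound holds at every point of \<open>space M\<close>, so that every row
  \<open>K x\<close>, not merely almost every one, is square-integrable.\<close>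

definition bounded_kernels :: "('a \<Rightarrow> 'a \<Rightarrow> real) set" where
  "bounded_kernels = {K. (\<lambda>z. K (fst z) (snd z)) \<in> borel_measurable (M \<Otimes>\<^sub>M M) \<and>
     (\<exists>B. \<forall>x\<in>space M. \<forall>y\<in>space M. \<bar>K x y\<bar> \<le> B)}"

text \<open>The squared Hilbert-Schmidt norm, as an iterated integral so that everything can be
  computed row by row.\<close>

definition hs_sq :: "('a \<Rightarrow> 'a \<Rightarrow> real) \<Rightarrow> real" where
  "hs_sq K = (\<integral>x. (\<integral>y. (K x y)\<^sup>2 \<partial>M) \<partial>M)"

definition kop :: "('a \<Rightarrow> 'a \<Rightarrow> real) \<Rightarrow> ('a \<Rightarrow> real) \<Rightarrow> 'a \<Rightarrow> real" where
  "kop K h x = (\<integral>y. K x y * h y \<partial>M)"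

lemma bounded_kernels_measurable:
  "K \<in> bounded_kernels \<Longrightarrow> (\<lambda>z. K (fst z) (snd z)) \<in> borel_measurable (M \<Otimes>\<^sub>M M)"
  by (simp add: bounded_kernels_def)

lemma bounded_kernels_row:
  assumes "K \<in> bounded_kernels" "x \<in> space M"
  shows "K x \<in> L2 M"
proof -
  obtain B where "\<forall>x\<in>space M. \<forall>y\<in>space M. \<bar>K x y\<bar> \<le> B"
    using assms by (auto simp: bounded_kernels_def)
  moreover have "K x \<in> borel_measurable M"
    using measurable_compose[OF measurable_Pair1'[OF assms(2)] bounded_kernels_measurable[OF assms(1)]]
    by simp
  ultimately show ?thesis using assms(2) by (intro bounded_L2) auto
qed

lemma bounded_kernels_lincomb:
  assumes K: "K \<in> bounded_kernels" and L: "L \<in> bounded_kernels"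
    and eq: "\<And>x y. x \<in> space M \<Longrightarrow> y \<in> space M \<Longrightarrow> N x y = a * K x y + b * L x y"
  shows "N \<in> bounded_kernels"
proof -
  note [measurable] = bounded_kernels_measurable[OF K] bounded_kernels_measurable[OF L]
  obtain B C where B: "\<forall>x\<in>space M. \<forall>y\<in>space M. \<bar>K x y\<bar> \<le> B"
    and C: "\<forall>x\<in>space M. \<forall>y\<in>space M. \<bar>L x y\<bar> \<le> C"
    using K L by (auto simp: bounded_kernels_def)
  have "\<bar>N x y\<bar> \<le> \<bar>a\<bar> * B + \<bar>b\<bar> * C" if "x \<in> space M" "y \<in> space M" for x y
  proof -
    have "\<bar>N x y\<bar> \<le> \<bar>a\<bar> * \<bar>K x y\<bar> + \<bar>b\<bar> * \<bar>L x y\<bar>"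
      unfolding eq[OF that] using abs_triangle_ineq[of "a * K x y" "b * L x y"] by (simp add: abs_mult)
    also have "\<dots> \<le> \<bar>a\<bar> * B + \<bar>b\<bar> * C"
      using B C that by (intro add_mono mult_left_mono) auto
    finally show ?thesis .
  qed
  moreover have "(\<lambda>z. N (fst z) (snd z)) \<in> borel_measurable (M \<Otimes>\<^sub>M M)
      \<longleftrightarrow> (\<lambda>z. a * K (fst z) (snd z) + b * L (fst z) (snd z)) \<in> borel_measurable (M \<Otimes>\<^sub>M M)"
    by (intro measurable_cong) (auto simp: space_pair_measure eq)
  ultimately show ?thesis by (auto simp: bounded_kernels_def)
qed

lemma bounded_kernels_sq_row:
  assumes K: "K \<in> bounded_kernels"
  shows "integrable M (\<lambda>x. \<integral>y. (K x y)\<^sup>2 \<partial>M)"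
proof -
  note [measurable] = bounded_kernels_measurable[OF K]
  obtain B where B: "\<And>x y. x \<in> space M \<Longrightarrow> y \<in> space M \<Longrightarrow> \<bar>K x y\<bar> \<le> B"
    using K by (auto simp: bounded_kernels_def)
  have m: "(\<lambda>(x, y). (K x y)\<^sup>2) \<in> borel_measurable (M \<Otimes>\<^sub>M M)"
    by (simp add: split_beta')
  show ?thesis
  proof (rule integrable_const_bound[where B = "B\<^sup>2"])
    show "AE x in M. norm (\<integral>y. (K x y)\<^sup>2 \<partial>M) \<le> B\<^sup>2"
    proof (rule AE_I2)
      fix x assume x: "x \<in> space M"
      have "(\<integral>y. (K x y)\<^sup>2 \<partial>M) \<le> (\<integral>y. B\<^sup>2 \<partial>M)"
        using L2_integrable_sq[OF bounded_kernels_row[OF K x]]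
        by (intro integral_mono) (auto intro!: power2_le_iff_abs_le[THEN iffD2] B x
            intro: order_trans[OF abs_ge_zero B[OF x x]])
      then show "norm (\<integral>y. (K x y)\<^sup>2 \<partial>M) \<le> B\<^sup>2" by (simp add: prob_space)
    qed
    show "(\<lambda>x. \<integral>y. (K x y)\<^sup>2 \<partial>M) \<in> borel_measurable M"
      by (rule borel_measurable_lebesgue_integral[OF m])
  qed
qed

lemma hs_sq_nonneg: "0 \<le> hs_sq K"
  by (simp add: hs_sq_def)

text \<open>The parallelogram law, solved for the difference: two elements of a convex set whose
  norms are close to the infimum must be close to each other, since their midpoint cannot lie below
  the infimum.\<close>

lemma hs_sq_parallelogram:
  assumes K: "K \<in> bounded_kernels" and L: "L \<in> bounded_kernels"
    and N: "\<And>x y. x \<in> space M \<Longrightarrow> y \<in> space M \<Longrightarrow> N x y = (K x y + L x y) / 2"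
  shows "hs_sq (\<lambda>x y. K x y - L x y) = 2 * hs_sq K + 2 * hs_sq L - 4 * hs_sq N"
proof -
  have NB: "N \<in> bounded_kernels"
    by (rule bounded_kernels_lincomb[OF K L, of _ "1/2" "1/2"]) (simp add: N)
  have row: "(\<integral>y. (K x y - L x y)\<^sup>2 \<partial>M)
      = 2 * (\<integral>y. (K x y)\<^sup>2 \<partial>M) + 2 * (\<integral>y. (L x y)\<^sup>2 \<partial>M) - 4 * (\<integral>y. (N x y)\<^sup>2 \<partial>M)"
    if x: "x \<in> space M" for x
  proof -
    note [simp] = L2_integrable_sq[OF bounded_kernels_row[OF K x]]
      L2_integrable_sq[OF bounded_kernels_row[OF L x]] L2_integrable_sq[OF bounded_kernels_row[OF NB x]]
    have "(\<integral>y. (K x y - L x y)\<^sup>2 \<partial>M)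
        = (\<integral>y. 2 * (K x y)\<^sup>2 + 2 * (L x y)\<^sup>2 - 4 * (N x y)\<^sup>2 \<partial>M)"
      by (intro Bochner_Integration.integral_cong) (auto simp: N x power2_eq_square field_simps)
    then show ?thesis by simp
  qed
  have "hs_sq (\<lambda>x y. K x y - L x y)
      = (\<integral>x. 2 * (\<integral>y. (K x y)\<^sup>2 \<partial>M) + 2 * (\<integral>y. (L x y)\<^sup>2 \<partial>M) - 4 * (\<integral>y. (N x y)\<^sup>2 \<partial>M) \<partial>M)"
    unfolding hs_sq_def by (intro Bochner_Integration.integral_cong) (auto simp: row)
  then show ?thesis
    using bounded_kernels_sq_row[OF K] bounded_kernels_sq_row[OF L] bounded_kernels_sq_row[OF NB]
    by (simp add: hs_sq_def)
qed

text \<open>Cauchy-Schwarz in each row: the operator norm is at most the Hilbert-Schmidt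
  norm.\<close>

lemma kop_L2:
  assumes K: "K \<in> bounded_kernels" and h: "h \<in> L2 M"
  shows "kop K h \<in> L2 M" "l2norm M (kop K h) \<le> sqrt (hs_sq K) * l2norm M h"
proof -
  note [measurable] = bounded_kernels_measurable[OF K] L2_measurable[OF h]
  have "(\<lambda>(x, y). K x y * h y) \<in> borel_measurable (M \<Otimes>\<^sub>M M)"
    by (simp add: split_beta')
  from borel_measurable_lebesgue_integral[OF this]
  have m: "kop K h \<in> borel_measurable M" by (simp add: kop_def[abs_def])
  have le: "(kop K h x)\<^sup>2 \<le> (\<integral>y. (K x y)\<^sup>2 \<partial>M) * (\<integral>y. (h y)\<^sup>2 \<partial>M)" if "x \<in> space M" for x
    unfolding kop_def using Cauchy_Schwarz_integral_sq[OF bounded_kernels_row[OF K that] h] .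
  have int: "integrable M (\<lambda>x. (\<integral>y. (K x y)\<^sup>2 \<partial>M) * (\<integral>y. (h y)\<^sup>2 \<partial>M))"
    using bounded_kernels_sq_row[OF K] by simp
  have int': "integrable M (\<lambda>x. (kop K h x)\<^sup>2)"
    by (rule Bochner_Integration.integrable_bound[OF int]) (use m le in auto)
  then show "kop K h \<in> L2 M" using m by (simp add: L2_def)
  have "(\<integral>x. (kop K h x)\<^sup>2 \<partial>M) \<le> (\<integral>x. (\<integral>y. (K x y)\<^sup>2 \<partial>M) * (\<integral>y. (h y)\<^sup>2 \<partial>M) \<partial>M)"
    using int int' le by (intro integral_mono) auto
  also have "\<dots> = hs_sq K * (l2norm M h)\<^sup>2" by (simp add: hs_sq_def l2norm_sq)
  finally have "sqrt (\<integral>x. (kop K h x)\<^sup>2 \<partial>M) \<le> sqrt (hs_sq K * (l2norm M h)\<^sup>2)"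
    by (rule real_sqrt_le_mono)
  then show "l2norm M (kop K h) \<le> sqrt (hs_sq K) * l2norm M h"
    by (simp add: real_sqrt_mult) (simp add: l2norm_def)
qed

lemma kop_lincomb:
  assumes K: "K \<in> bounded_kernels" and L: "L \<in> bounded_kernels" and h: "h \<in> L2 M"
    and N: "\<And>x y. x \<in> space M \<Longrightarrow> y \<in> space M \<Longrightarrow> N x y = a * K x y + b * L x y"
    and x: "x \<in> space M"
  shows "kop N h x = a * kop K h x + b * kop L h x"
proof -
  note [simp] = L2_integrable_mult[OF bounded_kernels_row[OF K x] h]
    L2_integrable_mult[OF bounded_kernels_row[OF L x] h]
  have "kop N h x = (\<integral>y. a * (K x y * h y) + b * (L x y * h y) \<partial>M)"
    unfolding kop_def by (intro Bochner_Integration.integral_cong) (auto simp: N x algebra_simps)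
  then show ?thesis by (simp add: kop_def)
qed

lemma l2norm_cong: "(\<And>x. x \<in> space M \<Longrightarrow> f x = g x) \<Longrightarrow> l2norm M f = l2norm M g"
  unfolding l2norm_def by (metis (mono_tags, lifting) Bochner_Integration.integral_cong)

lemma l2norm_kop_diff:
  assumes K: "K \<in> bounded_kernels" and L: "L \<in> bounded_kernels" and h: "h \<in> L2 M"
  shows "l2norm M (\<lambda>x. kop K h x - kop L h x) \<le> sqrt (hs_sq (\<lambda>x y. K x y - L x y)) * l2norm M h"
proof -
  have D: "(\<lambda>x y. K x y - L x y) \<in> bounded_kernels"
    by (rule bounded_kernels_lincomb[OF K L, of _ 1 "-1"]) simp
  have "l2norm M (\<lambda>x. kop K h x - kop L h x) = l2norm M (kop (\<lambda>x y. K x y - L x y) h)"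
    by (rule l2norm_cong) (simp add: kop_lincomb[OF K L h, of _ 1 "-1"])
  then show ?thesis using kop_L2(2)[OF D h] by simp
qed

lemma l2norm_le_const:
  assumes "0 \<le> c" "f \<in> borel_measurable M" "\<And>x. x \<in> space M \<Longrightarrow> \<bar>f x\<bar> \<le> c"
  shows "l2norm M f \<le> c"
  using l2norm_mono(2)[of f M "\<lambda>_. c"] assms bounded_L2[of "\<lambda>_. c" c]
  by (simp add: l2norm_def prob_space)

end

text \<open>Orthogonality to the almost periodic functions characterises the weakly mixing part. A
  whole finite family is taken because a single group element has to decorrelate all its
  members.\<close>

locale weakly_mixing_family = pmp_action M G act
  for M :: "'x measure" and G :: "('g, 'b) monoid_scheme" (structure) and act +
  fixes I :: "'i set" and f :: "'i \<Rightarrow> 'x \<Rightarrow> real" and c :: real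
  assumes finite_I: "finite I"
    and f_measurable: "\<And>i. i \<in> I \<Longrightarrow> f i \<in> borel_measurable M"
    and f_bounded: "\<And>i x. i \<in> I \<Longrightarrow> x \<in> space M \<Longrightarrow> \<bar>f i x\<bar> \<le> c"
    and f_orth: "\<And>i k. i \<in> I \<Longrightarrow> almost_periodic k \<Longrightarrow> (\<integral>x. f i x * k x \<partial>M) = 0"
begin

lemma f_L2: "i \<in> I \<Longrightarrow> f i \<in> L2 M"
  using bounded_L2[OF f_measurable f_bounded] .

abbreviation corr :: "'g \<Rightarrow> 'i \<Rightarrow> ('x \<Rightarrow> real) \<Rightarrow> real" where
  "corr g i h \<equiv> (\<integral>y. f i (act g y) * h y \<partial>M)"

text \<open>The convex hull of the orbit of \<open>\<Sum>i. f i \<otimes> f i\<close>, where midpoints are enough; kernels matter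
  only on \<open>space M\<close>.\<close>
inductive_set kernel_hull :: "('x \<Rightarrow> 'x \<Rightarrow> real) set" where
  orbit: "g \<in> carrier G \<Longrightarrow> (\<And>x y. x \<in> space M \<Longrightarrow> y \<in> space M \<Longrightarrow>
      K x y = (\<Sum>i\<in>I. f i (act g x) * f i (act g y))) \<Longrightarrow> K \<in> kernel_hull"
| mid: "K \<in> kernel_hull \<Longrightarrow> L \<in> kernel_hull \<Longrightarrow> (\<And>x y. x \<in> space M \<Longrightarrow> y \<in> space M \<Longrightarrow>
      N x y = (K x y + L x y) / 2) \<Longrightarrow> N \<in> kernel_hull"

section \<open>Properties of the hull: invariance, orthogonality, lower bound, finite rank\<close>

lemma kernel_hull_bounded: "K \<in> kernel_hull \<Longrightarrow> K \<in> bounded_kernels"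
proof (induction rule: kernel_hull.induct)
  case (orbit g K)
  note [measurable] = act_measurable[OF orbit(1)] f_measurable
  have "(\<lambda>z. K (fst z) (snd z)) \<in> borel_measurable (M \<Otimes>\<^sub>M M) \<longleftrightarrow>
      (\<lambda>z. \<Sum>i\<in>I. f i (act g (fst z)) * f i (act g (snd z))) \<in> borel_measurable (M \<Otimes>\<^sub>M M)"
    by (intro measurable_cong) (auto simp: space_pair_measure orbit(2))
  then have "(\<lambda>z. K (fst z) (snd z)) \<in> borel_measurable (M \<Otimes>\<^sub>M M)"
    by simp
  moreover have "\<bar>K x y\<bar> \<le> (\<Sum>i\<in>I. c * c)" if "x \<in> space M" "y \<in> space M" for x y
    unfolding orbit(2)[OF that]
  proof (rule order_trans[OF sum_abs], rule sum_mono)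
    fix i assume "i \<in> I"
    then have "\<bar>f i (act g x)\<bar> \<le> c" "\<bar>f i (act g y)\<bar> \<le> c"
      using f_bounded act_space orbit(1) that by auto
    then show "\<bar>f i (act g x) * f i (act g y)\<bar> \<le> c * c"
      unfolding abs_mult by (intro mult_mono) auto
  qed
  ultimately show ?case by (auto simp: bounded_kernels_def)
next
  case (mid K L N)
  show ?case by (rule bounded_kernels_lincomb[OF mid.IH, of _ "1/2" "1/2"]) (simp add: mid.hyps(3))
qed

text \<open>Acting by \<open>\<gamma>\<close> on both variables turns the orbit kernel of
  \<open>g\<close> into that of \<open>g \<otimes> \<gamma>\<close> and respects midpoints.\<close>

lemma kernel_hull_act:
  assumes "K \<in> kernel_hull" "\<gamma> \<in> carrier G"
  shows "(\<lambda>x y. K (act \<gamma> x) (act \<gamma> y)) \<in> kernel_hull"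
  using assms
proof (induction rule: kernel_hull.induct)
  case (orbit g K)
  show ?case
    by (rule kernel_hull.orbit[of "g \<otimes> \<gamma>"]) (use orbit in \<open>auto simp: act_mult act_space\<close>)
next
  case (mid K L N)
  show ?case
    by (rule kernel_hull.mid[OF mid.IH]) (use mid in \<open>auto simp: act_space\<close>)
qed

lemma hs_sq_act:
  assumes K: "K \<in> bounded_kernels" and g: "g \<in> carrier G"
  shows "hs_sq (\<lambda>x y. K (act g x) (act g y)) = hs_sq K"
proof -
  have "(\<integral>y. (K (act g x) (act g y))\<^sup>2 \<partial>M) = (\<integral>y. (K (act g x) y)\<^sup>2 \<partial>M)" if "x \<in> space M" for x
    using integral_act[OF g, of "\<lambda>y. (K (act g x) y)\<^sup>2"]
      L2_measurable[OF bounded_kernels_row[OF K act_space[OF g that]]] by simp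
  then have "hs_sq (\<lambda>x y. K (act g x) (act g y)) = (\<integral>x. (\<integral>y. (K (act g x) y)\<^sup>2 \<partial>M) \<partial>M)"
    unfolding hs_sq_def by (rule Bochner_Integration.integral_cong[OF refl])
  also have "\<dots> = hs_sq K"
    unfolding hs_sq_def
    by (rule integral_act[OF g borel_measurable_integrable[OF bounded_kernels_sq_row[OF K]]])
  finally show ?thesis .
qed

text \<open>For an invariant kernel this says that the operator commutes with the action. The
  kernels used are invariant only up to a small error, so the translated kernel is kept.\<close>

lemma kop_act:
  assumes K: "K \<in> bounded_kernels" and h: "h \<in> L2 M" and g: "g \<in> carrier G" and x: "x \<in> space M"
  shows "kop K h (act g x) = kop (\<lambda>x y. K (act g x) (act g y)) (\<lambda>y. h (act g y)) x"
  unfolding kop_def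
  using integral_act[OF g, of "\<lambda>y. K (act g x) y * h y"] L2_measurable[OF h]
    L2_measurable[OF bounded_kernels_row[OF K act_space[OF g x]]] by simp

lemma kop_orbit:
  assumes g: "g \<in> carrier G" and h: "h \<in> L2 M" and x: "x \<in> space M"
    and K: "\<And>x y. x \<in> space M \<Longrightarrow> y \<in> space M \<Longrightarrow> K x y = (\<Sum>i\<in>I. f i (act g x) * f i (act g y))"
  shows "kop K h x = (\<Sum>i\<in>I. f i (act g x) * corr g i h)"
proof -
  have "kop K h x = (\<integral>y. (\<Sum>i\<in>I. f i (act g x) * (f i (act g y) * h y)) \<partial>M)"
    unfolding kop_def
    by (intro Bochner_Integration.integral_cong) (auto simp: K x sum_distrib_right mult.assoc)
  also have "\<dots> = (\<Sum>i\<in>I. f i (act g x) * corr g i h)"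
    by (subst Bochner_Integration.integral_sum) (auto intro!: L2_integrable_mult L2_act g f_L2 h)
  finally show ?thesis .
qed

text \<open>For \<open>h = k\<close> the right-hand side is the sum of squared correlations, the
  quantity that must be made small.\<close>

lemma integral_kop_orbit:
  assumes g: "g \<in> carrier G" and h: "h \<in> L2 M" and k: "k \<in> L2 M"
    and K: "\<And>x y. x \<in> space M \<Longrightarrow> y \<in> space M \<Longrightarrow> K x y = (\<Sum>i\<in>I. f i (act g x) * f i (act g y))"
  shows "(\<integral>x. kop K h x * k x \<partial>M) = (\<Sum>i\<in>I. corr g i h * corr g i k)"
proof -
  have "(\<integral>x. kop K h x * k x \<partial>M) = (\<integral>x. (\<Sum>i\<in>I. corr g i h * (f i (act g x) * k x)) \<partial>M)"
    by (intro Bochner_Integration.integral_cong)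
      (auto simp: kop_orbit[OF g h _ K] sum_distrib_right intro!: sum.cong)
  also have "\<dots> = (\<Sum>i\<in>I. corr g i h * corr g i k)"
    by (subst Bochner_Integration.integral_sum) (auto intro!: L2_integrable_mult L2_act g f_L2 k)
  finally show ?thesis .
qed

lemma integral_kop_mid:
  assumes K: "K \<in> kernel_hull" and L: "L \<in> kernel_hull" and h: "h \<in> L2 M" and k: "k \<in> L2 M"
    and N: "\<And>x y. x \<in> space M \<Longrightarrow> y \<in> space M \<Longrightarrow> N x y = (K x y + L x y) / 2"
  shows "(\<integral>x. kop N h x * k x \<partial>M) = ((\<integral>x. kop K h x * k x \<partial>M) + (\<integral>x. kop L h x * k x \<partial>M)) / 2"
proof -
  note B = kernel_hull_bounded[OF K] kernel_hull_bounded[OF L]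
  note [simp] = L2_integrable_mult[OF kop_L2(1)[OF B(1) h] k] L2_integrable_mult[OF kop_L2(1)[OF B(2) h] k]
  have "kop N h x = 1/2 * kop K h x + 1/2 * kop L h x" if "x \<in> space M" for x
    by (rule kop_lincomb[OF B h _ that]) (simp add: N)
  then have "(\<integral>x. kop N h x * k x \<partial>M) = (\<integral>x. 1/2 * (kop K h x * k x) + 1/2 * (kop L h x * k x) \<partial>M)"
    by (intro Bochner_Integration.integral_cong) (auto simp: algebra_simps)
  then show ?thesis by simp
qed

text \<open>The correlation of a translate of \<open>f i\<close> with \<open>k\<close> is the
  integral of \<open>f i\<close> against a translate of \<open>k\<close>, and translates of almost
  periodic functions are almost periodic.\<close>

lemma kernel_hull_orth_almost_periodic:
  assumes "K \<in> kernel_hull" and h: "h \<in> L2 M" and k: "almost_periodic k"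
  shows "(\<integral>x. kop K h x * k x \<partial>M) = 0"
  using assms(1)
proof (induction rule: kernel_hull.induct)
  case (orbit g K)
  have "corr g i k = 0" if "i \<in> I" for i
    using integral_act_adjoint[OF orbit(1) f_measurable[OF that] L2_measurable[OF almost_periodic_L2[OF k]]]
      f_orth[OF that almost_periodic_act[OF k, of "inv g"]] orbit(1) by simp
  then show ?case
    using integral_kop_orbit[OF orbit(1) h almost_periodic_L2[OF k] orbit(2)] by simp
next
  case (mid K L N)
  then show ?case using integral_kop_mid[OF mid.hyps(1,2) h almost_periodic_L2[OF k] mid.hyps(3)] by simp
qed

text \<open>The quadratic form is affine in the kernel, so a lower bound on the orbit passes to
  midpoints.\<close>

lemma kernel_hull_quadratic_ge:
  assumes "K \<in> kernel_hull" and J: "finite J" and h: "\<And>j. j \<in> J \<Longrightarrow> h j \<in> L2 M"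
    and ge: "\<And>g. g \<in> carrier G \<Longrightarrow> e \<le> (\<Sum>j\<in>J. \<Sum>i\<in>I. (corr g i (h j))\<^sup>2)"
  shows "e \<le> (\<Sum>j\<in>J. \<integral>x. kop K (h j) x * h j x \<partial>M)"
  using assms(1)
proof (induction rule: kernel_hull.induct)
  case (orbit g K)
  have "(\<Sum>j\<in>J. \<integral>x. kop K (h j) x * h j x \<partial>M) = (\<Sum>j\<in>J. \<Sum>i\<in>I. (corr g i (h j))\<^sup>2)"
    by (rule sum.cong[OF refl])
      (simp add: integral_kop_orbit[OF orbit(1) h h orbit(2)] power2_eq_square)
  then show ?case using ge[OF orbit(1)] by simp
next
  case (mid K L N)
  have "(\<Sum>j\<in>J. \<integral>x. kop N (h j) x * h j x \<partial>M)
      = ((\<Sum>j\<in>J. \<integral>x. kop K (h j) x * h j x \<partial>M) + (\<Sum>j\<in>J. \<integral>x. kop L (h j) x * h j x \<partial>M)) / 2"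
    by (simp add: integral_kop_mid[OF mid.hyps(1,2) h h mid.hyps(3)] sum.distrib flip: sum_divide_distrib)
  then show ?case using mid by simp
qed

text \<open>Kernels in the hull have finite rank, so a bounded set is mapped to a totally bounded one:
  round the finitely many coordinates.\<close>
lemma kernel_hull_coloured:
  assumes "K \<in> kernel_hull" and h: "h \<in> L2 M"
  shows "e > 0 \<Longrightarrow> \<exists>\<Phi> :: 'g \<Rightarrow> nat. finite (\<Phi> ` carrier G) \<and>
    (\<forall>\<gamma>\<in>carrier G. \<forall>\<gamma>'\<in>carrier G. \<Phi> \<gamma> = \<Phi> \<gamma>' \<longrightarrow>
      l2norm M (\<lambda>x. kop K (\<lambda>y. h (act \<gamma> y)) x - kop K (\<lambda>y. h (act \<gamma>' y)) x) < e)"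
  using assms(1)
proof (induction arbitrary: e rule: kernel_hull.induct)
  case (orbit g K)
  note kop_orb = kop_orbit[OF orbit(1) L2_act[OF _ h] _ orbit(2)]
  \<comment> \<open>The rounding mesh. Moving each of the \<open>card I\<close> coordinates by at
    most \<open>d\<close> moves the image by at most \<open>card I * \<bar>c\<bar> * d\<close>,
    which is below \<open>e\<close>; \<open>\<bar>c\<bar>\<close> and the 1 keep the denominator
    positive.\<close>
  define d where "d = e / (2 * (real (card I) * \<bar>c\<bar> + 1))"
  have pos: "0 < real (card I) * \<bar>c\<bar> + 1" by (simp add: add_nonneg_pos)
  then have d: "d > 0" using orbit(3) by (simp add: d_def)
  have "d * (2 * (real (card I) * \<bar>c\<bar> + 1)) = e"
    using pos unfolding d_def by (metis nonzero_divide_eq_eq less_irrefl mult_pos_pos zero_less_numeral)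
  then have small: "real (card I) * \<bar>c\<bar> * d < e"
    using d orbit(3) by (simp add: algebra_simps)
  let ?F = "\<lambda>\<gamma> i. corr g i (\<lambda>y. h (act \<gamma> y))"
  define \<Phi> where "\<Phi> \<gamma> = restrict (\<lambda>i. \<lfloor>?F \<gamma> i / d\<rfloor>) I" for \<gamma>
  have bnd: "\<bar>?F \<gamma> i\<bar> \<le> l2norm M (f i) * l2norm M h" if "\<gamma> \<in> carrier G" "i \<in> I" for \<gamma> i
    using Cauchy_Schwarz_integral[OF L2_act[OF orbit(1) f_L2[OF that(2)]] L2_act[OF that(1) h]]
      l2norm_act[OF orbit(1) f_measurable[OF that(2)]] l2norm_act[OF that(1) L2_measurable[OF h]] by simp
  define b where "b i = \<lceil>l2norm M (f i) * l2norm M h / d\<rceil>" for i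
  have "\<Phi> ` carrier G \<subseteq> (\<Pi>\<^sub>E i\<in>I. {- b i..b i})"
  proof (clarsimp simp: \<Phi>_def PiE_iff)
    fix \<gamma> i assume "\<gamma> \<in> carrier G" "i \<in> I"
    from bnd[OF this] d have "\<bar>?F \<gamma> i / d\<bar> \<le> l2norm M (f i) * l2norm M h / d"
      by (simp add: divide_right_mono)
    then have "\<bar>?F \<gamma> i / d\<bar> \<le> of_int (b i)" unfolding b_def by linarith
    then show "- b i \<le> \<lfloor>?F \<gamma> i / d\<rfloor> \<and> \<lfloor>?F \<gamma> i / d\<rfloor> \<le> b i" by linarith
  qed
  then have "finite (\<Phi> ` carrier G)"
    by (rule finite_subset) (auto intro: finite_PiE finite_I)
  then obtain \<Psi> :: "'g \<Rightarrow> nat" where fin: "finite (\<Psi> ` carrier G)" and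
    \<Psi>: "\<And>\<gamma> \<gamma>'. \<gamma> \<in> carrier G \<Longrightarrow> \<gamma>' \<in> carrier G \<Longrightarrow> \<Psi> \<gamma> = \<Psi> \<gamma>' \<Longrightarrow> \<Phi> \<gamma> = \<Phi> \<gamma>'"
    by (rule colouring_to_nat) blast
  show ?case
  proof (intro exI[of _ \<Psi>] conjI fin ballI impI)
    fix \<gamma> \<gamma>' assume gg: "\<gamma> \<in> carrier G" "\<gamma>' \<in> carrier G" "\<Psi> \<gamma> = \<Psi> \<gamma>'"
    have KB: "K \<in> bounded_kernels" using kernel_hull_bounded[OF kernel_hull.orbit[OF orbit(1,2)]] .
    have close: "\<bar>?F \<gamma> i - ?F \<gamma>' i\<bar> \<le> d" if "i \<in> I" for i
    proof -
      have "\<lfloor>?F \<gamma> i / d\<rfloor> = \<lfloor>?F \<gamma>' i / d\<rfloor>"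
        using fun_cong[OF \<Psi>[OF gg], of i] that by (simp add: \<Phi>_def)
      then have "\<bar>?F \<gamma> i / d - ?F \<gamma>' i / d\<bar> \<le> 1" by linarith
      then show ?thesis using d by (simp add: abs_le_iff field_simps flip: diff_divide_distrib)
    qed
    have "l2norm M (\<lambda>x. kop K (\<lambda>y. h (act \<gamma> y)) x - kop K (\<lambda>y. h (act \<gamma>' y)) x)
        \<le> real (card I) * \<bar>c\<bar> * d"
    proof (rule l2norm_le_const)
      show "0 \<le> real (card I) * \<bar>c\<bar> * d" using d by simp
      show "(\<lambda>x. kop K (\<lambda>y. h (act \<gamma> y)) x - kop K (\<lambda>y. h (act \<gamma>' y)) x) \<in> borel_measurable M"
        using L2_measurable[OF kop_L2(1)[OF KB L2_act[OF gg(1) h]]]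
          L2_measurable[OF kop_L2(1)[OF KB L2_act[OF gg(2) h]]] by simp
      fix x assume x: "x \<in> space M"
      have "kop K (\<lambda>y. h (act \<gamma> y)) x - kop K (\<lambda>y. h (act \<gamma>' y)) x
          = (\<Sum>i\<in>I. f i (act g x) * (?F \<gamma> i - ?F \<gamma>' i))"
        by (simp add: kop_orb gg x right_diff_distrib sum_subtractf)
      also have "\<bar>\<dots>\<bar> \<le> (\<Sum>i\<in>I. \<bar>c\<bar> * d)"
      proof (rule order_trans[OF sum_abs], rule sum_mono)
        fix i assume i: "i \<in> I"
        have "\<bar>f i (act g x)\<bar> \<le> \<bar>c\<bar>"
          using f_bounded[OF i act_space[OF orbit(1) x]] by simp
        then show "\<bar>f i (act g x) * (?F \<gamma> i - ?F \<gamma>' i)\<bar> \<le> \<bar>c\<bar> * d"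
          unfolding abs_mult using close[OF i] by (intro mult_mono) auto
      qed
      finally show "\<bar>kop K (\<lambda>y. h (act \<gamma> y)) x - kop K (\<lambda>y. h (act \<gamma>' y)) x\<bar> \<le> real (card I) * \<bar>c\<bar> * d"
        by simp
    qed
    with small show "l2norm M (\<lambda>x. kop K (\<lambda>y. h (act \<gamma> y)) x - kop K (\<lambda>y. h (act \<gamma>' y)) x) < e"
      by simp
  qed
next
  case (mid K L N)
  let ?D = "\<lambda>K \<gamma> \<gamma>' x. kop K (\<lambda>y. h (act \<gamma> y)) x - kop K (\<lambda>y. h (act \<gamma>' y)) x"
  from mid.IH(1)[OF mid.prems] obtain \<Phi> :: "'g \<Rightarrow> nat" where fin: "finite (\<Phi> ` carrier G)" and
    \<Phi>: "\<And>\<gamma> \<gamma>'. \<gamma> \<in> carrier G \<Longrightarrow> \<gamma>' \<in> carrier G \<Longrightarrow> \<Phi> \<gamma> = \<Phi> \<gamma>' \<Longrightarrow> l2norm M (?D K \<gamma> \<gamma>') < e"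
    by blast
  from mid.IH(2)[OF mid.prems] obtain \<Psi> :: "'g \<Rightarrow> nat" where fin': "finite (\<Psi> ` carrier G)" and
    \<Psi>: "\<And>\<gamma> \<gamma>'. \<gamma> \<in> carrier G \<Longrightarrow> \<gamma>' \<in> carrier G \<Longrightarrow> \<Psi> \<gamma> = \<Psi> \<gamma>' \<Longrightarrow> l2norm M (?D L \<gamma> \<gamma>') < e"
    by blast
  have "finite ((\<lambda>\<gamma>. (\<Phi> \<gamma>, \<Psi> \<gamma>)) ` carrier G)"
    by (rule finite_subset[OF _ finite_cartesian_product[OF fin fin']]) auto
  then obtain \<Theta> :: "'g \<Rightarrow> nat" where fin'': "finite (\<Theta> ` carrier G)" and
    \<Theta>: "\<And>\<gamma> \<gamma>'. \<gamma> \<in> carrier G \<Longrightarrow> \<gamma>' \<in> carrier G \<Longrightarrow> \<Theta> \<gamma> = \<Theta> \<gamma>' \<Longrightarrow> (\<Phi> \<gamma>, \<Psi> \<gamma>) = (\<Phi> \<gamma>', \<Psi> \<gamma>')"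
    by (rule colouring_to_nat) blast
  show ?case
  proof (intro exI[of _ \<Theta>] conjI fin'' ballI impI)
    fix \<gamma> \<gamma>' assume gg: "\<gamma> \<in> carrier G" "\<gamma>' \<in> carrier G" "\<Theta> \<gamma> = \<Theta> \<gamma>'"
    note B = kernel_hull_bounded[OF mid.hyps(1)] kernel_hull_bounded[OF mid.hyps(2)]
    have lin: "kop N (\<lambda>y. h (act \<gamma> y)) x = 1/2 * kop K (\<lambda>y. h (act \<gamma> y)) x + 1/2 * kop L (\<lambda>y. h (act \<gamma> y)) x"
      if "x \<in> space M" "\<gamma> \<in> carrier G" for x \<gamma>
      by (rule kop_lincomb[OF B L2_act[OF that(2) h] _ that(1)]) (simp add: mid.hyps(3))
    have L: "(\<lambda>x. 1/2 * ?D K \<gamma> \<gamma>' x) \<in> L2 M" "(\<lambda>x. 1/2 * ?D L \<gamma> \<gamma>' x) \<in> L2 M"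
      by (intro L2_cmult L2_diff kop_L2 B L2_act gg h)+
    have half: "l2norm M (\<lambda>x. 1/2 * F x) = 1/2 * l2norm M F" for F
      by (simp add: l2norm_def power_divide real_sqrt_divide)
    have "l2norm M (?D N \<gamma> \<gamma>') = l2norm M (\<lambda>x. 1/2 * ?D K \<gamma> \<gamma>' x + 1/2 * ?D L \<gamma> \<gamma>' x)"
      by (rule l2norm_cong) (simp add: lin gg field_simps)
    also have "\<dots> \<le> 1/2 * l2norm M (?D K \<gamma> \<gamma>') + 1/2 * l2norm M (?D L \<gamma> \<gamma>')"
      using l2norm_triangle[OF L] unfolding half .
    also have "\<dots> < e" using \<Phi>[OF gg(1,2)] \<Psi>[OF gg(1,2)] \<Theta>[OF gg] by simp
    finally show "l2norm M (?D N \<gamma> \<gamma>') < e" .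
  qed
qed

text \<open>\<open>K n\<close> exceeds the infimum \<open>m\<close> by less than
  \<open>1 / (n + 1)\<close>, and the parallelogram law bounds the distance of two near-minimal
  kernels by their excesses. A translate of \<open>K n\<close> has the same norm and lies in the
  hull, so it is near-minimal as well: this is the asymptotic invariance.\<close>

lemma kernel_hull_minimising:
  obtains K where "\<And>n::nat. K n \<in> kernel_hull"
    "\<And>n k. hs_sq (\<lambda>x y. K n x y - K k x y) \<le> 2 / Suc n + 2 / Suc k"
    "\<And>n g. g \<in> carrier G \<Longrightarrow> hs_sq (\<lambda>x y. K n (act g x) (act g y) - K n x y) \<le> 4 / Suc n"
proof -
  define m where "m = Inf (hs_sq ` kernel_hull)"
  have bdd: "bdd_below (hs_sq ` kernel_hull)" by (auto intro!: bdd_belowI[of _ 0] hs_sq_nonneg)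
  have "(\<lambda>x y. \<Sum>i\<in>I. f i (act \<one> x) * f i (act \<one> y)) \<in> kernel_hull"
    by (rule kernel_hull.orbit) auto
  then have ne: "hs_sq ` kernel_hull \<noteq> {}" by auto
  have m_le: "m \<le> hs_sq K" if "K \<in> kernel_hull" for K
    unfolding m_def using that bdd by (intro cInf_lower) auto
  have "\<exists>K\<in>kernel_hull. hs_sq K < m + 1 / Suc n" for n
    using cInf_less_iff[OF ne bdd, of "m + 1 / Suc n"] by (auto simp: m_def)
  then obtain K where K: "\<And>n. K n \<in> kernel_hull" and Kn: "\<And>n. hs_sq (K n) < m + 1 / Suc n"
    by metis
  have diff: "hs_sq (\<lambda>x y. K x y - L x y) \<le> 2 * (hs_sq K - m) + 2 * (hs_sq L - m)"
    if "K \<in> kernel_hull" "L \<in> kernel_hull" for K L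
  proof -
    have "(\<lambda>x y. (K x y + L x y) / 2) \<in> kernel_hull" by (rule kernel_hull.mid[OF that]) simp
    from m_le[OF this] hs_sq_parallelogram[OF kernel_hull_bounded[OF that(1)] kernel_hull_bounded[OF that(2)], of "\<lambda>x y. (K x y + L x y) / 2"]
    show ?thesis by simp
  qed
  show ?thesis
  proof (rule that[of K])
    show "K n \<in> kernel_hull" for n by (rule K)
    show "hs_sq (\<lambda>x y. K n x y - K k x y) \<le> 2 / Suc n + 2 / Suc k" for n k
      using diff[OF K[of n] K[of k]] Kn[of n] Kn[of k] by simp
    show "hs_sq (\<lambda>x y. K n (act g x) (act g y) - K n x y) \<le> 4 / Suc n" if "g \<in> carrier G" for n g
      using diff[OF kernel_hull_act[OF K that] K[of n], of n] hs_sq_act[OF kernel_hull_bounded[OF K] that, of n] Kn[of n]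
      by simp
  qed
qed

theorem correlations_vanish:
  assumes J: "finite J" and h: "\<And>j. j \<in> J \<Longrightarrow> h j \<in> L2 M" and e: "e > 0"
  shows "\<exists>g\<in>carrier G. (\<Sum>j\<in>J. \<Sum>i\<in>I. (corr g i (h j))\<^sup>2) < e"
proof (rule ccontr)
  assume "\<not> ?thesis"
  then have ge: "e \<le> (\<Sum>j\<in>J. \<Sum>i\<in>I. (corr g i (h j))\<^sup>2)" if "g \<in> carrier G" for g
    using that by (auto simp: not_less)
  obtain K where K: "\<And>n::nat. K n \<in> kernel_hull"
    and cau: "\<And>n k. hs_sq (\<lambda>x y. K n x y - K k x y) \<le> 2 / Suc n + 2 / Suc k"
    and inv: "\<And>n g. g \<in> carrier G \<Longrightarrow> hs_sq (\<lambda>x y. K n (act g x) (act g y) - K n x y) \<le> 4 / Suc n"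
    using kernel_hull_minimising by blast
  note KB = kernel_hull_bounded[OF K]
  \<comment> \<open>The quadratic forms tend to 0 at each \<open>k\<close>, against the lower bound
    \<open>e\<close> that they inherit from the orbit.\<close>
  have "(\<lambda>n. \<integral>x. kop (K n) k x * k x \<partial>M) \<longlonglongrightarrow> 0" if k: "k \<in> L2 M" for k
  proof -
    note vL = kop_L2(1)[OF KB k]
    \<comment> \<open>The bound \<open>4 / Suc n\<close> serves twice: for the differences of
      kernels from index \<open>n\<close> on, and for the defect of invariance of
      \<open>K n\<close>.\<close>
    have small: "\<exists>N. \<forall>n\<ge>N. sqrt (4 / Suc n) * l2norm M k < d" if "d > 0" for d
    proof -
      have "(\<lambda>n. sqrt (4 / Suc n) * l2norm M k) \<longlonglongrightarrow> sqrt 0 * l2norm M k"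
        by (intro tendsto_intros) (rule LIMSEQ_Suc[OF lim_const_over_n, of 4])
      from order_tendstoD(2)[OF this, of d] that show ?thesis by (simp add: eventually_sequentially)
    qed
    have "\<exists>N. \<forall>m\<ge>N. \<forall>n\<ge>N. l2norm M (\<lambda>x. kop (K m) k x - kop (K n) k x) < d" if d: "d > 0" for d
    proof -
      obtain N where N: "sqrt (4 / Suc N) * l2norm M k < d" using small[OF d] by blast
      show ?thesis
      proof (intro exI[of _ N] allI impI)
        fix m n assume mn: "N \<le> m" "N \<le> n"
        have "2 / Suc m + 2 / Suc n \<le> 2 / Suc N + 2 / Suc N"
          using mn by (intro add_mono divide_left_mono) auto
        then have "sqrt (hs_sq (\<lambda>x y. K m x y - K n x y)) \<le> sqrt (4 / Suc N)"
          using cau[of m n] by (intro real_sqrt_le_mono) simp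
        then have "l2norm M (\<lambda>x. kop (K m) k x - kop (K n) k x) \<le> sqrt (4 / Suc N) * l2norm M k"
          using l2norm_kop_diff[OF KB KB k, of m n] mult_right_mono[OF _ l2norm_nonneg] order_trans
          by blast
        with N show "l2norm M (\<lambda>x. kop (K m) k x - kop (K n) k x) < d" by simp
      qed
    qed
    then obtain u where u: "u \<in> L2 M" and lim: "(\<lambda>n. l2norm M (\<lambda>x. kop (K n) k x - u x)) \<longlonglongrightarrow> 0"
      by (rule L2_complete[of "\<lambda>n. kop (K n) k", OF vL])
    have u_ap: "almost_periodic u"
    proof (rule almost_periodic_limit[OF u])
      fix d :: real assume d: "d > 0"
      then have d3: "d / 3 > 0" by simp
      obtain N1 where N1: "\<And>n. n \<ge> N1 \<Longrightarrow> l2norm M (\<lambda>x. kop (K n) k x - u x) < d"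
        using order_tendstoD(2)[OF lim d] unfolding eventually_sequentially by blast
      obtain N2 where N2: "\<And>n. n \<ge> N2 \<Longrightarrow> sqrt (4 / Suc n) * l2norm M k < d / 3"
        using small[OF d3] by blast
      define n where "n = max N1 N2"
      let ?v = "kop (K n) k" and ?k = "\<lambda>g y. k (act g y)"
      have nu: "l2norm M (\<lambda>x. ?v x - u x) < d" using N1 by (simp add: n_def)
      have sm: "sqrt (4 / Suc n) * l2norm M k < d / 3" using N2 by (simp add: n_def)
      \<comment> \<open>The operator of \<open>K n\<close> commutes with \<open>g\<close> up to
        \<open>d / 3\<close>. This error at \<open>g\<close> and at \<open>g'\<close>, together with
        a finite-rank colouring at scale \<open>d / 3\<close>, gives a colouring of
        \<open>?v\<close> at scale \<open>d\<close>.\<close>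
      have eqv: "l2norm M (\<lambda>x. ?v (act g x) - kop (K n) (?k g) x) < d / 3" if g: "g \<in> carrier G" for g
      proof -
        have "l2norm M (\<lambda>x. ?v (act g x) - kop (K n) (?k g) x)
            = l2norm M (\<lambda>x. kop (\<lambda>x y. K n (act g x) (act g y)) (?k g) x - kop (K n) (?k g) x)"
          by (rule l2norm_cong) (simp add: kop_act[OF KB k g])
        also have "\<dots> \<le> sqrt (hs_sq (\<lambda>x y. K n (act g x) (act g y) - K n x y)) * l2norm M (?k g)"
          by (rule l2norm_kop_diff[OF kernel_hull_bounded[OF kernel_hull_act[OF K g]] KB L2_act[OF g k]])
        also have "\<dots> \<le> sqrt (4 / Suc n) * l2norm M k"
          using inv[OF g, of n] l2norm_act[OF g L2_measurable[OF k]]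
          by (intro mult_mono real_sqrt_le_mono) auto
        finally show ?thesis using sm by simp
      qed
      obtain \<Phi> :: "'g \<Rightarrow> nat" where fin: "finite (\<Phi> ` carrier G)" and
        \<Phi>: "\<And>\<gamma> \<gamma>'. \<gamma> \<in> carrier G \<Longrightarrow> \<gamma>' \<in> carrier G \<Longrightarrow> \<Phi> \<gamma> = \<Phi> \<gamma>' \<Longrightarrow>
          l2norm M (\<lambda>x. kop (K n) (?k \<gamma>) x - kop (K n) (?k \<gamma>') x) < d / 3"
        using kernel_hull_coloured[OF K k d3, of n] by blast
      have "orbit_coloured ?v d"
      proof (rule orbit_colouredI[OF fin])
        fix g g' assume gg: "g \<in> carrier G" "g' \<in> carrier G" "\<Phi> g = \<Phi> g'"
        note L = L2_act[OF gg(1) vL] kop_L2(1)[OF KB L2_act[OF gg(1) k]]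
          kop_L2(1)[OF KB L2_act[OF gg(2) k]] L2_act[OF gg(2) vL]
        show "l2norm M (\<lambda>x. ?v (act g x) - ?v (act g' x)) < d"
          using l2norm_diff_triangle[OF L(1,2,4), of n n n] l2norm_diff_triangle[OF L(2,3,4), of n n n]
            eqv[OF gg(1)] eqv[OF gg(2)] \<Phi>[OF gg]
            l2norm_minus_commute[of M "kop (K n) (?k g')" "\<lambda>x. ?v (act g' x)"] by linarith
      qed
      with nu vL show "\<exists>v\<in>L2 M. l2norm M (\<lambda>x. v x - u x) < d \<and> orbit_coloured v d"
        by blast
    qed
    \<comment> \<open>The limit \<open>u\<close> is tested against itself: being almost periodic, it
      is orthogonal to every \<open>kop (K n) k\<close>, hence to its own limit value.\<close>
    have "(\<lambda>n. \<integral>x. kop (K n) k x * u x \<partial>M) \<longlonglongrightarrow> (\<integral>x. u x * u x \<partial>M)"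
      by (rule tendsto_integral_mult_L2[OF vL u u lim])
    then have "(\<integral>x. u x * u x \<partial>M) = 0"
      using kernel_hull_orth_almost_periodic[OF K k u_ap] LIMSEQ_unique[OF _ tendsto_const] by simp
    then have "l2norm M u = 0" by (simp add: l2norm_def power2_eq_square)
    then have "(\<integral>x. u x * k x \<partial>M) = 0"
      using Cauchy_Schwarz_integral[OF u k] by simp
    then show ?thesis using tendsto_integral_mult_L2[OF vL u k lim] by simp
  qed
  then have "(\<lambda>n. \<Sum>j\<in>J. \<integral>x. kop (K n) (h j) x * h j x \<partial>M) \<longlonglongrightarrow> (\<Sum>j\<in>J. 0)"
    by (intro tendsto_sum) (use h in blast)
  moreover have "e \<le> (\<Sum>j\<in>J. \<integral>x. kop (K n) (h j) x * h j x \<partial>M)" for n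
    by (rule kernel_hull_quadratic_ge[OF K J h ge])
  ultimately have "e \<le> (\<Sum>j\<in>J. 0)"
    by (intro LIMSEQ_le_const) auto
  with e show False by simp
qed

end


section \<open>Entropy of finite-valued maps\<close>

definition eta :: "real \<Rightarrow> real" where
  "eta t = - t * ln t"

section \<open>Continuity and size of \<open>eta\<close>\<close>

lemma eta_0 [simp]: "eta 0 = 0"
  by (simp add: eta_def)

lemma eta_nonneg: "0 \<le> t \<Longrightarrow> t \<le> 1 \<Longrightarrow> 0 \<le> eta t"
  by (cases "t = 0") (auto simp: eta_def mult_nonneg_nonpos)

lemma eta_borel_measurable [measurable]: "eta \<in> borel_measurable borel"
  unfolding eta_def[abs_def] by measurable

text \<open>\<open>ln s \<le> s - 1\<close> at \<open>s = 1 / sqrt t\<close>. The estimate settles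
  continuity of \<open>eta\<close> at 0 and bounds it on the unit interval.\<close>

lemma eta_le_sqrt:
  assumes "0 \<le> t" shows "eta t \<le> 2 * sqrt t"
proof (cases "t = 0")
  case False
  then have t: "0 < t" using assms by simp
  then have s: "0 < sqrt t" by simp
  have "ln (1 / sqrt t) \<le> 1 / sqrt t - 1"
    using s by (intro ln_le_minus_one) simp
  then have "- ln t / 2 \<le> 1 / sqrt t"
    using t by (simp add: ln_div ln_sqrt)
  then have "t * (- ln t) \<le> t * (2 / sqrt t)"
    using t by (intro mult_left_mono) (simp_all add: field_simps)
  also have "t * (2 / sqrt t) = 2 * sqrt t"
  proof -
    have "t * (2 / sqrt t) = 2 * (t / sqrt t)" by simp
    then show ?thesis using real_div_sqrt[OF assms] by simp
  qed
  finally show ?thesis by (simp add: eta_def)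
qed simp

lemma continuous_on_eta: "continuous_on {0..1} eta"
  unfolding continuous_on_eq_continuous_within
proof
  fix x :: real assume x: "x \<in> {0..1}"
  show "continuous (at x within {0..1}) eta"
  proof (cases "x = 0")
    case True
    have "(eta \<longlongrightarrow> 0) (at 0 within {0..1})"
    proof (rule tendsto_sandwich[of "\<lambda>_. 0" _ _ "\<lambda>t. 2 * sqrt t"])
      show "\<forall>\<^sub>F t in at 0 within {0..1}. 0 \<le> eta t"
        by (auto simp: eventually_at_filter eta_nonneg)
      show "\<forall>\<^sub>F t in at 0 within {0..1}. eta t \<le> 2 * sqrt t"
        by (auto simp: eventually_at_filter eta_le_sqrt)
      have "((\<lambda>t. 2 * sqrt t) \<longlongrightarrow> 2 * sqrt 0) (at 0 within {0..1})"
        by (intro tendsto_intros)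
      then show "((\<lambda>t. 2 * sqrt t) \<longlongrightarrow> 0) (at 0 within {0..1})" by simp
    qed simp
    then show ?thesis using True by (simp add: continuous_within)
  next
    case False
    then have "isCont eta x"
      unfolding eta_def[abs_def] using x by (intro continuous_intros) auto
    then show ?thesis by (rule continuous_at_imp_continuous_at_within)
  qed
qed

lemma eta_uniformly_continuous:
  assumes "e > 0"
  obtains d where "d > 0"
    "\<And>s t. 0 \<le> s \<Longrightarrow> s \<le> 1 \<Longrightarrow> 0 \<le> t \<Longrightarrow> t \<le> 1 \<Longrightarrow> \<bar>s - t\<bar> < d \<Longrightarrow> \<bar>eta s - eta t\<bar> < e"
proof -
  have "uniformly_continuous_on {0..1} eta"
    by (rule compact_uniformly_continuous[OF continuous_on_eta]) simp
  then obtain d where "d > 0" "\<forall>x\<in>{0..1}. \<forall>x'\<in>{0..1}. dist x' x < d \<longrightarrow> dist (eta x') (eta x) < e"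
    using assms unfolding uniformly_continuous_on_def by metis
  then show ?thesis by (intro that[of d]) (auto simp: dist_real_def)
qed

lemma simple_function_list:
  assumes "\<And>i. i \<in> set xs \<Longrightarrow> simple_function M (a i)"
  shows "simple_function M (\<lambda>x. map (\<lambda>i. a i x) xs)"
  using assms
proof (induction xs)
  case (Cons i xs)
  have "simple_function M (\<lambda>x. a i x # map (\<lambda>i. a i x) xs)"
    by (rule simple_function_compose2[where h = "(#)"]) (use Cons in auto)
  then show ?case by simp
qed simp

context prob_space
begin

text \<open>Partitions are represented by finite-valued maps: joins become pairs or lists, pullbacks
  become composition with \<open>act g\<close>, and coarser partitions become
  post-composition.\<close>

definition pr :: "('a \<Rightarrow> 'c) \<Rightarrow> 'c \<Rightarrow> real" where
  "pr X c = prob (X -` {c} \<inter> space M)"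

definition ent :: "('a \<Rightarrow> 'c) \<Rightarrow> real" where
  "ent X = (\<Sum>c\<in>X ` space M. eta (pr X c))"

text \<open>The conditional Shannon entropy of \<open>X\<close> given \<open>Y\<close>, defined
  through the chain rule.\<close>

definition cent :: "('a \<Rightarrow> 'c) \<Rightarrow> ('a \<Rightarrow> 'd) \<Rightarrow> real" where
  "cent X Y = ent (\<lambda>x. (X x, Y x)) - ent Y"

lemma pr_nonneg: "0 \<le> pr X c" and pr_le_1: "pr X c \<le> 1"
  by (simp_all add: pr_def)

lemma pr_eq_0: "c \<notin> X ` space M \<Longrightarrow> pr X c = 0"
proof -
  assume "c \<notin> X ` space M"
  then have "X -` {c} \<inter> space M = {}" by auto
  then show ?thesis by (simp add: pr_def)
qed

lemma ent_superset:
  assumes "finite S" "X ` space M \<subseteq> S"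
  shows "ent X = (\<Sum>c\<in>S. eta (pr X c))"
  unfolding ent_def by (rule sum.mono_neutral_left) (use assms in \<open>auto simp: pr_eq_0\<close>)

lemma sum_pr:
  assumes X: "simple_function M X"
  shows "(\<Sum>c\<in>{c \<in> X ` space M. P c}. pr X c) = prob {x \<in> space M. P (X x)}"
proof -
  let ?T = "{c \<in> X ` space M. P c}"
  have "{x \<in> space M. P (X x)} = (\<Union>c\<in>?T. X -` {c} \<inter> space M)" by auto
  also have "prob \<dots> = (\<Sum>c\<in>?T. prob (X -` {c} \<inter> space M))"
    by (rule finite_measure_finite_Union)
      (use simple_functionD[OF X] in \<open>auto simp: disjoint_family_on_def\<close>)
  finally show ?thesis by (simp add: pr_def)
qed

lemma sum_pr_all: "simple_function M X \<Longrightarrow> (\<Sum>c\<in>X ` space M. pr X c) = 1"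
  using sum_pr[of X "\<lambda>_. True"] by (simp add: prob_space)

lemma pr_compose:
  assumes X: "simple_function M X"
  shows "pr (\<lambda>x. f (X x)) v = (\<Sum>c\<in>{c \<in> X ` space M. f c = v}. pr X c)"
proof -
  have "(\<lambda>x. f (X x)) -` {v} \<inter> space M = {x \<in> space M. f (X x) = v}" by auto
  then show ?thesis using sum_pr[OF X, of "\<lambda>c. f c = v"] by (simp add: pr_def)
qed

lemma pr_le_compose:
  assumes X: "simple_function M X"
  shows "pr X c \<le> pr (\<lambda>x. f (X x)) (f c)"
proof -
  have "simple_function M (\<lambda>x. f (X x))"
    using simple_function_compose1[OF X] .
  then show ?thesis unfolding pr_def
    by (intro finite_measure_mono) (auto dest: simple_functionD(2))
qed

lemma sum_pr_compose:
  assumes X: "simple_function M X"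
  shows "(\<Sum>c\<in>X ` space M. pr X c * F (f c)) = (\<Sum>v\<in>(\<lambda>x. f (X x)) ` space M. pr (\<lambda>x. f (X x)) v * F v)"
proof -
  have "(\<Sum>c\<in>X ` space M. pr X c * F (f c))
      = (\<Sum>v\<in>f ` (X ` space M). \<Sum>c\<in>{c \<in> X ` space M. f c = v}. pr X c * F (f c))"
    by (rule sum.image_gen[OF simple_functionD(1)[OF X]])
  also have "\<dots> = (\<Sum>v\<in>f ` (X ` space M). pr (\<lambda>x. f (X x)) v * F v)"
    by (intro sum.cong refl) (simp add: pr_compose[OF X] sum_distrib_right)
  finally show ?thesis by (simp add: image_image)
qed

text \<open>Expresses the entropy of a coarser map as a sum over the values of the finer one, so
  that entropies of several marginals can be compared term by term.\<close>

lemma ent_compose_eq: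
  assumes X: "simple_function M X"
  shows "ent (\<lambda>x. f (X x)) = - (\<Sum>c\<in>X ` space M. pr X c * ln (pr (\<lambda>x. f (X x)) (f c)))"
  unfolding sum_pr_compose[OF X, of "\<lambda>v. ln (pr (\<lambda>x. f (X x)) v)" f]
  by (simp add: ent_def eta_def sum_negf)

text \<open>Fibres grow under post-composition and \<open>- ln\<close> decreases. The lemma also
  serves to regroup tuples and to split or append list entries.\<close>

lemma ent_compose_le:
  assumes X: "simple_function M X"
  shows "ent (\<lambda>x. f (X x)) \<le> ent X"
proof -
  have "(\<Sum>c\<in>X ` space M. pr X c * ln (pr X c))
      \<le> (\<Sum>c\<in>X ` space M. pr X c * ln (pr (\<lambda>x. f (X x)) (f c)))"
  proof (rule sum_mono)
    fix c
    show "pr X c * ln (pr X c) \<le> pr X c * ln (pr (\<lambda>x. f (X x)) (f c))"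
    proof (cases "pr X c = 0")
      case False
      then have "0 < pr X c" using pr_nonneg[of X c] by simp
      then show ?thesis using pr_le_compose[OF X, of c f] by (intro mult_left_mono) auto
    qed simp
  qed
  then show ?thesis unfolding ent_compose_eq[OF X] by (simp add: ent_def eta_def sum_negf)
qed

text \<open>Gibbs' inequality: the joint distribution \<open>?p\<close> is compared with
  \<open>?r\<close>, the one that makes \<open>X\<close> and \<open>Z\<close> conditionally
  independent given \<open>Y\<close>. Since \<open>?r\<close> has total mass at most 1,
  \<open>ln t \<le> t - 1\<close> gives the claim.\<close>

lemma ent_submodular:
  assumes X: "simple_function M X" and Y: "simple_function M Y" and Z: "simple_function M Z"
  shows "ent (\<lambda>x. (X x, Y x, Z x)) + ent Y \<le> ent (\<lambda>x. (X x, Y x)) + ent (\<lambda>x. (Y x, Z x))"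
proof -
  define W where "W = (\<lambda>x. (X x, Y x, Z x))"
  define XY where "XY = (\<lambda>x. (X x, Y x))"
  define YZ where "YZ = (\<lambda>x. (Y x, Z x))"
  have sf: "simple_function M W" "simple_function M XY" "simple_function M YZ"
    unfolding W_def XY_def YZ_def by (intro simple_function_Pair X Y Z)+
  let ?S = "W ` space M" and ?p = "pr W"
  let ?xy = "\<lambda>w. pr XY (fst w, fst (snd w))" and ?yz = "\<lambda>w. pr YZ (snd w)" and ?y = "\<lambda>w. pr Y (fst (snd w))"
  let ?r = "\<lambda>w. ?xy w * ?yz w / ?y w"
  have E: "ent W = - (\<Sum>w\<in>?S. ?p w * ln (?p w))"
    "ent XY = - (\<Sum>w\<in>?S. ?p w * ln (?xy w))"
    "ent YZ = - (\<Sum>w\<in>?S. ?p w * ln (?yz w))"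
    "ent Y = - (\<Sum>w\<in>?S. ?p w * ln (?y w))"
    using ent_compose_eq[OF sf(1), of "\<lambda>w. w"] ent_compose_eq[OF sf(1), of "\<lambda>w. (fst w, fst (snd w))"]
      ent_compose_eq[OF sf(1), of snd] ent_compose_eq[OF sf(1), of "\<lambda>w. fst (snd w)"]
    by (simp_all add: W_def XY_def YZ_def)
  have pointwise: "?p w - ?r w \<le> ?p w * ln (?p w) + ?p w * ln (?y w) - ?p w * ln (?xy w) - ?p w * ln (?yz w)" for w
  proof (cases "?p w = 0")
    case True
    then show ?thesis by (simp add: pr_nonneg)
  next
    case False
    then have p: "0 < ?p w" using pr_nonneg[of W w] by simp
    have pos: "0 < ?xy w" "0 < ?yz w" "0 < ?y w"
      using p pr_le_compose[OF sf(1), of w "\<lambda>w. (fst w, fst (snd w))"] pr_le_compose[OF sf(1), of w snd]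
        pr_le_compose[OF sf(1), of w "\<lambda>w. fst (snd w)"]
      by (auto simp: W_def XY_def YZ_def)
    have "ln (?r w / ?p w) \<le> ?r w / ?p w - 1"
      using pos p by (intro ln_le_minus_one) simp
    then have "?p w * ln (?r w / ?p w) \<le> ?p w * (?r w / ?p w - 1)"
      using p by (intro mult_left_mono) auto
    also have "\<dots> = ?r w - ?p w" using p by (simp add: right_diff_distrib)
    also have "ln (?r w / ?p w) = ln (?xy w) + ln (?yz w) - ln (?y w) - ln (?p w)"
      using pos p by (simp add: ln_div ln_mult)
    finally show ?thesis by (simp add: algebra_simps)
  qed
  let ?X = "X ` space M" and ?Y = "Y ` space M" and ?Z = "Z ` space M"
  have fin: "finite ?X" "finite ?Y" "finite ?Z" using X Y Z by (auto dest: simple_functionD)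
  have mx: "(\<Sum>x\<in>?X. pr XY (x, y)) = pr Y y" for y
  proof -
    have "pr Y y = (\<Sum>c\<in>{c \<in> XY ` space M. snd c = y}. pr XY c)"
      using pr_compose[OF sf(2), of snd] by (simp add: XY_def)
    also have "\<dots> = (\<Sum>c\<in>(\<lambda>x. (x, y)) ` ?X. pr XY c)"
      by (rule sum.mono_neutral_left) (use fin in \<open>auto simp: XY_def intro!: pr_eq_0\<close>)
    finally show ?thesis by (simp add: sum.reindex inj_on_def)
  qed
  have mz: "(\<Sum>z\<in>?Z. pr YZ (y, z)) = pr Y y" for y
  proof -
    have "pr Y y = (\<Sum>c\<in>{c \<in> YZ ` space M. fst c = y}. pr YZ c)"
      using pr_compose[OF sf(3), of fst] by (simp add: YZ_def)
    also have "\<dots> = (\<Sum>c\<in>(\<lambda>z. (y, z)) ` ?Z. pr YZ c)"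
      by (rule sum.mono_neutral_left) (use fin in \<open>auto simp: YZ_def intro!: pr_eq_0\<close>)
    finally show ?thesis by (simp add: sum.reindex inj_on_def)
  qed
  have "(\<Sum>w\<in>?S. ?r w) \<le> (\<Sum>w\<in>?X \<times> ?Y \<times> ?Z. ?r w)"
    by (rule sum_mono2) (use fin in \<open>auto simp: W_def pr_nonneg\<close>)
  also have "\<dots> = (\<Sum>x\<in>?X. \<Sum>y\<in>?Y. \<Sum>z\<in>?Z. pr XY (x, y) * pr YZ (y, z) / pr Y y)"
    by (simp add: sum.cartesian_product')
  also have "\<dots> = (\<Sum>x\<in>?X. \<Sum>y\<in>?Y. pr XY (x, y) * pr Y y / pr Y y)"
    by (simp add: mz flip: sum_divide_distrib sum_distrib_left)
  also have "\<dots> = (\<Sum>y\<in>?Y. \<Sum>x\<in>?X. pr XY (x, y) * pr Y y / pr Y y)"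
    by (rule sum.swap)
  also have "\<dots> = (\<Sum>y\<in>?Y. pr Y y)"
  proof (rule sum.cong[OF refl])
    fix y
    show "(\<Sum>x\<in>?X. pr XY (x, y) * pr Y y / pr Y y) = pr Y y"
      \<comment> \<open>Values \<open>y\<close> of probability 0 may occur; then the quotient is 0
        and both sides vanish.\<close>
      by (cases "pr Y y = 0") (simp_all add: mx)
  qed
  also have "\<dots> = 1" by (rule sum_pr_all[OF Y])
  finally have "0 \<le> (\<Sum>w\<in>?S. ?p w - ?r w)"
    using sum_pr_all[OF sf(1)] by (simp add: sum_subtractf)
  also have "\<dots> \<le> (\<Sum>w\<in>?S. ?p w * ln (?p w) + ?p w * ln (?y w) - ?p w * ln (?xy w) - ?p w * ln (?yz w))"
    by (rule sum_mono[OF pointwise])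
  finally have "ent W + ent Y \<le> ent XY + ent YZ"
    unfolding E by (simp add: sum_subtractf sum.distrib)
  then show ?thesis by (simp add: W_def XY_def YZ_def)
qed

lemma ent_list_le:
  fixes a :: "nat \<Rightarrow> 'a \<Rightarrow> 'c" and b :: "nat \<Rightarrow> 'a \<Rightarrow> 'd"
  assumes a: "\<And>i. simple_function M (a i)" and b: "\<And>i. simple_function M (b i)"
  shows "ent (\<lambda>x. map (\<lambda>i. a i x) [1..<Suc n])
    \<le> ent (\<lambda>x. map (\<lambda>i. b i x) [1..<Suc n]) + (\<Sum>i=1..n. cent (a i) (b i))"
proof -
  let ?A = "\<lambda>n x. map (\<lambda>i. a i x) [1..<Suc n]" and ?B = "\<lambda>n x. map (\<lambda>i. b i x) [1..<Suc n]"
  have A: "simple_function M (?A n)" and B: "simple_function M (?B n)" for n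
    by (intro simple_function_list a b)+
  \<comment> \<open>The induction is run for the joint entropy of both lists, so that each new
    \<open>a i\<close> can be conditioned on \<open>b i\<close> present in the list.\<close>
  have "ent (\<lambda>x. (?A n x, ?B n x)) \<le> ent (?B n) + (\<Sum>i=1..n. cent (a i) (b i))"
  proof (induction n)
    case 0
    show ?case using ent_compose_le[OF B[of 0], of "\<lambda>l. ([], l)"] by simp
  next
    case (Suc n)
    note AB = simple_function_Pair[OF A[of n] B[of n]]
    let ?a = "a (Suc n)" and ?b = "b (Suc n)"
    have "ent (\<lambda>x. (?A (Suc n) x, ?B (Suc n) x)) \<le> ent (\<lambda>x. ((?A n x, ?B n x), ?b x, ?a x))"
      using ent_compose_le[OF simple_function_Pair[OF AB simple_function_Pair[OF b[of "Suc n"] a[of "Suc n"]]],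
          of "\<lambda>((l, m), y, x). (l @ [x], m @ [y])"]
      by simp
    \<comment> \<open>Submodularity with \<open>?b\<close> in the middle: given everything before,
      \<open>?a\<close> costs at most its conditional entropy given \<open>?b\<close>.\<close>
    also have "\<dots> \<le> ent (\<lambda>x. ((?A n x, ?B n x), ?b x)) + ent (\<lambda>x. (?b x, ?a x)) - ent ?b"
      using ent_submodular[OF AB b[of "Suc n"] a[of "Suc n"]] by simp
    also have "ent (\<lambda>x. ((?A n x, ?B n x), ?b x)) \<le> ent (\<lambda>x. (?A n x, ?B n x, ?b x))"
      using ent_compose_le[OF simple_function_Pair[OF A[of n] simple_function_Pair[OF B[of n] b[of "Suc n"]]],
          of "\<lambda>(l, m, y). ((l, m), y)"] by simp
    \<comment> \<open>Submodularity with \<open>?B n\<close> in the middle, so that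
      \<open>- ent (?B n)\<close> cancels against the induction hypothesis.\<close>
    also have "\<dots> \<le> ent (\<lambda>x. (?A n x, ?B n x)) + ent (\<lambda>x. (?B n x, ?b x)) - ent (?B n)"
      using ent_submodular[OF A[of n] B[of n] b[of "Suc n"]] by simp
    also have "ent (\<lambda>x. (?B n x, ?b x)) \<le> ent (?B (Suc n))"
      using ent_compose_le[OF B[of "Suc n"], of "\<lambda>l. (butlast l, last l)"] by simp
    also have "ent (\<lambda>x. (?b x, ?a x)) \<le> ent (\<lambda>x. (?a x, ?b x))"
      using ent_compose_le[OF simple_function_Pair[OF a[of "Suc n"] b[of "Suc n"]], of prod.swap] by simp
    also note Suc.IH
    finally show ?case by (simp add: cent_def)
  qed
  moreover have "ent (?A n) \<le> ent (\<lambda>x. (?A n x, ?B n x))"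
    using ent_compose_le[OF simple_function_Pair[OF A B], of fst n n] by simp
  ultimately show ?thesis by simp
qed

lemma pr_diff_le:
  assumes X: "simple_function M X" and Y: "simple_function M Y"
  shows "\<bar>pr X c - pr Y c\<bar> \<le> prob {x \<in> space M. X x \<noteq> Y x}"
proof -
  have D: "{x \<in> space M. X x \<noteq> Y x} \<in> sets M"
  proof -
    have "simple_function M (\<lambda>x. (X x, Y x))" by (rule simple_function_Pair[OF X Y])
    from simple_functionD(2)[OF this, of "{p. fst p \<noteq> snd p}"] show ?thesis
      by (simp add: vimage_def Int_def conj_commute)
  qed
  have le: "pr X c \<le> pr Y c + prob {x \<in> space M. X x \<noteq> Y x}"
    if "simple_function M X" "simple_function M Y" "{x \<in> space M. X x \<noteq> Y x} \<in> sets M" for X Y :: "'a \<Rightarrow> 'b"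
  proof -
    have "prob (X -` {c} \<inter> space M) \<le> prob ((Y -` {c} \<inter> space M) \<union> {x \<in> space M. X x \<noteq> Y x})"
      using that simple_functionD(2)[OF that(2)] by (intro finite_measure_mono) auto
    also have "\<dots> \<le> prob (Y -` {c} \<inter> space M) + prob {x \<in> space M. X x \<noteq> Y x}"
      using that simple_functionD(2)[OF that(2)] by (intro measure_Un_le) auto
    finally show ?thesis by (simp add: pr_def)
  qed
  have "{x \<in> space M. Y x \<noteq> X x} = {x \<in> space M. X x \<noteq> Y x}" by auto
  then show ?thesis using le[OF X Y D] le[OF Y X] D by auto
qed

lemma ent_close:
  assumes X: "simple_function M X" "X ` space M \<subseteq> S" and Y: "simple_function M Y" "Y ` space M \<subseteq> S"
    and S: "finite S"
    and d: "\<And>s t. 0 \<le> s \<Longrightarrow> s \<le> 1 \<Longrightarrow> 0 \<le> t \<Longrightarrow> t \<le> 1 \<Longrightarrow> \<bar>s - t\<bar> < d \<Longrightarrow> \<bar>eta s - eta t\<bar> < e"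
    and close: "prob {x \<in> space M. X x \<noteq> Y x} < d"
  shows "\<bar>ent X - ent Y\<bar> \<le> real (card S) * e"
proof -
  have "\<bar>ent X - ent Y\<bar> = \<bar>\<Sum>c\<in>S. eta (pr X c) - eta (pr Y c)\<bar>"
    by (simp add: ent_superset[OF S X(2)] ent_superset[OF S Y(2)] sum_subtractf)
  also have "\<dots> \<le> (\<Sum>c\<in>S. e)"
  proof (rule order_trans[OF sum_abs], rule sum_mono)
    fix c
    have "\<bar>eta (pr X c) - eta (pr Y c)\<bar> < e"
      by (rule d) (use pr_diff_le[OF X(1) Y(1), of c] close in \<open>auto simp: pr_nonneg pr_le_1\<close>)
    then show "\<bar>eta (pr X c) - eta (pr Y c)\<bar> \<le> e" by simp
  qed
  finally show ?thesis by simp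
qed

text \<open>\<open>d\<close> depends only on the value sets and on \<open>e\<close>; this uniformity
  lets one \<open>d\<close> serve all translates of a partition.\<close>

lemma cent_close:
  assumes S: "finite S" and T: "finite T" and e: "e > 0"
  obtains d where "d > 0" "\<And>X Y Y'. simple_function M X \<Longrightarrow> simple_function M Y \<Longrightarrow> simple_function M Y' \<Longrightarrow>
      X ` space M \<subseteq> S \<Longrightarrow> Y ` space M \<subseteq> T \<Longrightarrow> Y' ` space M \<subseteq> T \<Longrightarrow>
      prob {x \<in> space M. Y x \<noteq> Y' x} < d \<Longrightarrow> cent X Y \<le> cent X Y' + e"
proof -
  \<comment> \<open>The number of \<open>eta\<close> terms in the two entropies that make up
    \<open>cent\<close>, plus 1 for positivity.\<close>
  define k where "k = real (card (S \<times> T)) + real (card T) + 1"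
  have k: "k > 0" by (simp add: k_def add_nonneg_pos)
  then obtain d where d: "d > 0" and
    dd: "\<And>s t. 0 \<le> s \<Longrightarrow> s \<le> 1 \<Longrightarrow> 0 \<le> t \<Longrightarrow> t \<le> 1 \<Longrightarrow> \<bar>s - t\<bar> < d \<Longrightarrow> \<bar>eta s - eta t\<bar> < e / k"
    using eta_uniformly_continuous[of "e / k"] e by (metis divide_pos_pos)
  show ?thesis
  proof (rule that[OF d])
    fix X Y Y'
    assume sf: "simple_function M X" "simple_function M Y" "simple_function M Y'"
      and im: "X ` space M \<subseteq> S" "Y ` space M \<subseteq> T" "Y' ` space M \<subseteq> T"
      and close: "prob {x \<in> space M. Y x \<noteq> Y' x} < d"
    have "\<bar>ent Y - ent Y'\<bar> \<le> real (card T) * (e / k)"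
      by (rule ent_close[OF sf(2) im(2) sf(3) im(3) T dd close])
    moreover have "\<bar>ent (\<lambda>x. (X x, Y x)) - ent (\<lambda>x. (X x, Y' x))\<bar> \<le> real (card (S \<times> T)) * (e / k)"
      by (rule ent_close[OF simple_function_Pair[OF sf(1,2)] _ simple_function_Pair[OF sf(1,3)] _ _ dd])
        (use S T im close in auto)
    ultimately have "cent X Y \<le> cent X Y' + (real (card (S \<times> T)) + real (card T)) * (e / k)"
      unfolding cent_def by (simp only: distrib_right)
    also have "(real (card (S \<times> T)) + real (card T)) * (e / k) \<le> k * (e / k)"
      using e k by (intro mult_right_mono) (auto simp: k_def)
    also have "k * (e / k) = e" using k by simp
    finally show "cent X Y \<le> cent X Y' + e" by simp
  qed
qed

section \<open>Jensen's inequality on a cell and its approximate converse\<close>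

lemma integrable_real_bounded:
  fixes u :: "'a \<Rightarrow> real"
  assumes "u \<in> borel_measurable M" "\<And>x. x \<in> space M \<Longrightarrow> \<bar>u x\<bar> \<le> c"
  shows "integrable M u"
  by (rule integrable_const_bound[where B = c]) (use assms in auto)

lemma abs_eta_le_2: "0 \<le> t \<Longrightarrow> t \<le> 1 \<Longrightarrow> \<bar>eta t\<bar> \<le> 2"
  using eta_le_sqrt[of t] eta_nonneg[of t] real_sqrt_le_1_iff[of t] by linarith

text \<open>For \<open>C\<close> of positive measure the right-hand side is
  \<open>prob C * eta (q / prob C)\<close>, written so that summing over the cells of \<alpha>
  yields an entropy difference directly. The proof integrates a tangent line of the concave function
  \<open>eta\<close>.\<close>

lemma eta_Jensen:
  assumes u[measurable]: "u \<in> borel_measurable M" and u01: "\<And>x. x \<in> space M \<Longrightarrow> 0 \<le> u x \<and> u x \<le> 1"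
    and C[measurable]: "C \<in> sets M" and q: "q = (\<integral>x. u x * indicator C x \<partial>M)"
  shows "(\<integral>x. eta (u x) * indicator C x \<partial>M) \<le> eta q + q * ln (prob C)"
proof -
  have iC: "integrable M (indicator C :: 'a \<Rightarrow> real)"
    by (rule integrable_real_bounded[where c = 1]) (auto simp: indicator_def)
  have iu: "integrable M (\<lambda>x. u x * indicator C x)"
    by (rule integrable_real_bounded[where c = 1]) (use u01 in \<open>auto simp: indicator_def\<close>)
  have ie: "integrable M (\<lambda>x. eta (u x) * indicator C x)"
    by (rule integrable_real_bounded[where c = 2]) (use u01 abs_eta_le_2 in \<open>auto simp: indicator_def\<close>)
  have q0: "0 \<le> q" unfolding q using u01 by (intro integral_nonneg_AE AE_I2) auto
  show ?thesis
  proof (cases "q = 0")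
    case True
    then have "AE x in M. u x * indicator C x = 0"
      using integral_nonneg_eq_0_iff_AE[OF iu] u01 q by (auto intro!: AE_I2)
    then have "AE x in M. eta (u x) * indicator C x = 0"
      by eventually_elim (auto simp: indicator_def)
    then show ?thesis using True by (simp add: integral_eq_zero_AE)
  next
    case False
    then have q1: "0 < q" using q0 by simp
    have "q \<le> (\<integral>x. indicator C x \<partial>M)"
      unfolding q by (rule integral_mono[OF iu]) (use u01 iC in \<open>auto split: split_indicator\<close>)
    then have m: "0 < prob C" using q1 C by simp
    define t where "t = q / prob C"
    have t: "0 < t" using q1 m by (simp add: t_def)
    \<comment> \<open>The tangent line at \<open>t\<close>, the mean of \<open>u\<close> over
      \<open>C\<close>; its slope is \<open>- ln t - 1\<close>.\<close>
    have pt: "eta v \<le> - v * ln t - v + t" if "0 \<le> v" for v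
    proof (cases "v = 0")
      case False
      then have v: "0 < v" using that by simp
      have "v * ln (t / v) \<le> v * (t / v - 1)"
        using v t by (intro mult_left_mono ln_le_minus_one) auto
      then show ?thesis using v t by (simp add: eta_def ln_div algebra_simps)
    qed (use t in simp)
    have "(\<integral>x. eta (u x) * indicator C x \<partial>M)
        \<le> (\<integral>x. (- ln t - 1) * (u x * indicator C x) + t * indicator C x \<partial>M)"
    proof (rule integral_mono[OF ie])
      fix x assume "x \<in> space M"
      then show "eta (u x) * indicator C x \<le> (- ln t - 1) * (u x * indicator C x) + t * indicator C x"
        using pt[of "u x"] u01[of x] by (auto simp: algebra_simps split: split_indicator)
    qed (use iu iC in simp)
    also have "\<dots> = (- ln t - 1) * q + t * prob C"
      using iu iC C by (simp add: q)
    also have "\<dots> = - q * ln t" using m by (simp add: t_def algebra_simps)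
    also have "\<dots> = eta q + q * ln (prob C)"
      using q1 m by (simp add: t_def ln_div eta_def algebra_simps)
    finally show ?thesis .
  qed
qed

text \<open>The converse of Jensen's inequality up to \<open>e\<close>, when \<open>u\<close> oscillates less than \<open>d\<close> on \<open>C\<close>.\<close>
lemma eta_oscillation:
  assumes u[measurable]: "u \<in> borel_measurable M" and u01: "\<And>x. x \<in> space M \<Longrightarrow> 0 \<le> u x \<and> u x \<le> 1"
    and C[measurable]: "C \<in> sets M" and q: "q = (\<integral>x. u x * indicator C x \<partial>M)"
    and d: "\<And>s t. 0 \<le> s \<Longrightarrow> s \<le> 1 \<Longrightarrow> 0 \<le> t \<Longrightarrow> t \<le> 1 \<Longrightarrow> \<bar>s - t\<bar> < d \<Longrightarrow> \<bar>eta s - eta t\<bar> < e"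
    and osc: "\<And>x y. x \<in> C \<Longrightarrow> y \<in> C \<Longrightarrow> \<bar>u x - u y\<bar> \<le> d'" and d': "d' < d"
  shows "eta q + q * ln (prob C) \<le> (\<integral>x. eta (u x) * indicator C x \<partial>M) + e * prob C"
proof -
  have iC: "integrable M (indicator C :: 'a \<Rightarrow> real)"
    by (rule integrable_real_bounded[where c = 1]) (auto simp: indicator_def)
  have iu: "integrable M (\<lambda>x. u x * indicator C x)"
    by (rule integrable_real_bounded[where c = 1]) (use u01 in \<open>auto simp: indicator_def\<close>)
  have ie: "integrable M (\<lambda>x. eta (u x) * indicator C x)"
    by (rule integrable_real_bounded[where c = 2]) (use u01 abs_eta_le_2 in \<open>auto simp: indicator_def\<close>)
  have q0: "0 \<le> q" unfolding q using u01 by (intro integral_nonneg_AE AE_I2) auto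
  have "q \<le> (\<integral>x. indicator C x \<partial>M)"
    unfolding q by (rule integral_mono[OF iu]) (use u01 iC in \<open>auto split: split_indicator\<close>)
  then have qm: "q \<le> prob C" using C by simp
  show ?thesis
  proof (cases "prob C = 0")
    case True
    have "0 \<le> (\<integral>x. eta (u x) * indicator C x \<partial>M)"
      using u01 by (intro integral_nonneg_AE AE_I2) (auto simp: eta_nonneg)
    then show ?thesis using True qm q0 by simp
  next
    case False
    then have m: "0 < prob C" using measure_nonneg[of M C] by linarith
    define t where "t = q / prob C"
    have t01: "0 \<le> t" "t \<le> 1" using q0 qm m by (auto simp: t_def)
    have tm: "t * prob C = q" using m by (simp add: t_def)
    have eq: "eta q + q * ln (prob C) = eta t * prob C"
    proof (cases "q = 0")
      case False
      then have "0 < q" using q0 by simp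
      then show ?thesis using m by (simp add: t_def ln_div eta_def algebra_simps)
    qed (simp add: t_def)
    \<comment> \<open>Integrating the oscillation bound over \<open>C\<close>: the mean of
      \<open>u\<close> differs from each of its values on \<open>C\<close> by at most
      \<open>d'\<close>.\<close>
    have close: "\<bar>t - u x\<bar> \<le> d'" if x: "x \<in> C" for x
    proof -
      have "(u x - d') * prob C = (\<integral>y. (u x - d') * indicator C y \<partial>M)" using C by simp
      also have "\<dots> \<le> q" unfolding q
        by (rule integral_mono[OF _ iu]) (use osc[OF x] iC in \<open>auto simp: abs_le_iff algebra_simps split: split_indicator\<close>)
      finally have 1: "(u x - d') * prob C \<le> t * prob C" unfolding tm .
      have "q \<le> (\<integral>y. (u x + d') * indicator C y \<partial>M)" unfolding q
        by (rule integral_mono[OF iu]) (use osc[OF x] iC in \<open>auto simp: abs_le_iff algebra_simps split: split_indicator\<close>)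
      also have "\<dots> = (u x + d') * prob C" using C by simp
      finally have 2: "t * prob C \<le> (u x + d') * prob C" unfolding tm .
      show ?thesis using mult_right_le_imp_le[OF 1 m] mult_right_le_imp_le[OF 2 m] by linarith
    qed
    have "eta t * prob C = (\<integral>x. eta t * indicator C x \<partial>M)" using C by simp
    also have "\<dots> \<le> (\<integral>x. eta (u x) * indicator C x + e * indicator C x \<partial>M)"
    proof (rule integral_mono)
      show "integrable M (\<lambda>x. eta (u x) * indicator C x + e * indicator C x)"
        using ie iC C by simp
      fix x assume x: "x \<in> space M"
      show "eta t * indicator C x \<le> eta (u x) * indicator C x + e * indicator C x"
        using d[OF t01, of "u x"] u01[OF x] close[of x] d' by (auto simp: indicator_def)
    qed (use C iC in simp)
    also have "\<dots> = (\<integral>x. eta (u x) * indicator C x \<partial>M) + e * prob C"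
      using ie iC C by simp
    finally show ?thesis unfolding eq .
  qed
qed

end


section \<open>Conditional entropy given the Kronecker algebra\<close>

context pmp_action
begin

lemma simple_function_act:
  assumes X: "simple_function M X" and g: "g \<in> carrier G"
  shows "simple_function M (\<lambda>x. X (act g x))"
  using simple_function_comp[OF act_measurable[OF g] X] .

lemma pr_act:
  assumes X: "simple_function M X" and g: "g \<in> carrier G"
  shows "pr (\<lambda>x. X (act g x)) c = pr X c"
proof -
  have "(\<lambda>x. X (act g x)) -` {c} \<inter> space M = act g -` (X -` {c} \<inter> space M) \<inter> space M"
    using act_space[OF g] by auto
  then show ?thesis
    using measure_act[OF g simple_functionD(2)[OF X, of "{c}"]] by (simp add: pr_def)
qed

lemma ent_act:
  assumes X: "simple_function M X" and g: "g \<in> carrier G"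
  shows "ent (\<lambda>x. X (act g x)) = ent X"
proof -
  have "(\<lambda>x. X (act g x)) ` space M \<subseteq> X ` space M" using act_space[OF g] by auto
  from ent_superset[OF simple_functionD(1)[OF X] this]
  show ?thesis by (simp add: pr_act[OF X g]) (simp add: ent_def)
qed

lemma cent_act:
  assumes X: "simple_function M X" and Y: "simple_function M Y" and g: "g \<in> carrier G"
  shows "cent (\<lambda>x. X (act g x)) (\<lambda>x. Y (act g x)) = cent X Y"
  using ent_act[OF simple_function_Pair[OF X Y] g] ent_act[OF Y g] by (simp add: cent_def)

lemma simple_function_kronecker:
  "simple_function \<K> b \<Longrightarrow> simple_function M b"
  using subalgebra_kronecker by (auto simp: simple_function_def subalgebra_def)

text \<open>The level sets of \<open>b\<close> are Kronecker sets, and the squared L2-distance of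
  two translated indicators is the measure of the set where they differ. Colouring all level sets
  simultaneously controls where the translates of \<open>b\<close> disagree.\<close>

lemma kronecker_simple_coloured:
  assumes b: "simple_function \<K> b" and d: "d > 0"
  obtains \<Phi> :: "'g \<Rightarrow> nat" where "finite (\<Phi> ` carrier G)"
    "\<And>g h. g \<in> carrier G \<Longrightarrow> h \<in> carrier G \<Longrightarrow> \<Phi> g = \<Phi> h \<Longrightarrow>
      prob {x \<in> space M. b (act g x) \<noteq> b (act h x)} < d"
proof -
  let ?T = "b ` space M"
  note bM = simple_function_kronecker[OF b]
  define D where "D c = b -` {c} \<inter> space M" for c
  have T: "finite ?T" using simple_functionD(1)[OF bM] .
  have D_sets: "D c \<in> sets M" for c unfolding D_def using simple_functionD(2)[OF bM] .
  have "almost_periodic (indicator (D c))" for c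
    using simple_functionD(2)[OF b, of "{c}"] by (simp add: D_def sets_kronecker space_kronecker kronecker_sets_iff)
  \<comment> \<open>Each level set contributes at most \<open>e\<^sup>2\<close>, and
    \<open>card ?T * e\<^sup>2 < d\<close>.\<close>
  define e where "e = sqrt (d / (real (card ?T) + 1))"
  have e: "e > 0" using d by (simp add: e_def add_nonneg_pos)
  have e2: "e\<^sup>2 = d / (real (card ?T) + 1)" using d by (simp add: e_def)
  have "\<exists>\<Phi> :: 'g \<Rightarrow> nat. finite (\<Phi> ` carrier G) \<and> (\<forall>g\<in>carrier G. \<forall>h\<in>carrier G. \<Phi> g = \<Phi> h \<longrightarrow>
      l2norm M (\<lambda>x. indicator (D c) (act g x) - indicator (D c) (act h x)) < e)" for c
    using \<open>almost_periodic (indicator (D c))\<close> e unfolding almost_periodic_def orbit_coloured_def by simp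
  then obtain \<Phi> :: "_ \<Rightarrow> 'g \<Rightarrow> nat" where fin: "\<And>c. finite (\<Phi> c ` carrier G)" and
    \<Phi>: "\<And>c g h. g \<in> carrier G \<Longrightarrow> h \<in> carrier G \<Longrightarrow> \<Phi> c g = \<Phi> c h \<Longrightarrow>
      l2norm M (\<lambda>x. indicator (D c) (act g x) - indicator (D c) (act h x)) < e"
    by metis
  define \<Theta> where "\<Theta> g = restrict (\<lambda>c. \<Phi> c g) ?T" for g
  have "\<Theta> ` carrier G \<subseteq> (\<Pi>\<^sub>E c\<in>?T. \<Phi> c ` carrier G)"
    by (auto simp: \<Theta>_def)
  then have "finite (\<Theta> ` carrier G)"
    by (rule finite_subset) (intro finite_PiE T fin)
  then obtain \<Psi> :: "'g \<Rightarrow> nat" where fin': "finite (\<Psi> ` carrier G)" and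
    \<Psi>: "\<And>g h. g \<in> carrier G \<Longrightarrow> h \<in> carrier G \<Longrightarrow> \<Psi> g = \<Psi> h \<Longrightarrow> \<Theta> g = \<Theta> h"
    by (rule colouring_to_nat) blast
  show ?thesis
  proof (rule that[OF fin'])
    fix g h assume gh: "g \<in> carrier G" "h \<in> carrier G" "\<Psi> g = \<Psi> h"
    note [measurable] = act_measurable[OF gh(1)] act_measurable[OF gh(2)] D_sets
    define E where "E c = {x \<in> space M. indicator (D c) (act g x) \<noteq> (indicator (D c) (act h x) :: real)}" for c
    have E_sets [measurable]: "E c \<in> sets M" for c unfolding E_def by measurable
    have pE: "prob (E c) \<le> e\<^sup>2" if c: "c \<in> ?T" for c
    proof -
      have "\<Phi> c g = \<Phi> c h" using fun_cong[OF \<Psi>[OF gh], of c] c by (simp add: \<Theta>_def)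
      from \<Phi>[OF gh(1,2) this]
      have "(l2norm M (\<lambda>x. indicator (D c) (act g x) - indicator (D c) (act h x)))\<^sup>2 \<le> e\<^sup>2"
        by (intro power_mono) auto
      moreover have "(l2norm M (\<lambda>x. indicator (D c) (act g x) - indicator (D c) (act h x)))\<^sup>2
          = (\<integral>x. indicator (E c) x \<partial>M)"
        unfolding l2norm_sq
        by (rule Bochner_Integration.integral_cong) (auto simp: E_def indicator_def)
      ultimately show ?thesis by simp
    qed
    have "{x \<in> space M. b (act g x) \<noteq> b (act h x)} \<subseteq> (\<Union>c\<in>?T. E c)"
      using act_space gh by (fastforce simp: E_def D_def indicator_def)
    then have "prob {x \<in> space M. b (act g x) \<noteq> b (act h x)} \<le> prob (\<Union>c\<in>?T. E c)"
      by (rule finite_measure_mono[OF _ sets.finite_UN[OF T E_sets]])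
    also have "\<dots> \<le> (\<Sum>c\<in>?T. prob (E c))"
      by (rule measure_UNION_le[OF T]) simp
    also have "\<dots> \<le> real (card ?T) * e\<^sup>2"
      using sum_mono[OF pE] by simp
    also have "\<dots> < (real (card ?T) + 1) * e\<^sup>2"
      using e by simp
    also have "\<dots> = d" unfolding e2 by (simp add: add_nonneg_eq_0_iff)
    finally show "prob {x \<in> space M. b (act g x) \<noteq> b (act h x)} < d" .
  qed
qed

lemma seq_ent_upper:
  assumes a: "simple_function M a" and b: "simple_function \<K> b" and e: "e > 0"
    and s: "\<And>n. s n \<in> carrier G"
  obtains C where "\<And>n. ent (\<lambda>x. map (\<lambda>i. a (act (s i) x)) [1..<Suc n]) \<le> C + real n * (cent a b + e)"
proof -
  note bM = simple_function_kronecker[OF b]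
  obtain d where d: "d > 0" and close: "\<And>X Y Y'. simple_function M X \<Longrightarrow> simple_function M Y \<Longrightarrow> simple_function M Y' \<Longrightarrow>
      X ` space M \<subseteq> a ` space M \<Longrightarrow> Y ` space M \<subseteq> b ` space M \<Longrightarrow> Y' ` space M \<subseteq> b ` space M \<Longrightarrow>
      prob {x \<in> space M. Y x \<noteq> Y' x} < d \<Longrightarrow> cent X Y \<le> cent X Y' + e"
    by (rule cent_close[OF simple_functionD(1)[OF a] simple_functionD(1)[OF bM] e]) blast
  obtain \<Phi> :: "'g \<Rightarrow> nat" where fin: "finite (\<Phi> ` carrier G)" and
    \<Phi>: "\<And>g h. g \<in> carrier G \<Longrightarrow> h \<in> carrier G \<Longrightarrow> \<Phi> g = \<Phi> h \<Longrightarrow>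
      prob {x \<in> space M. b (act g x) \<noteq> b (act h x)} < d"
    by (rule kronecker_simple_coloured[OF b d]) blast
  \<comment> \<open>One representative for each colour class; the translates of \<open>b\<close> by
    \<open>g\<close> and by \<open>\<rho> g\<close> disagree on a set of measure below
    \<open>d\<close>.\<close>
  define \<rho> where "\<rho> g = inv_into (carrier G) \<Phi> (\<Phi> g)" for g
  have \<rho>: "\<rho> g \<in> carrier G" "\<Phi> (\<rho> g) = \<Phi> g" if "g \<in> carrier G" for g
    using that unfolding \<rho>_def by (auto intro: inv_into_into f_inv_into_f)
  have "finite (\<rho> ` carrier G)"
    using fin unfolding \<rho>_def by (simp add: image_image[symmetric, of "inv_into (carrier G) \<Phi>" \<Phi>])
  then obtain gs where gs: "set gs = \<rho> ` carrier G" using finite_list by blast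
  have gsG: "set gs \<subseteq> carrier G" unfolding gs using \<rho> by auto
  have "\<exists>j<length gs. gs ! j = \<rho> (s i)" for i
  proof -
    have "\<rho> (s i) \<in> set gs" unfolding gs using s by auto
    then show ?thesis by (auto simp: in_set_conv_nth)
  qed
  then obtain j where j: "\<And>i. j i < length gs" "\<And>i. gs ! j i = \<rho> (s i)" by metis
  let ?L = "\<lambda>x. map (\<lambda>g. b (act g x)) gs"
  have L: "simple_function M ?L"
    by (intro simple_function_list simple_function_act bM) (use gsG in auto)
  show ?thesis
  proof (rule that)
    fix n
    let ?c = "\<lambda>i x. b (act (\<rho> (s i)) x)"
    have "ent (\<lambda>x. map (\<lambda>i. a (act (s i) x)) [1..<Suc n])
        \<le> ent (\<lambda>x. map (\<lambda>i. ?c i x) [1..<Suc n]) + (\<Sum>i=1..n. cent (\<lambda>x. a (act (s i) x)) (?c i))"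
      by (rule ent_list_le) (intro simple_function_act a bM s \<rho>)+
    \<comment> \<open>All representatives are read off the single finite list \<open>?L\<close>,
      whose entropy does not depend on \<open>n\<close>; it is the constant
      \<open>C\<close>.\<close>
    also have "ent (\<lambda>x. map (\<lambda>i. ?c i x) [1..<Suc n]) \<le> ent ?L"
      using ent_compose_le[OF L, of "\<lambda>l. map (\<lambda>i. l ! j i) [1..<Suc n]"] by (simp add: j cong: map_cong)
    also have "(\<Sum>i=1..n. cent (\<lambda>x. a (act (s i) x)) (?c i)) \<le> (\<Sum>i=1..n. cent a b + e)"
    proof (rule sum_mono)
      fix i
      \<comment> \<open>Replacing the representative by \<open>s i\<close> itself costs
        \<open>e\<close>, after which invariance removes \<open>s i\<close>.\<close>
      have "cent (\<lambda>x. a (act (s i) x)) (?c i)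
          \<le> cent (\<lambda>x. a (act (s i) x)) (\<lambda>x. b (act (s i) x)) + e"
        by (rule close) (use act_space s \<rho> \<Phi> in \<open>auto intro!: simple_function_act a bM\<close>)
      then show "cent (\<lambda>x. a (act (s i) x)) (?c i) \<le> cent a b + e"
        by (simp add: cent_act[OF a bM s])
    qed
    finally show "ent (\<lambda>x. map (\<lambda>i. a (act (s i) x)) [1..<Suc n]) \<le> ent ?L + real n * (cent a b + e)"
      by simp
  qed
qed

end

section \<open>The partition as a map and its conditional expectations\<close>

locale partitioned_action = pmp_action M G act
  for M :: "'x measure" and G :: "('g, 'b) monoid_scheme" (structure) and act +
  fixes \<alpha> :: "'x set set"
  assumes finite_\<alpha>: "finite \<alpha>" and \<alpha>_sets: "\<alpha> \<subseteq> sets M"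
    and disjoint_\<alpha>: "disjoint \<alpha>" and Union_\<alpha>: "\<Union>\<alpha> = space M"
begin

definition cell :: "'x \<Rightarrow> 'x set" where
  "cell x = (THE A. A \<in> \<alpha> \<and> x \<in> A)"

lemma cell_eq: "A \<in> \<alpha> \<Longrightarrow> x \<in> A \<Longrightarrow> cell x = A"
  unfolding cell_def using disjoint_\<alpha> by (intro the_equality) (auto simp: disjoint_def)

lemma cell_in: assumes "x \<in> space M" shows "cell x \<in> \<alpha>" "x \<in> cell x"
proof -
  obtain A where "A \<in> \<alpha>" "x \<in> A" using Union_\<alpha> assms by blast
  then show "cell x \<in> \<alpha>" "x \<in> cell x" using cell_eq by auto
qed

lemma cell_vimage: "A \<in> \<alpha> \<Longrightarrow> cell -` {A} \<inter> space M = A"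
  using cell_eq cell_in Union_\<alpha> by auto

text \<open>Only an inclusion, since \<alpha> may contain the empty set.\<close>

lemma cell_image: "cell ` space M \<subseteq> \<alpha>"
  using cell_in by auto

lemma simple_function_cell: "simple_function M cell"
  unfolding simple_function_def
  using finite_subset[OF cell_image finite_\<alpha>] cell_in(1) cell_vimage \<alpha>_sets by auto

lemma sum_indicator_\<alpha>: "x \<in> space M \<Longrightarrow> (\<Sum>A\<in>\<alpha>. indicator A x :: real) = 1"
proof -
  assume x: "x \<in> space M"
  have "x \<in> A \<longleftrightarrow> A = cell x" if "A \<in> \<alpha>" for A
    using cell_eq[OF that] cell_in(2)[OF x] by blast
  then have "(\<Sum>A\<in>\<alpha>. indicator A x :: real) = (\<Sum>A\<in>\<alpha>. if A = cell x then 1 else 0)"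
    by (intro sum.cong) (simp_all add: indicator_def)
  then show ?thesis using cell_in(1)[OF x] finite_\<alpha> by simp
qed

sublocale kr: finite_measure_subalgebra M \<K>
  by unfold_locales (rule subalgebra_kronecker)

text \<open>A version of the conditional expectation of the indicator, truncated so that it lies in
  the unit interval everywhere and not just almost everywhere.\<close>

definition kexp :: "'x set \<Rightarrow> 'x \<Rightarrow> real" where
  "kexp A x = min 1 (max 0 (real_cond_exp M \<K> (indicator A) x))"

definition kentropy :: real where
  "kentropy = (\<Sum>A\<in>\<alpha>. \<integral>x. eta (kexp A x) \<partial>M)"

lemma kexp_measurable_kronecker [measurable]: "kexp A \<in> borel_measurable \<K>"
  unfolding kexp_def[abs_def] by measurable

lemma kexp_measurable [measurable]: "kexp A \<in> borel_measurable M"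
  using measurable_from_subalg[OF subalgebra_kronecker kexp_measurable_kronecker] .

lemma kexp_bounds: "0 \<le> kexp A x" "kexp A x \<le> 1"
  by (auto simp: kexp_def)

lemma kexp_AE:
  assumes A: "A \<in> sets M"
  shows "AE x in M. real_cond_exp M \<K> (indicator A) x = kexp A x"
proof -
  have int: "integrable M (indicator A :: 'x \<Rightarrow> real)"
    using A by (intro integrable_real_bounded[where c = 1]) (auto simp: indicator_def)
  have "AE x in M. real_cond_exp M \<K> (indicator A) x \<ge> 0"
    by (rule kr.real_cond_exp_ge_c[OF int]) (auto simp: indicator_def)
  moreover have "AE x in M. real_cond_exp M \<K> (indicator A) x \<le> 1"
    by (rule kr.real_cond_exp_le_c[OF int]) (auto simp: indicator_def)
  ultimately show ?thesis by eventually_elim (simp add: kexp_def)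
qed

lemma integral_kexp:
  assumes A: "A \<in> sets M" and k: "k \<in> borel_measurable \<K>" "k \<in> L2 M"
  shows "(\<integral>x. kexp A x * k x \<partial>M) = (\<integral>x. indicator A x * k x \<partial>M)"
proof -
  have [measurable]: "k \<in> borel_measurable M" using k(2) by (simp add: L2_def)
  have "(\<integral>x. kexp A x * k x \<partial>M) = (\<integral>x. k x * real_cond_exp M \<K> (indicator A) x \<partial>M)"
    by (rule integral_cong_AE) (use kexp_AE[OF A] in auto)
  also have "\<dots> = (\<integral>x. k x * indicator A x \<partial>M)"
    by (rule kr.real_cond_exp_intg(2)[OF L2_integrable_mult[OF k(2) indicator_L2[OF A]] k(1)]) (use A in simp)
  finally show ?thesis by (simp add: mult.commute)
qed

lemma sum_kexp_AE: "AE x in M. (\<Sum>A\<in>\<alpha>. kexp A x) = 1"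
proof -
  have int: "integrable M (indicator A :: 'x \<Rightarrow> real)" if "A \<in> \<alpha>" for A
    using \<alpha>_sets that by (intro integrable_real_bounded[where c = 1]) (auto simp: indicator_def)
  \<comment> \<open>Extended by 0 because additivity of the conditional expectation asks for
    integrability at every index, not only at those in \<alpha>.\<close>
  let ?f = "\<lambda>A x. if A \<in> \<alpha> then indicator A x else (0::real)"
  have "AE x in M. real_cond_exp M \<K> (\<lambda>x. \<Sum>A\<in>\<alpha>. ?f A x) x = (\<Sum>A\<in>\<alpha>. real_cond_exp M \<K> (?f A) x)"
  proof (rule kr.real_cond_exp_sum)
    show "integrable M (?f A)" for A by (cases "A \<in> \<alpha>") (simp_all add: int)
  qed
  moreover have "AE x in M. real_cond_exp M \<K> (\<lambda>x. \<Sum>A\<in>\<alpha>. ?f A x) x = real_cond_exp M \<K> (\<lambda>x. 1) x"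
    by (rule kr.real_cond_exp_cong) (use \<alpha>_sets in \<open>auto simp: sum_indicator_\<alpha> intro!: borel_measurable_sum\<close>)
  moreover have "AE x in M. real_cond_exp M \<K> (\<lambda>x. 1) x = 1"
    by (rule kr.real_cond_exp_F_meas) auto
  moreover have "AE x in M. \<forall>A\<in>\<alpha>. real_cond_exp M \<K> (indicator A) x = kexp A x"
    using kexp_AE \<alpha>_sets finite_\<alpha> by (intro AE_finite_allI) auto
  ultimately show ?thesis
  proof eventually_elim
    case (elim x)
    have "(\<Sum>A\<in>\<alpha>. kexp A x) = (\<Sum>A\<in>\<alpha>. real_cond_exp M \<K> (?f A) x)"
      using elim(4) by (intro sum.cong) auto
    from this elim(1)[symmetric] elim(2) elim(3) show ?case by (rule trans[OF trans[OF trans]])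
  qed
qed

lemma cond_entropy_kronecker: "cond_entropy M \<alpha> \<K> = kentropy"
  unfolding cond_entropy_def kentropy_def
proof (rule sum.cong[OF refl])
  fix A assume "A \<in> \<alpha>"
  then have "A \<in> sets M" using \<alpha>_sets by auto
  from kexp_AE[OF this]
  show "(\<integral>x. - real_cond_exp M \<K> (indicator A) x * ln (real_cond_exp M \<K> (indicator A) x) \<partial>M)
      = (\<integral>x. eta (kexp A x) \<partial>M)"
    by (intro integral_cong_AE) (auto simp: eta_def)
qed

lemma integrable_kexp_indicator:
  assumes "C \<in> sets M" "g \<in> carrier G"
  shows "integrable M (\<lambda>x. kexp A (act g x) * indicator C x)"
proof -
  have [measurable]: "act g \<in> measurable M M" using assms by auto
  show ?thesis
    using assms(1) by (intro integrable_real_bounded[where c = 1])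
      (use kexp_bounds in \<open>auto simp: indicator_def\<close>)
qed

lemma integrable_eta_kexp_indicator:
  assumes "C \<in> sets M" "g \<in> carrier G"
  shows "integrable M (\<lambda>x. eta (kexp A (act g x)) * indicator C x)"
proof -
  have [measurable]: "act g \<in> measurable M M" using assms by auto
  show ?thesis
    using assms(1) by (intro integrable_real_bounded[where c = 2])
      (use kexp_bounds abs_eta_le_2 in \<open>auto simp: indicator_def\<close>)
qed

text \<open>Translated by \<open>g\<close> for the lower bound; the upper bound uses it at the
  neutral element.\<close>

lemma sum_integral_kexp_indicator:
  assumes C: "C \<in> sets M" and g: "g \<in> carrier G"
  shows "(\<Sum>A\<in>\<alpha>. \<integral>x. kexp A (act g x) * indicator C x \<partial>M) = prob C"
proof -
  have [measurable]: "act g \<in> measurable M M" using g by auto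
  have "(\<Sum>A\<in>\<alpha>. \<integral>x. kexp A (act g x) * indicator C x \<partial>M)
      = (\<integral>x. (\<Sum>A\<in>\<alpha>. kexp A (act g x)) * indicator C x \<partial>M)"
    by (simp add: Bochner_Integration.integral_sum integrable_kexp_indicator[OF C g] sum_distrib_right)
  also have "\<dots> = (\<integral>x. indicator C x \<partial>M)"
    by (rule integral_cong_AE) (use AE_act[OF g sum_kexp_AE] C in auto)
  finally show ?thesis using C by simp
qed

text \<open>The level sets of \<open>E\<close> partition the space, and the remaining integral is
  invariant under \<open>g\<close>.\<close>

lemma sum_integral_eta_kexp:
  assumes E: "simple_function M E" and g: "g \<in> carrier G"
  shows "(\<Sum>c\<in>E ` space M. \<Sum>A\<in>\<alpha>. \<integral>x. eta (kexp A (act g x)) * indicator (E -` {c} \<inter> space M) x \<partial>M)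
    = kentropy"
proof -
  let ?S = "E ` space M" and ?C = "\<lambda>c. E -` {c} \<inter> space M"
  have S: "finite ?S" using simple_functionD(1)[OF E] .
  have "(\<Sum>c\<in>?S. \<Sum>A\<in>\<alpha>. \<integral>x. eta (kexp A (act g x)) * indicator (?C c) x \<partial>M)
      = (\<Sum>A\<in>\<alpha>. \<Sum>c\<in>?S. \<integral>x. eta (kexp A (act g x)) * indicator (?C c) x \<partial>M)"
    by (rule sum.swap)
  also have "\<dots> = (\<Sum>A\<in>\<alpha>. \<integral>x. eta (kexp A x) \<partial>M)"
  proof (rule sum.cong[OF refl])
    fix A
    have one: "(\<Sum>c\<in>?S. indicator (?C c) x :: real) = 1" if x: "x \<in> space M" for x
    proof -
      have "(\<Sum>c\<in>?S. indicator (?C c) x :: real) = (\<Sum>c\<in>?S. if c = E x then 1 else 0)"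
        by (rule sum.cong) (use x in \<open>auto simp: indicator_def\<close>)
      then show ?thesis using S x by simp
    qed
    have "(\<Sum>c\<in>?S. \<integral>x. eta (kexp A (act g x)) * indicator (?C c) x \<partial>M)
        = (\<integral>x. (\<Sum>c\<in>?S. eta (kexp A (act g x)) * indicator (?C c) x) \<partial>M)"
      by (rule Bochner_Integration.integral_sum[symmetric])
        (rule integrable_eta_kexp_indicator[OF simple_functionD(2)[OF E] g])
    also have "\<dots> = (\<integral>x. eta (kexp A (act g x)) \<partial>M)"
      by (rule Bochner_Integration.integral_cong) (simp_all add: one flip: sum_distrib_left)
    also have "\<dots> = (\<integral>x. eta (kexp A x) \<partial>M)"
      using integral_act[OF g, of "\<lambda>x. eta (kexp A x)"] by simp
    finally show "(\<Sum>c\<in>?S. \<integral>x. eta (kexp A (act g x)) * indicator (?C c) x \<partial>M) = (\<integral>x. eta (kexp A x) \<partial>M)" .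
  qed
  finally show ?thesis by (simp add: kentropy_def)
qed

text \<open>In the limit of vanishing correlations \<open>g\<close> makes \<open>\<alpha>\<close> independent of \<open>E\<close> relative to the
  Kronecker algebra.\<close>
lemma ent_step:
  fixes E :: "'x \<Rightarrow> 'c"
  assumes E: "simple_function M E" and e: "e > 0"
  obtains g where "g \<in> carrier G" "ent E + kentropy - e \<le> ent (\<lambda>x. (E x, cell (act g x)))"
proof -
  let ?S = "E ` space M"
  define C where "C c = E -` {c} \<inter> space M" for c
  have S: "finite ?S" using simple_functionD(1)[OF E] .
  have C: "C c \<in> sets M" for c unfolding C_def using simple_functionD(2)[OF E] .
  define k where "k = real (card (?S \<times> \<alpha>)) + 1"
  have k: "k > 0" by (simp add: k_def add_nonneg_pos)
  obtain d where d: "d > 0" and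
    dd: "\<And>s t. 0 \<le> s \<Longrightarrow> s \<le> 1 \<Longrightarrow> 0 \<le> t \<Longrightarrow> t \<le> 1 \<Longrightarrow> \<bar>s - t\<bar> < d \<Longrightarrow> \<bar>eta s - eta t\<bar> < e / k"
    using eta_uniformly_continuous[of "e / k"] e k by (metis divide_pos_pos)
  let ?f = "\<lambda>A x. indicator A x - kexp A x"
  interpret wm: weakly_mixing_family M G act \<alpha> ?f 1
  proof
    show "finite \<alpha>" by (rule finite_\<alpha>)
    fix A assume A: "A \<in> \<alpha>"
    then have AM [measurable]: "A \<in> sets M" using \<alpha>_sets by auto
    show "?f A \<in> borel_measurable M" by measurable
    show "\<bar>?f A x\<bar> \<le> 1" for x
      using kexp_bounds[of A x] by (auto simp: indicator_def)
    fix u assume u: "almost_periodic u"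
    have "kexp A \<in> L2 M" by (rule bounded_L2[where c = 1]) (use kexp_bounds in auto)
    then show "(\<integral>x. ?f A x * u x \<partial>M) = 0"
      using integral_kexp[OF AM almost_periodic_measurable[OF u] almost_periodic_L2[OF u]]
        L2_integrable_mult[OF indicator_L2[OF AM] almost_periodic_L2[OF u]] L2_integrable_mult[OF _ almost_periodic_L2[OF u]]
      by (simp add: left_diff_distrib)
  qed
  \<comment> \<open>One \<open>g\<close> for all cells \<open>C c\<close> and all \<open>A\<close>
    in \<alpha>; the bound \<open>d\<^sup>2\<close> on the sum of squares makes every single
    correlation smaller than \<open>d\<close>.\<close>
  have "\<exists>g\<in>carrier G. (\<Sum>c\<in>?S. \<Sum>A\<in>\<alpha>. (\<integral>y. ?f A (act g y) * indicator (C c) y \<partial>M)\<^sup>2) < d\<^sup>2"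
    by (rule wm.correlations_vanish[OF S]) (use d indicator_L2[OF C] in auto)
  then obtain g where g: "g \<in> carrier G" and
    small: "(\<Sum>c\<in>?S. \<Sum>A\<in>\<alpha>. (\<integral>y. ?f A (act g y) * indicator (C c) y \<partial>M)\<^sup>2) < d\<^sup>2" by blast
  have [measurable]: "act g \<in> measurable M M" using g by auto
  let ?X = "\<lambda>x. (E x, cell (act g x))"
  \<comment> \<open>The mass that the pair \<open>(c, A)\<close> would have if the correlation with
    \<open>1 - E(.|\<K>)\<close> of the indicator of \<open>A\<close> vanished exactly.\<close>
  define q where "q c A = (\<integral>x. kexp A (act g x) * indicator (C c) x \<partial>M)" for c A
  have q01: "0 \<le> q c A" "q c A \<le> 1" for c A
  proof -
    show "0 \<le> q c A" unfolding q_def using kexp_bounds by (intro integral_nonneg_AE AE_I2) auto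
    have "q c A \<le> (\<integral>x. 1 \<partial>M)" unfolding q_def
      by (rule integral_mono[OF integrable_kexp_indicator[OF C g]])
        (use kexp_bounds in \<open>auto split: split_indicator\<close>)
    then show "q c A \<le> 1" by (simp add: prob_space)
  qed
  have pq: "\<bar>pr ?X (c, A) - q c A\<bar> < d" if c: "c \<in> ?S" and A: "A \<in> \<alpha>" for c A
  proof -
    have [measurable]: "A \<in> sets M" "C c \<in> sets M" using A \<alpha>_sets C by auto
    let ?I = "\<lambda>x. indicator A (act g x) * indicator (C c) x :: real"
    have cA: "cell (act g x) = A \<longleftrightarrow> act g x \<in> A" if "x \<in> space M" for x
      using cell_eq[OF A] cell_in(2)[OF act_space[OF g that]] by blast
    have "pr ?X (c, A) = prob {x \<in> space M. act g x \<in> A \<and> x \<in> C c}"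
      unfolding pr_def C_def
      by (rule arg_cong[where f = prob]) (use cA in auto)
    also have "\<dots> = (\<integral>x. indicator {x \<in> space M. act g x \<in> A \<and> x \<in> C c} x \<partial>M)"
      by simp
    also have "\<dots> = (\<integral>x. ?I x \<partial>M)"
      by (rule Bochner_Integration.integral_cong) (auto simp: indicator_def)
    finally have "pr ?X (c, A) - q c A = (\<integral>x. ?I x - kexp A (act g x) * indicator (C c) x \<partial>M)"
      unfolding q_def
      by (subst Bochner_Integration.integral_diff[OF _ integrable_kexp_indicator[OF C g]])
        (auto intro!: integrable_real_bounded[where c = 1] simp: indicator_def)
    also have "\<dots> = (\<integral>y. ?f A (act g y) * indicator (C c) y \<partial>M)"
      by (simp add: left_diff_distrib)
    finally have eq: "pr ?X (c, A) - q c A = (\<integral>y. ?f A (act g y) * indicator (C c) y \<partial>M)" .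
    have "(pr ?X (c, A) - q c A)\<^sup>2 \<le> (\<Sum>A\<in>\<alpha>. (\<integral>y. ?f A (act g y) * indicator (C c) y \<partial>M)\<^sup>2)"
      unfolding eq by (rule member_le_sum[OF A]) (auto simp: finite_\<alpha>)
    also have "\<dots> \<le> (\<Sum>c\<in>?S. \<Sum>A\<in>\<alpha>. (\<integral>y. ?f A (act g y) * indicator (C c) y \<partial>M)\<^sup>2)"
      by (rule member_le_sum[OF c]) (auto simp: S sum_nonneg)
    finally have "\<bar>pr ?X (c, A) - q c A\<bar>\<^sup>2 < d\<^sup>2" using small by simp
    then show ?thesis using d by (meson less_imp_le power_less_imp_less_base)
  qed
  have "ent ?X = (\<Sum>c\<in>?S. \<Sum>A\<in>\<alpha>. eta (pr ?X (c, A)))"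
    using ent_superset[of "?S \<times> \<alpha>" ?X] S finite_\<alpha> cell_in(1)[OF act_space[OF g]]
    by (auto simp: sum.cartesian_product')
  moreover have "(\<Sum>c\<in>?S. \<Sum>A\<in>\<alpha>. eta (q c A)) - (\<Sum>c\<in>?S. \<Sum>A\<in>\<alpha>. eta (pr ?X (c, A)))
      \<le> (\<Sum>c\<in>?S. \<Sum>A\<in>\<alpha>. e / k)"
    unfolding sum_subtractf[symmetric]
  proof (intro sum_mono)
    fix c A assume "c \<in> ?S" "A \<in> \<alpha>"
    from dd[OF pr_nonneg pr_le_1 q01 pq[OF this]]
    show "eta (q c A) - eta (pr ?X (c, A)) \<le> e / k" by linarith
  qed
  moreover have "(\<Sum>c\<in>?S. \<Sum>A\<in>\<alpha>. e / k) \<le> e"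
  proof -
    have "(\<Sum>c\<in>?S. \<Sum>A\<in>\<alpha>. e / k) = real (card (?S \<times> \<alpha>)) * (e / k)"
      by (simp add: card_cartesian_product)
    also have "\<dots> \<le> k * (e / k)" using e k by (intro mult_right_mono) (auto simp: k_def)
    finally show ?thesis using k by simp
  qed
  \<comment> \<open>Jensen on each cell of \<open>E\<close>. The masses \<open>q c A\<close> add up
    to \<open>pr E c\<close>, so the logarithmic terms sum to \<open>- ent E\<close>.\<close>
  moreover have "ent E + kentropy \<le> (\<Sum>c\<in>?S. \<Sum>A\<in>\<alpha>. eta (q c A))"
  proof -
    have "kentropy = (\<Sum>c\<in>?S. \<Sum>A\<in>\<alpha>. \<integral>x. eta (kexp A (act g x)) * indicator (C c) x \<partial>M)"
      using sum_integral_eta_kexp[OF E g] by (simp add: C_def)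
    also have "\<dots> \<le> (\<Sum>c\<in>?S. \<Sum>A\<in>\<alpha>. eta (q c A) + q c A * ln (prob (C c)))"
      by (intro sum_mono eta_Jensen[OF _ _ C]) (use kexp_bounds in \<open>auto simp: q_def\<close>)
    also have "\<dots> = (\<Sum>c\<in>?S. (\<Sum>A\<in>\<alpha>. eta (q c A)) - eta (pr E c))"
    proof (rule sum.cong[OF refl])
      fix c
      have "(\<Sum>A\<in>\<alpha>. q c A) = pr E c"
        using sum_integral_kexp_indicator[OF C g, of c] by (simp add: q_def pr_def C_def)
      then show "(\<Sum>A\<in>\<alpha>. eta (q c A) + q c A * ln (prob (C c))) = (\<Sum>A\<in>\<alpha>. eta (q c A)) - eta (pr E c)"
        by (simp add: sum.distrib flip: sum_distrib_right) (simp add: eta_def pr_def C_def)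
    qed
    finally show ?thesis by (simp add: sum_subtractf ent_def)
  qed
  ultimately have "ent E + kentropy - e \<le> ent ?X" by linarith
  with g show ?thesis by (rule that)
qed

text \<open>\<open>b\<close> rounds all the functions \<open>kexp A\<close> at mesh
  \<open>1 / n\<close>, so each of them oscillates by at most \<open>1 / n < d\<close> on a level
  set of \<open>b\<close>, and Jensen's inequality is nearly an equality there.\<close>

lemma kronecker_approximation:
  assumes e: "e > 0"
  obtains b :: "'x \<Rightarrow> int list" where "simple_function \<K> b" "cent cell b \<le> kentropy + e"
proof -
  define k where "k = real (card \<alpha>) + 1"
  have k: "k > 0" by (simp add: k_def add_nonneg_pos)
  obtain d where d: "d > 0" and
    dd: "\<And>s t. 0 \<le> s \<Longrightarrow> s \<le> 1 \<Longrightarrow> 0 \<le> t \<Longrightarrow> t \<le> 1 \<Longrightarrow> \<bar>s - t\<bar> < d \<Longrightarrow> \<bar>eta s - eta t\<bar> < e / k"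
    using eta_uniformly_continuous[of "e / k"] e k by (metis divide_pos_pos)
  obtain N where N: "inverse (real (Suc N)) < d" using reals_Archimedean[OF d] by blast
  define n where "n = real (Suc N)"
  have n: "n > 0" "1 / n < d" using N by (auto simp: n_def divide_inverse)
  obtain As where As: "set As = \<alpha>" using finite_list[OF finite_\<alpha>] by blast
  define b where "b x = map (\<lambda>A. \<lfloor>n * kexp A x\<rfloor>) As" for x
  have "simple_function \<K> (\<lambda>x. \<lfloor>n * kexp A x\<rfloor>)" for A
    unfolding simple_function_def
  proof (intro conjI ballI)
    have "(\<lambda>x. \<lfloor>n * kexp A x\<rfloor>) ` space \<K> \<subseteq> {0..\<lfloor>n\<rfloor>}"
      using kexp_bounds[of A] n(1) by (auto intro!: floor_mono simp: mult_left_le)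
    then show "finite ((\<lambda>x. \<lfloor>n * kexp A x\<rfloor>) ` space \<K>)"
      using finite_subset by blast
    have "(\<lambda>x. \<lfloor>n * kexp A x\<rfloor>) \<in> measurable \<K> (count_space UNIV)" by measurable
    then show "(\<lambda>x. \<lfloor>n * kexp A x\<rfloor>) -` {c} \<inter> space \<K> \<in> sets \<K>" for c
      by (rule measurable_sets) simp
  qed
  then have b: "simple_function \<K> b"
    unfolding b_def[abs_def] by (intro simple_function_list)
  note bM = simple_function_kronecker[OF b]
  let ?T = "b ` space M" and ?X = "\<lambda>x. (cell x, b x)"
  define D where "D c = b -` {c} \<inter> space M" for c
  have T: "finite ?T" using simple_functionD(1)[OF bM] .
  have DK: "D c \<in> sets \<K>" for c
    unfolding D_def using simple_functionD(2)[OF b, of "{c}"] by (simp add: space_kronecker)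
  have DM: "D c \<in> sets M" for c unfolding D_def using simple_functionD(2)[OF bM] .
  define q where "q c A = (\<integral>x. kexp A x * indicator (D c) x \<partial>M)" for c A
  \<comment> \<open>An exact identity, since \<open>D c\<close> belongs to the Kronecker
    algebra.\<close>
  have pq: "pr ?X (A, c) = q c A" if A: "A \<in> \<alpha>" for A c
  proof -
    have AM [measurable]: "A \<in> sets M" "D c \<in> sets M" using A \<alpha>_sets DM by auto
    have "pr ?X (A, c) = prob (A \<inter> D c)"
      unfolding pr_def D_def
      by (rule arg_cong[where f = prob]) (use cell_eq[OF A] cell_in Union_\<alpha> A in auto)
    also have "\<dots> = (\<integral>x. indicator (A \<inter> D c) x \<partial>M)" by simp
    also have "\<dots> = (\<integral>x. indicator A x * indicator (D c) x \<partial>M)"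
      by (rule Bochner_Integration.integral_cong) (auto simp: indicator_def)
    also have "\<dots> = q c A"
      unfolding q_def
      by (rule integral_kexp[symmetric]) (use DK indicator_L2[OF DM] in auto)
    finally show ?thesis .
  qed
  have "ent ?X = (\<Sum>A\<in>\<alpha>. \<Sum>c\<in>?T. eta (pr ?X (A, c)))"
    using ent_superset[of "\<alpha> \<times> ?T" ?X] T finite_\<alpha> cell_in(1)
    by (auto simp: sum.cartesian_product')
  also have "\<dots> = (\<Sum>c\<in>?T. \<Sum>A\<in>\<alpha>. eta (q c A))"
    by (subst sum.swap) (simp add: pq)
  finally have "cent cell b = (\<Sum>c\<in>?T. (\<Sum>A\<in>\<alpha>. eta (q c A)) - eta (pr b c))"
    by (simp add: cent_def sum_subtractf) (simp add: ent_def)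
  also have "\<dots> = (\<Sum>c\<in>?T. \<Sum>A\<in>\<alpha>. eta (q c A) + q c A * ln (prob (D c)))"
  proof (rule sum.cong[OF refl])
    fix c
    \<comment> \<open>The neutral element is inserted to match the lemma for translated
      functions.\<close>
    have "(\<Sum>A\<in>\<alpha>. \<integral>x. kexp A (act \<one> x) * indicator (D c) x \<partial>M) = (\<Sum>A\<in>\<alpha>. q c A)"
      unfolding q_def by (intro sum.cong Bochner_Integration.integral_cong refl) (simp add: act_one)
    then have "(\<Sum>A\<in>\<alpha>. q c A) = pr b c"
      using sum_integral_kexp_indicator[OF DM one_closed, of c] by (simp add: pr_def D_def)
    then show "(\<Sum>A\<in>\<alpha>. eta (q c A)) - eta (pr b c) = (\<Sum>A\<in>\<alpha>. eta (q c A) + q c A * ln (prob (D c)))"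
      by (simp add: sum.distrib flip: sum_distrib_right) (simp add: eta_def pr_def D_def)
  qed
  also have "\<dots> \<le> (\<Sum>c\<in>?T. \<Sum>A\<in>\<alpha>. (\<integral>x. eta (kexp A x) * indicator (D c) x \<partial>M) + e / k * prob (D c))"
  proof (intro sum_mono)
    fix c A assume A: "A \<in> \<alpha>"
    show "eta (q c A) + q c A * ln (prob (D c))
        \<le> (\<integral>x. eta (kexp A x) * indicator (D c) x \<partial>M) + e / k * prob (D c)"
    proof (rule eta_oscillation[OF kexp_measurable _ DM q_def dd])
      fix x y assume xy: "x \<in> D c" "y \<in> D c"
      then have "b x = b y" by (simp add: D_def)
      then have "\<lfloor>n * kexp A x\<rfloor> = \<lfloor>n * kexp A y\<rfloor>" using A As by (simp add: b_def)
      then have "\<bar>n * kexp A x - n * kexp A y\<bar> \<le> 1" by linarith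
      then have "n * \<bar>kexp A x - kexp A y\<bar> \<le> 1"
        using n(1) by (simp add: abs_mult flip: right_diff_distrib)
      then show "\<bar>kexp A x - kexp A y\<bar> \<le> 1 / n" using n(1) by (simp add: field_simps)
    qed (use kexp_bounds n in auto)
  qed
  also have "\<dots> = (\<Sum>c\<in>?T. \<Sum>A\<in>\<alpha>. \<integral>x. eta (kexp A (act \<one> x)) * indicator (D c) x \<partial>M)
      + real (card \<alpha>) * (e / k) * (\<Sum>c\<in>?T. prob (D c))"
  proof -
    have "(\<integral>x. eta (kexp A (act \<one> x)) * indicator (D c) x \<partial>M) = (\<integral>x. eta (kexp A x) * indicator (D c) x \<partial>M)"
      for A c
      by (intro Bochner_Integration.integral_cong refl) (simp add: act_one)
    then show ?thesis by (simp add: sum.distrib sum_distrib_left mult.assoc)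
  qed
  also have "(\<Sum>c\<in>?T. prob (D c)) = 1"
    using sum_pr_all[OF bM] by (simp add: pr_def D_def)
  also have "(\<Sum>c\<in>?T. \<Sum>A\<in>\<alpha>. \<integral>x. eta (kexp A (act \<one> x)) * indicator (D c) x \<partial>M) = kentropy"
    unfolding D_def by (rule sum_integral_eta_kexp[OF bM one_closed])
  finally have "cent cell b \<le> kentropy + real (card \<alpha>) * (e / k)" by simp
  also have "real (card \<alpha>) * (e / k) \<le> k * (e / k)"
    using e k by (intro mult_right_mono) (auto simp: k_def)
  also have "k * (e / k) = e" using k by simp
  finally have "cent cell b \<le> kentropy + e" by simp
  with b show ?thesis by (rule that)
qed

end


section \<open>Sequence entropy\<close>

context partitioned_action
begin

abbreviation cells :: "(nat \<Rightarrow> 'g) \<Rightarrow> nat \<Rightarrow> 'x \<Rightarrow> 'x set list" where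
  "cells s n \<equiv> \<lambda>x. map (\<lambda>i. cell (act (s i) x)) [1..<Suc n]"

lemma simple_function_cells:
  "(\<And>n. s n \<in> carrier G) \<Longrightarrow> simple_function M (cells s n)"
  by (intro simple_function_list simple_function_act simple_function_cell)

text \<open>Distinct choices \<open>c\<close> may give the same set, but only the empty one:
  nonempty members of the join correspond one to one to the values of \<open>cells s n\<close>. The
  empty set contributes \<open>eta 0 = 0\<close>.\<close>

lemma part_entropy_join_pullbacks:
  assumes s: "\<And>n. s n \<in> carrier G"
  shows "part_entropy M (join_pullbacks (space M) act s n \<alpha>) = ent (cells s n)"
proof -
  let ?L = "cells s n" and ?J = "join_pullbacks (space M) act s n \<alpha>"
  define F where "F l = ?L -` {l} \<inter> space M" for l
  have L: "simple_function M ?L" using simple_function_cells[OF s] .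
  have Fx: "F (?L x) = space M \<inter> (\<Inter>i\<in>{1..n}. act (s i) -` cell (act (s i) x))" if x: "x \<in> space M" for x
  proof -
    have "cell (act (s i) y) = cell (act (s i) x) \<longleftrightarrow> act (s i) y \<in> cell (act (s i) x)"
      if y: "y \<in> space M" for y i
      using cell_in(2)[OF act_space[OF s y]] cell_eq[OF cell_in(1)[OF act_space[OF s x]]] by metis
    moreover have "?L y = ?L x \<longleftrightarrow> (\<forall>i\<in>{1..n}. cell (act (s i) y) = cell (act (s i) x))" for y
      by (auto simp del: upt_Suc)
    ultimately show ?thesis by (auto simp: F_def simp del: upt_Suc)
  qed
  have J: "?J - {{}} = F ` (?L ` space M)"
  proof (intro equalityI subsetI)
    fix B assume "B \<in> ?J - {{}}"
    then obtain c where c: "\<And>i. i \<in> {1..n} \<Longrightarrow> c i \<in> \<alpha>"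
      and B: "B = space M \<inter> (\<Inter>i\<in>{1..n}. act (s i) -` c i)"
      unfolding join_pullbacks_def by blast
    obtain x where x: "x \<in> B" using \<open>B \<in> ?J - {{}}\<close> by blast
    have xM: "x \<in> space M" using x B by auto
    have "cell (act (s i) x) = c i" if "i \<in> {1..n}" for i
      using cell_eq[OF c[OF that]] x B that by auto
    then have "B = F (?L x)" unfolding B Fx[OF xM] by auto
    then show "B \<in> F ` (?L ` space M)" using xM by blast
  next
    fix B assume "B \<in> F ` (?L ` space M)"
    then obtain x where x: "x \<in> space M" and B: "B = F (?L x)" by blast
    have "x \<in> B" unfolding B F_def using x by simp
    moreover have "B \<in> ?J"
      unfolding B Fx[OF x] join_pullbacks_def using cell_in(1)[OF act_space[OF s x]]
      by (intro CollectI exI[of _ "\<lambda>i. cell (act (s i) x)"]) auto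
    ultimately show "B \<in> ?J - {{}}" by auto
  qed
  have fin: "finite (?L ` space M)" using simple_functionD(1)[OF L] .
  have finJ: "finite ?J"
    using fin J by (metis finite_Diff2 finite_imageI finite.emptyI finite_insert)
  have inj: "inj_on F (?L ` space M)"
  proof (rule inj_onI)
    fix l m assume "l \<in> ?L ` space M" "F l = F m"
    then obtain x where x: "x \<in> space M" "l = ?L x" by blast
    then have "x \<in> F l" by (simp add: F_def)
    then have "x \<in> F m" using \<open>F l = F m\<close> by simp
    then show "l = m" using x(2) by (simp add: F_def)
  qed
  have "part_entropy M ?J = (\<Sum>B\<in>?J. eta (prob B))"
    by (simp add: part_entropy_def eta_def sum_negf)
  also have "\<dots> = (\<Sum>B\<in>?J - {{}}. eta (prob B))"
    by (rule sum.mono_neutral_right[OF finJ]) auto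
  also have "\<dots> = (\<Sum>l\<in>?L ` space M. eta (prob (F l)))"
    unfolding J by (simp only: sum.reindex[OF inj] o_def)
  also have "\<dots> = ent ?L" by (simp add: ent_def pr_def F_def)
  finally show ?thesis .
qed

lemma seq_entropy_le:
  assumes s: "\<And>n. s n \<in> carrier G"
  shows "seq_entropy M act s \<alpha> \<le> ereal kentropy"
proof (rule ereal_le_epsilon2)
  fix e :: real assume e: "e > 0"
  then have e3: "e / 3 > 0" by simp
  obtain b :: "'x \<Rightarrow> int list" where b: "simple_function \<K> b" and bk: "cent cell b \<le> kentropy + e / 3"
    using kronecker_approximation[OF e3] .
  obtain C where C: "\<And>n. ent (cells s n) \<le> C + real n * (cent cell b + e / 3)"
    by (rule seq_ent_upper[OF simple_function_cell b e3, of s, OF s]) blast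
  have "(\<lambda>n. C / real n) \<longlonglongrightarrow> 0" by (rule lim_const_over_n)
  from order_tendstoD(2)[OF this e3]
  have "\<forall>\<^sub>F n in sequentially. ereal (ent (cells s n) / real n) \<le> ereal (kentropy + e)"
    using eventually_gt_at_top[of 0]
  proof eventually_elim
    case (elim n)
    have "ent (cells s n) / real n \<le> (C + real n * (cent cell b + e / 3)) / real n"
      using C by (intro divide_right_mono) auto
    also have "\<dots> = C / real n + (cent cell b + e / 3)"
      using elim by (simp add: add_divide_distrib)
    also have "\<dots> \<le> kentropy + e" using elim bk by linarith
    finally show ?case by simp
  qed
  then have "limsup (\<lambda>n. ereal (ent (cells s n) / real n)) \<le> ereal (kentropy + e)"
    by (rule Limsup_bounded)
  then show "seq_entropy M act s \<alpha> \<le> ereal kentropy + ereal e"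
    by (simp add: seq_entropy_def part_entropy_join_pullbacks[OF s])
qed

text \<open>Greedy choice: \<open>ent_step\<close> applied to the join of all translates chosen so
  far provides the next element, which raises the entropy by at least \<open>kentropy - e\<close>.
  The sequence depends on \<open>e\<close>.\<close>

lemma exists_seq_entropy_ge:
  assumes e: "e > 0"
  obtains s where "\<And>n::nat. s n \<in> carrier G" "ereal (kentropy - e) \<le> seq_entropy M act s \<alpha>"
proof -
  let ?P = "\<lambda>s n g. g \<in> carrier G \<and>
    ent (\<lambda>x. map (\<lambda>i. cell (act (s i) x)) [1..<n]) + kentropy - e
      \<le> ent (\<lambda>x. (map (\<lambda>i. cell (act (s i) x)) [1..<n], cell (act g x)))"
  have "\<exists>s. \<forall>n. ?P s n (s n)"
  proof (rule dependent_wellorder_choice)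
    \<comment> \<open>The condition at \<open>n\<close> involves \<open>s\<close> only at indices
      from 1 to \<open>n - 1\<close>, as recursive choice requires.\<close>
    fix r and s t :: "nat \<Rightarrow> 'g" and n assume "\<And>i. i < n \<Longrightarrow> s i = t i"
    then have "map (\<lambda>i. cell (act (s i) x)) [1..<n] = map (\<lambda>i. cell (act (t i) x)) [1..<n]" for x
      by simp
    then show "?P s n r = ?P t n r" by (simp only:)
  next
    fix n and s :: "nat \<Rightarrow> 'g" assume "\<And>i. i < n \<Longrightarrow> ?P s i (s i)"
    then have "simple_function M (\<lambda>x. map (\<lambda>i. cell (act (s i) x)) [1..<n])"
      by (intro simple_function_list simple_function_act simple_function_cell) simp
    then obtain g where "?P s n g"
      by (rule ent_step[OF _ e]) blast
    then show "\<exists>g. ?P s n g" by blast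
  qed
  then obtain s where s: "\<And>n. s n \<in> carrier G"
    and step: "\<And>n. ent (\<lambda>x. map (\<lambda>i. cell (act (s i) x)) [1..<n]) + kentropy - e
      \<le> ent (\<lambda>x. (map (\<lambda>i. cell (act (s i) x)) [1..<n], cell (act (s n) x)))"
    by blast
  have ge: "real n * (kentropy - e) \<le> ent (cells s n)" for n
  proof (induction n)
    case 0
    show ?case by (auto simp: ent_def intro!: sum_nonneg eta_nonneg pr_nonneg pr_le_1)
  next
    case (Suc n)
    have "real (Suc n) * (kentropy - e) \<le> ent (cells s n) + kentropy - e"
      using Suc by (simp add: distrib_right)
    \<comment> \<open>The choice condition at index \<open>Suc n\<close>, whose list
      \<open>[1..<Suc n]\<close> is the one in \<open>cells s n\<close>.\<close>
    also have "\<dots> \<le> ent (\<lambda>x. (cells s n x, cell (act (s (Suc n)) x)))"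
      by (rule step)
    also have "\<dots> \<le> ent (cells s (Suc n))"
      using ent_compose_le[OF simple_function_cells[of s "Suc n", OF s], of "\<lambda>l. (butlast l, last l)"] by simp
    finally show ?case .
  qed
  have "\<forall>\<^sub>F n in sequentially. ereal (kentropy - e) \<le> ereal (ent (cells s n) / real n)"
    using eventually_gt_at_top[of 0]
  proof eventually_elim
    case (elim n)
    then show ?case using ge[of n] by (simp add: field_simps)
  qed
  then have "ereal (kentropy - e) \<le> limsup (\<lambda>n. ereal (ent (cells s n) / real n))"
    by (intro le_Limsup) auto
  then show ?thesis
    by (intro that[OF s]) (simp add: seq_entropy_def part_entropy_join_pullbacks[OF s])
qed

theorem max_seq_entropy_eq:
  "max_seq_entropy M G act \<alpha> = ereal (cond_entropy M \<alpha> \<K>)"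
  unfolding cond_entropy_kronecker max_seq_entropy_def
proof (rule antisym)
  show "(SUP s\<in>{s. \<forall>n. s n \<in> carrier G}. seq_entropy M act s \<alpha>) \<le> ereal kentropy"
    by (rule SUP_least) (auto intro: seq_entropy_le)
  show "ereal kentropy \<le> (SUP s\<in>{s. \<forall>n. s n \<in> carrier G}. seq_entropy M act s \<alpha>)"
  proof (rule ereal_le_epsilon2)
    fix e :: real assume "e > 0"
    then obtain s where s: "\<And>n::nat. s n \<in> carrier G" and ge: "ereal (kentropy - e) \<le> seq_entropy M act s \<alpha>"
      by (rule exists_seq_entropy_ge) blast
    have "ereal (kentropy - e) \<le> (SUP s\<in>{s. \<forall>n. s n \<in> carrier G}. seq_entropy M act s \<alpha>)"
      by (rule order_trans[OF ge]) (use s in \<open>auto intro: SUP_upper\<close>)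
    then have "ereal (kentropy - e) + ereal e \<le> (SUP s\<in>{s. \<forall>n. s n \<in> carrier G}. seq_entropy M act s \<alpha>) + ereal e"
      by (rule add_right_mono)
    then show "ereal kentropy \<le> (SUP s\<in>{s. \<forall>n. s n \<in> carrier G}. seq_entropy M act s \<alpha>) + ereal e"
      by simp
  qed
qed

end

text \<open>A measure-preserving map pulls null sets back to null sets, which gives measurability
  for the completed algebras.\<close>

lemma completion_measure_preserving:
  assumes f: "f \<in> measurable M M" and d: "distr M M f = M"
  shows "f \<in> measurable (completion M) (completion M)" "distr (completion M) (completion M) f = completion M"
proof -
  have fM: "f \<in> measurable (completion M) M" using measurable_completion[OF f] .
  have dM: "distr (completion M) M f = M" using distr_completion[OF f] d by simp
  show "f \<in> measurable (completion M) (completion M)"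
    by (rule completion.measurable_completion2[OF fM]) (simp add: dM)
  show "distr (completion M) (completion M) f = completion M"
    using completion.completion_distr_eq[OF fM] by (simp add: dM)
qed

theorem theoremB3:
  fixes G :: "('g, 'b) monoid_scheme"
    and X :: "'x::metric_space set"
    and M :: "'x measure"
    and act :: "'g \<Rightarrow> 'x \<Rightarrow> 'x"
    and \<alpha> :: "'x set set"
  assumes "group G"
    and "countable (carrier G)" and "infinite (carrier G)"
    and "compact X"
    and "\<And>g. g \<in> carrier G \<Longrightarrow> continuous_on X (act g) \<and> act g ` X \<subseteq> X"
    and "\<And>x. x \<in> X \<Longrightarrow> act \<one>\<^bsub>G\<^esub> x = x"
    and "\<And>g h x. g \<in> carrier G \<Longrightarrow> h \<in> carrier G \<Longrightarrow> x \<in> X \<Longrightarrow>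
           act (g \<otimes>\<^bsub>G\<^esub> h) x = act g (act h x)"
    and "sets M = sets (restrict_space borel X)"
    and "prob_space M"
    and "\<And>g B. g \<in> carrier G \<Longrightarrow> B \<in> sets M \<Longrightarrow> measure M (act g -` B \<inter> X) = measure M B"
    and "finite \<alpha>" and "\<alpha> \<subseteq> sets (completion M)" and "disjoint \<alpha>" and "\<Union>\<alpha> = X"
  shows "max_seq_entropy (completion M) G act \<alpha> =
         ereal (cond_entropy (completion M) \<alpha> (kronecker_algebra (completion M) G act))"
proof -
  interpret M: prob_space M by fact
  have sp: "space M = X"
    using sets_eq_imp_space_eq[OF assms(8)] by (simp add: space_restrict_space)
  have meas: "act g \<in> measurable M M" if g: "g \<in> carrier G" for g
  proof -
    have "act g \<in> restrict_space borel X \<rightarrow>\<^sub>M restrict_space borel X"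
      using assms(5)[OF g]
      by (intro measurable_restrict_space2 borel_measurable_continuous_on_restrict)
        (auto simp: space_restrict_space)
    then show ?thesis by (simp cong: measurable_cong_sets add: assms(8))
  qed
  have pres: "distr M M (act g) = M" if g: "g \<in> carrier G" for g
  proof (rule measure_eqI)
    fix B assume "B \<in> sets (distr M M (act g))"
    then have B: "B \<in> sets M" by simp
    have "emeasure (distr M M (act g)) B = ennreal (measure M (act g -` B \<inter> space M))"
      using B by (simp add: emeasure_distr[OF meas[OF g]] M.emeasure_eq_measure)
    also have "\<dots> = emeasure M B"
      using assms(10)[OF g B] by (simp add: sp M.emeasure_eq_measure)
    finally show "emeasure (distr M M (act g)) B = emeasure M B" .
  qed simp
  interpret N: prob_space "completion M"
    by (rule prob_spaceI) (simp add: M.emeasure_space_1)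
  interpret G: group G by fact
  interpret partitioned_action "completion M" G act \<alpha>
  proof
    fix g assume g: "g \<in> carrier G"
    show "act g \<in> completion M \<rightarrow>\<^sub>M completion M" "distr (completion M) (completion M) (act g) = completion M"
      using completion_measure_preserving[OF meas[OF g] pres[OF g]] .
  qed (use assms in \<open>simp_all add: sp\<close>)
  show ?thesis by (rule max_seq_entropy_eq)
qed


end
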